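(* Let $p\neq q$ be positive integers with $p$ odd and $q$ even. Let $f\in L^2_s(\mu^p)$ and $g\in L^2_s(\mu^q)$, and set $$X=I_p(f),\qquad Y=I_q(g),\qquad Z=X+Y,$$ where $I_m$ denotes the $m$-th multiple Wiener--Itô integral. Assume $E[Z^2]=1$, and write $\kappa_4(Z)=E[Z^4]-3$. Then $$d_{\mathrm{TV}}(Z,N(0,1))\;\le\;\sqrt{6\,\kappa_4(Z)}.$$ In particular, for such fixed $p,q$, if $f_n\in L^2_s(\mu^p)$ and $g_n\in L^2_s(\mu^q)$ ($n\ge 1$) are such that $Z_n=I_p(f_n)+I_q(g_n)$ satisfies $E[Z_n^2]=1$ for all $n$ and $\kappa_4(Z_n)=E[Z_n^4]-3\to 0$ as $n\to\infty$, then $$d_{\mathrm{TV}}(Z_n,N(0,1))\longrightarrow 0.$$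
   Context: $(E,\mathcal E,\mu)$ is a $\sigma$-finite measure space, $H=L^2(E,\mu)$ is the associated real Hilbert space, and $W=\{W(h):h\in H\}$ is an isonormal Gaussian process over $H$ on some probability space, i.e. a centered Gaussian family with $E[W(h)W(h')]=\langle h,h'\rangle_H$. For $m\ge 1$, $L^2_s(\mu^m)$ is the space of real functions in $L^2(E^m,\mu^m)$ that are symmetric in their $m$ arguments ($\mu^m$-a.e.). $I_m$ denotes the $m$-th multiple Wiener--Itô integral with respect to $W$: the unique continuous linear map from $L^2_s(\mu^m)$ to $L^2(\Omega)$ such that $I_m(h^{\otimes m})=H_m(W(h))$ for every $h\in H$ with $\|h\|_H=1$, where $H_m$ is the $m$-th monic (probabilists') Hermite polynomial. It satisfies $E[I_m(f)I_m(g)]=m!\,\langle f,g\rangle_{L^2(\mu^m)}$. (When $A_1,\dots,A_m$ are pairwise disjoint sets of finite measure, the integral of the symmetrization of $\mathbf 1_{A_1}\otimes\cdots\otimes\mathbf 1_{A_m}$ is $W(\mathbf 1_{A_1})\cdots W(\mathbf 1_{A_m})$.) $N(0,1)$ is the standard normal law, and for real random variables (or laws) $F,G$, $d_{\mathrm{TV}}(F,G)=\sup_{B}|P(F\in B)-P(G\in B)|$, the supremum being over Borel sets $B\subset\mathbb R$. *)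

theory Defs
  imports "HOL-Probability.Probability" "HOL-Combinatorics.Permutations"
begin

text \<open>
  Elements of \<open>L\<^sup>2\<close> are represented by functions rather than by classes of a.e. equal
  functions; accordingly, identities between random variables below hold almost surely.
\<close>

definition L2 :: "'a measure \<Rightarrow> ('a \<Rightarrow> real) set" where
  "L2 M = {f \<in> borel_measurable M. integrable M (\<lambda>x. (f x)\<^sup>2)}"

definition L2_norm :: "'a measure \<Rightarrow> ('a \<Rightarrow> real) \<Rightarrow> real" where
  "L2_norm M f = sqrt (\<integral>x. (f x)\<^sup>2 \<partial>M)"

text \<open>\<open>E\<^sup>m\<close> consists of the (extensional) functions from \<open>{..<m}\<close> to \<open>E\<close>.\<close>

definition power_measure :: "nat \<Rightarrow> 'a measure \<Rightarrow> (nat \<Rightarrow> 'a) measure" where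
  "power_measure m M = PiM {..<m} (\<lambda>_. M)"

definition L2_sym :: "nat \<Rightarrow> 'a measure \<Rightarrow> ((nat \<Rightarrow> 'a) \<Rightarrow> real) set" where
  "L2_sym m M = {f \<in> L2 (power_measure m M).
     \<forall>\<pi>. \<pi> permutes {..<m} \<longrightarrow> (AE x in power_measure m M. f (x \<circ> \<pi>) = f x)}"

definition tensor_power :: "nat \<Rightarrow> ('a \<Rightarrow> real) \<Rightarrow> (nat \<Rightarrow> 'a) \<Rightarrow> real" where
  "tensor_power m h x = (\<Prod>i<m. h (x i))"

text \<open>Monic (probabilists') Hermite polynomials.\<close>

fun hermite :: "nat \<Rightarrow> real \<Rightarrow> real" where
  "hermite 0 x = 1"
| "hermite (Suc 0) x = x"
| "hermite (Suc (Suc n)) x = x * hermite (Suc n) x - real (Suc n) * hermite n x"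

text \<open>The law \<open>N(0, \<sigma>\<^sup>2)\<close>, which is the Dirac mass at \<open>0\<close> if \<open>\<sigma> = 0\<close>.\<close>

definition centered_normal :: "real \<Rightarrow> real measure" where
  "centered_normal \<sigma> =
     (if \<sigma> = 0 then return borel 0 else density lborel (\<lambda>x. ennreal (normal_density 0 \<sigma> x)))"

text \<open>
  A family of random variables is centered Gaussian if all its finite linear combinations have a
  (possibly degenerate) centered normal law.
\<close>

definition centered_gaussian_family ::
    "'w measure \<Rightarrow> 'i set \<Rightarrow> ('i \<Rightarrow> 'w \<Rightarrow> real) \<Rightarrow> bool" where
  "centered_gaussian_family P T X \<longleftrightarrow>
     (\<forall>t\<in>T. X t \<in> borel_measurable P) \<and>
     (\<forall>A c. finite A \<longrightarrow> A \<subseteq> T \<longrightarrow>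
        (\<exists>\<sigma>\<ge>0. distr P borel (\<lambda>\<omega>. \<Sum>t\<in>A. c t * X t \<omega>) = centered_normal \<sigma>))"

definition isonormal_process ::
    "'w measure \<Rightarrow> 'a measure \<Rightarrow> (('a \<Rightarrow> real) \<Rightarrow> 'w \<Rightarrow> real) \<Rightarrow> bool" where
  "isonormal_process P M W \<longleftrightarrow>
     prob_space P \<and>
     centered_gaussian_family P (L2 M) W \<and>
     (\<forall>h\<in>L2 M. \<forall>h'\<in>L2 M. (\<integral>\<omega>. W h \<omega> * W h' \<omega> \<partial>P) = (\<integral>x. h x * h' x \<partial>M))"

text \<open>
  \<open>J\<close> is (a version of) the \<open>m\<close>-th multiple Wiener--Ito integral with respect to \<open>W\<close>, i.e. the
  unique continuous linear map \<open>L\<^sup>2\<^sub>s(\<mu>\<^sup>m) \<rightarrow> L\<^sup>2(\<Omega>)\<close> with \<open>J (h\<^sup>\<otimes>\<^sup>m) = H\<^sub>m(W(h))\<close> for unit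
  vectors \<open>h\<close>. Continuity of the linear map is expressed as boundedness, which also makes \<open>J\<close>
  compatible with a.e. equality.
\<close>

definition multiple_wiener_integral ::
    "'w measure \<Rightarrow> 'a measure \<Rightarrow> (('a \<Rightarrow> real) \<Rightarrow> 'w \<Rightarrow> real) \<Rightarrow> nat \<Rightarrow>
       (((nat \<Rightarrow> 'a) \<Rightarrow> real) \<Rightarrow> 'w \<Rightarrow> real) \<Rightarrow> bool" where
  "multiple_wiener_integral P M W m J \<longleftrightarrow>
     (\<forall>f\<in>L2_sym m M. J f \<in> L2 P) \<and>
     (\<forall>f\<in>L2_sym m M. \<forall>g\<in>L2_sym m M. \<forall>a b.
        AE \<omega> in P. J (\<lambda>x. a * f x + b * g x) \<omega> = a * J f \<omega> + b * J g \<omega>) \<and>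
     (\<exists>C. \<forall>f\<in>L2_sym m M. L2_norm P (J f) \<le> C * L2_norm (power_measure m M) f) \<and>
     (\<forall>h\<in>L2 M. L2_norm M h = 1 \<longrightarrow>
        (AE \<omega> in P. J (tensor_power m h) \<omega> = hermite m (W h \<omega>)))"

definition tv_dist :: "real measure \<Rightarrow> real measure \<Rightarrow> real" where
  "tv_dist \<nu> \<nu>' = (SUP B\<in>sets borel. \<bar>measure \<nu> B - measure \<nu>' B\<bar>)"

text \<open>Total variation distance between the law of \<open>Z\<close> and \<open>N(0, 1)\<close>.\<close>

definition tv_dist_std_normal :: "'w measure \<Rightarrow> ('w \<Rightarrow> real) \<Rightarrow> real" where
  "tv_dist_std_normal P Z = tv_dist (distr P borel Z) std_normal_distribution"

text \<open>The fourth cumulant of a centered random variable of unit variance.\<close>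

definition kappa4 :: "'w measure \<Rightarrow> ('w \<Rightarrow> real) \<Rightarrow> real" where
  "kappa4 P Z = (\<integral>\<omega>. (Z \<omega>) ^ 4 \<partial>P) - 3"

end

theory Submission
  imports Defs "HOL-Real_Asymp.Real_Asymp"
begin

text \<open>
  By density of the tensor powers, by boundedness of the multiple integrals and by
  hypercontractivity it suffices to treat \<open>X\<close> and \<open>Y\<close> that are polynomials in finitely many
  independent standard normal variables, linear combinations of \<open>H\<^sub>p(a \<cdot> x)\<close> and \<open>H\<^sub>q(a \<cdot> x)\<close>
  respectively, with \<open>a\<close> a unit vector. These are eigenfunctions of \<open>A = x \<cdot> \<nabla> - \<Delta>\<close> with eigenvalues
  \<open>p\<close> and \<open>q\<close>. Write \<open>\<Gamma>(F,G) = \<nabla>F \<cdot> \<nabla>G\<close>. Stein's method and one integration by parts give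
  \<open>\<bar>E h(Z) - E h(N)\<bar> \<le> 2 E\<bar>1 - \<Gamma>(X/p + Y/q, Z)\<bar>\<close> for \<open>0 \<le> h \<le> 1\<close>.

  To bound the variance of \<open>\<Gamma>(X/p + Y/q, Z)\<close>, decompose \<open>XY = \<Sum>Q\<^sub>l\<close>, \<open>l \<le> min p q\<close>, into eigenfunctions
  of \<open>A\<close> with eigenvalues \<open>p + q - 2l\<close>; then \<open>\<Gamma>(X,Y) = \<Sum>l Q\<^sub>l\<close>, whence
  \<open>E \<Gamma>(X,Y)\<^sup>2 \<le> min p q \<cdot> E[XY \<Gamma>(X,Y)]\<close>. For \<open>X = Y\<close> this controls \<open>Var \<Gamma>(X,X)\<close> by \<open>\<kappa>\<^sub>4(X)\<close>, and
  \<open>E[XY \<Gamma>(X,Y)]\<close> is in turn at most \<open>min p q / 2\<close> times \<open>Cov(X\<^sup>2,Y\<^sup>2)\<close>. As \<open>p + q\<close> is odd, the mixed terms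
  \<open>E[X\<^sup>3Y]\<close>, \<open>E[XY\<^sup>3]\<close> and \<open>E[\<Gamma>(X,X)\<Gamma>(X,Y)]\<close> vanish, because the factors lie in eigenspaces of
  different parities. Altogether the variance is at most \<open>2/3 \<kappa>\<^sub>4(Z)\<close>, which yields the bound
  \<open>sqrt (8/3 \<kappa>\<^sub>4(Z))\<close>.
\<close>

subsection \<open>Gaussian integration by parts\<close>

text \<open>As \<open>p\<close> and \<open>q\<close> differ, Z is not an eigenfunction of A. The
  variable V = X/p + Y/q satisfies A V = Z, which is why Gamma(V,Z) enters Stein's identity
  E[Z f(Z)] = E[Gamma(V,Z) f'(Z)]. Writing kappa(F) = E F^4 - 3 (E F^2)^2, parity gives kappa(Z) =
  kappa(X) + kappa(Y) + 6 Cov(X^2,Y^2). All three summands are nonnegative, so a small kappa(Z)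
  makes each of them small, and each controls one piece of Gamma(V,Z). The factor 2/3 is 2 times
  1/3: the 1/3 comes from Var(Gamma(X,X)/p) \<le> kappa(X)/3, the 2 from estimating the product of
  the centred diagonal pieces by their squares. Two obstacles shape the passage to the limit. The
  polynomial approximants of Z need not have unit variance, so the finite-dimensional estimates
  carry v = E Z^2 and an error (1 - v)^2. And L2 continuity of the integrals says nothing about
  fourth moments; hypercontractivity supplies that control.\<close>

lemma Cauchy_Schwarz_integral:
  fixes f g :: "'a \<Rightarrow> real"
  assumes [measurable]: "f \<in> borel_measurable M" "g \<in> borel_measurable M"
    and f: "integrable M (\<lambda>x. (f x)\<^sup>2)" and g: "integrable M (\<lambda>x. (g x)\<^sup>2)"
  shows integrable_mult_L2: "integrable M (\<lambda>x. f x * g x)"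
    and "(\<integral>x. f x * g x \<partial>M)\<^sup>2 \<le> (\<integral>x. (f x)\<^sup>2 \<partial>M) * (\<integral>x. (g x)\<^sup>2 \<partial>M)"
proof -
  show fg: "integrable M (\<lambda>x. f x * g x)"
  proof (rule Bochner_Integration.integrable_bound)
    show "integrable M (\<lambda>x. (f x)\<^sup>2 + (g x)\<^sup>2)" using f g by auto
    have "\<bar>a * b\<bar> \<le> a\<^sup>2 + b\<^sup>2" for a b :: real
    proof -
      have "2 * (\<bar>a\<bar> * \<bar>b\<bar>) \<le> a\<^sup>2 + b\<^sup>2"
        using sum_squares_bound[of "\<bar>a\<bar>" "\<bar>b\<bar>"] by (simp add: mult.assoc)
      moreover have "0 \<le> \<bar>a\<bar> * \<bar>b\<bar>" by simp
      ultimately show ?thesis unfolding abs_mult by linarith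
    qed
    then show "AE x in M. norm (f x * g x) \<le> norm ((f x)\<^sup>2 + (g x)\<^sup>2)"
      by (intro AE_I2) (metis real_norm_def abs_ge_self order_trans)
  qed simp
  define a b c where "a = (\<integral>x. (f x)\<^sup>2 \<partial>M)" and "b = (\<integral>x. f x * g x \<partial>M)" and "c = (\<integral>x. (g x)\<^sup>2 \<partial>M)"
  \<comment> \<open>The integral of (t f + g)^2 is a nonnegative quadratic in t, and the claim is
    the sign of its discriminant.\<close>
  have pos: "0 \<le> a * t\<^sup>2 + 2 * b * t + c" for t
  proof -
    have "0 \<le> (\<integral>x. (t * f x + g x)\<^sup>2 \<partial>M)" by simp
    also have "(\<lambda>x. (t * f x + g x)\<^sup>2) = (\<lambda>x. t\<^sup>2 * (f x)\<^sup>2 + (2 * t) * (f x * g x) + (g x)\<^sup>2)"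
      by (rule ext) (simp add: power2_eq_square algebra_simps)
    also have "integral\<^sup>L M \<dots> = t\<^sup>2 * a + (2 * t) * b + c"
      unfolding a_def b_def c_def using f g fg by simp
    finally show ?thesis by (simp add: algebra_simps)
  qed
  have "a \<ge> 0" unfolding a_def by simp
  have "b\<^sup>2 \<le> a * c"
  proof (cases "a = 0")
    case True
    have "b = 0"
    proof (rule ccontr)
      assume b: "b \<noteq> 0"
      \<comment> \<open>With \<open>a = 0\<close> the quadratic is affine, and at this t it would
        take the value -1.\<close>
      have "2 * b * (-(c+1) / (2*b)) = -(c+1)" using b by (simp add: field_simps)
      then show False using pos[of "-(c+1)/(2*b)"] True by simp
    qed
    then show ?thesis using True by simp
  next
    case False
    then have a: "a > 0" using \<open>a \<ge> 0\<close> by simp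
    \<comment> \<open>The value at the minimizer t = -b/a.\<close>
    have "a * (-b/a)\<^sup>2 + 2 * b * (-b/a) + c = c - b\<^sup>2 / a"
      using a by (simp add: field_simps power2_eq_square)
    then have "b\<^sup>2 / a \<le> c" using pos[of "-b/a"] by linarith
    then show ?thesis using a by (simp add: field_simps)
  qed
  then show "(\<integral>x. f x * g x \<partial>M)\<^sup>2 \<le> (\<integral>x. (f x)\<^sup>2 \<partial>M) * (\<integral>x. (g x)\<^sup>2 \<partial>M)"
    unfolding a_def b_def c_def .
qed

text \<open>No decay of \<open>g\<close> at infinity is assumed. By the fundamental theorem of
  calculus g(k) - g(-k) tends to the integral I of \<open>g'\<close>. If I were nonzero, \<bar>g
  k\<bar> + \<bar>g (-k)\<bar> would stay above \<bar>I\<bar>/2 for all large k, contradicting the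
  integrability of \<open>g\<close>.\<close>

lemma integral_derivative_eq_0:
  fixes g g' :: "real \<Rightarrow> real"
  assumes D: "\<And>x. (g has_real_derivative g' x) (at x)" and c: "\<And>x. isCont g' x"
    and ig: "integrable lborel g" and ig': "integrable lborel g'"
  shows "(\<integral>x. g' x \<partial>lborel) = 0"
proof (rule ccontr)
  define I where "I = (\<integral>x. g' x \<partial>lborel)"
  assume "(\<integral>x. g' x \<partial>lborel) \<noteq> 0"
  then have I: "\<bar>I\<bar> > 0" by (simp add: I_def)
  have [measurable]: "g \<in> borel_measurable borel" using borel_measurable_integrable[OF ig] by simp
  have lim: "((\<lambda>k. \<integral>x. g' x * indicator {-k..k} x \<partial>lborel) \<longlongrightarrow> I) at_top"
    unfolding I_def
  proof (rule integral_dominated_convergence_at_top[where w = "\<lambda>x. \<bar>g' x\<bar>"])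
    show "AE x in lborel. ((\<lambda>k. g' x * indicator {-k..k} x) \<longlongrightarrow> g' x) at_top"
    proof (rule AE_I2)
      fix x :: real
      have "\<forall>\<^sub>F k in at_top. g' x * indicator {-k..k} x = g' x"
        using eventually_ge_at_top[of "\<bar>x\<bar>"] by eventually_elim (auto simp: indicator_def)
      then show "((\<lambda>k. g' x * indicator {-k..k} x) \<longlongrightarrow> g' x) at_top"
        by (rule tendsto_eventually)
    qed
    show "\<forall>\<^sub>F i in at_top. AE x in lborel. norm (g' x * indicator {- i..i} x) \<le> \<bar>g' x\<bar>"
      by (intro always_eventually allI AE_I2) (auto simp: indicator_def)
    show "integrable lborel (\<lambda>x. \<bar>g' x\<bar>)" using ig' by simp
  qed (use ig' in auto)
  have "\<forall>\<^sub>F k in at_top. dist (\<integral>x. g' x * indicator {-k..k} x \<partial>lborel) I < \<bar>I\<bar> / 2"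
    using lim I by (intro tendstoD) auto
  then obtain K where K: "\<And>k. k \<ge> K \<Longrightarrow> dist (\<integral>x. g' x * indicator {-k..k} x \<partial>lborel) I < \<bar>I\<bar> / 2"
    by (auto simp: eventually_at_top_linorder)
  define K0 where "K0 = max K 0"
  have h: "\<bar>I\<bar> / 2 \<le> \<bar>g k\<bar> + \<bar>g (-k)\<bar>" if "k \<ge> K0" for k
  proof -
    have "(\<integral>x. g' x * indicator {-k..k} x \<partial>lborel) = g k - g (-k)"
      using that D c by (intro integral_FTC_Icc_real) (auto simp: K0_def)
    with K[of k] that have "\<bar>g k - g (-k) - I\<bar> < \<bar>I\<bar> / 2" by (auto simp: dist_real_def K0_def)
    then show ?thesis by linarith
  qed
  define C where "C = (\<integral>x. \<bar>g x\<bar> + \<bar>g (-x)\<bar> \<partial>lborel)"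
  have igm: "integrable lborel (\<lambda>x. g (-x))"
    using lborel_integrable_real_affine[OF ig, of "-1" 0] by simp
  \<comment> \<open>Comparison on an interval of length N to the right of \<open>K0\<close>; since N
    is arbitrary, the constant C cannot be finite.\<close>
  have "\<bar>I\<bar> / 2 * real N \<le> C" for N
  proof -
    have "(\<integral>x. \<bar>I\<bar> / 2 * indicator {K0..K0 + real N} x \<partial>lborel) \<le> C"
      unfolding C_def
    proof (rule integral_mono)
      show "integrable lborel (\<lambda>x. \<bar>g x\<bar> + \<bar>g (- x)\<bar>)" using ig igm by auto
      show "integrable lborel (\<lambda>x. \<bar>I\<bar> / 2 * indicator {K0..K0 + real N} x)" by simp
      fix x :: real
      show "\<bar>I\<bar> / 2 * indicator {K0..K0 + real N} x \<le> \<bar>g x\<bar> + \<bar>g (- x)\<bar>"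
        using h[of x] by (auto simp: indicator_def)
    qed
    then show ?thesis by simp
  qed
  moreover obtain N where "C / (\<bar>I\<bar> / 2) < real N" using reals_Archimedean2 by blast
  ultimately show False using I by (simp add: field_simps) (smt (verit))
qed

text \<open>The function d f, with d the standard normal density, has derivative d (f' - x f)
  because d' = -x d; the preceding lemma makes the integral of this derivative vanish.\<close>

lemma std_normal_ibp:
  fixes f f' :: "real \<Rightarrow> real"
  assumes D: "\<And>x. (f has_real_derivative f' x) (at x)" and c: "\<And>x. isCont f' x"
    and "integrable std_normal_distribution f" "integrable std_normal_distribution f'"
    and "integrable std_normal_distribution (\<lambda>x. x * f x)"
  shows "(\<integral>x. x * f x \<partial>std_normal_distribution) = (\<integral>x. f' x \<partial>std_normal_distribution)"
proof -
  have cf: "isCont f x" for x using D DERIV_isCont by blast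
  have [measurable]: "f \<in> borel_measurable borel" "f' \<in> borel_measurable borel"
    using cf c by (auto intro!: borel_measurable_continuous_onI simp: continuous_on_eq_continuous_at)
  let ?d = std_normal_density
  have i1: "integrable lborel (\<lambda>x. ?d x * f x)" and i2: "integrable lborel (\<lambda>x. ?d x * f' x)"
    and i3: "integrable lborel (\<lambda>x. ?d x * (x * f x))"
    using assms(3,4,5) by (auto simp: integrable_density)
  have dd: "(?d has_real_derivative (- x * ?d x)) (at x)" for x
    unfolding std_normal_density_def
    by (rule DERIV_cong, (rule derivative_intros refl | simp)+)
  have "(\<integral>x. ?d x * f' x - ?d x * (x * f x) \<partial>lborel) = 0"
  proof (rule integral_derivative_eq_0[where g = "\<lambda>x. ?d x * f x"])
    show "((\<lambda>x. ?d x * f x) has_real_derivative ?d x * f' x - ?d x * (x * f x)) (at x)" for x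
      by (auto intro!: derivative_eq_intros dd D simp: algebra_simps)
    show "isCont (\<lambda>x. ?d x * f' x - ?d x * (x * f x)) x" for x
      by (intro continuous_intros c cf DERIV_isCont[OF dd])
  qed (use i1 i2 i3 in auto)
  then show ?thesis using i2 i3 by (simp add: integral_density)
qed

section \<open>Integration by parts for the product Gaussian measure\<close>

abbreviation gauss1 :: "real measure" where "gauss1 \<equiv> std_normal_distribution"

definition gauss :: "nat \<Rightarrow> (nat \<Rightarrow> real) measure" where
  "gauss n = PiM {..<n} (\<lambda>_. std_normal_distribution)"

lemma prob_space_gauss1: "prob_space gauss1"
  by (simp add: prob_space_normal_density)

interpretation gauss1: prob_space gauss1 by (rule prob_space_gauss1)

interpretation gauss_pair: product_sigma_finite "\<lambda>_::nat. gauss1"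
  by unfold_locales

lemma prob_space_gauss: "prob_space (gauss n)"
  unfolding gauss_def by (intro prob_space_PiM prob_space_gauss1)

interpretation gauss: prob_space "gauss n" for n by (rule prob_space_gauss)

lemma sets_gauss: "sets (gauss n) = sets (PiM {..<n} (\<lambda>_. borel))"
  unfolding gauss_def by (rule sets_PiM_cong) auto

lemma measurable_gauss_coord [measurable]: "i < n \<Longrightarrow> (\<lambda>x. x i) \<in> borel_measurable (gauss n)"
  unfolding measurable_cong_sets[OF sets_gauss refl] by (rule measurable_component_singleton) simp

text \<open>Tonelli: integrability on the product passes to almost every line in direction i, which
  is where the one-dimensional integration by parts is carried out.\<close>

lemma AE_integrable_section:
  fixes F :: "(nat \<Rightarrow> real) \<Rightarrow> real"
  assumes J: "finite J" "i \<notin> J" and F: "integrable (PiM (insert i J) (\<lambda>_. gauss1)) F"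
  shows "AE x in PiM J (\<lambda>_. gauss1). integrable gauss1 (\<lambda>y. F (x(i := y)))"
proof -
  note [measurable] = borel_measurable_integrable[OF F]
  have "(\<integral>\<^sup>+x. (\<integral>\<^sup>+y. ennreal (norm (F (x(i:=y)))) \<partial>gauss1) \<partial>PiM J (\<lambda>_. gauss1))
     = (\<integral>\<^sup>+x. ennreal (norm (F x)) \<partial>PiM (insert i J) (\<lambda>_. gauss1))"
    using J by (subst gauss_pair.product_nn_integral_insert) auto
  also have "\<dots> < \<infinity>" using F by (simp add: integrable_iff_bounded)
  finally have fin: "(\<integral>\<^sup>+x. (\<integral>\<^sup>+y. ennreal (norm (F (x(i:=y)))) \<partial>gauss1) \<partial>PiM J (\<lambda>_. gauss1)) \<noteq> \<infinity>"
    by simp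
  interpret sigma_finite_measure gauss1 by unfold_locales
  have "(\<lambda>x. \<integral>\<^sup>+y. ennreal (norm (F (x(i:=y)))) \<partial>gauss1) \<in> borel_measurable (PiM J (\<lambda>_. gauss1))"
    by (intro gauss1.borel_measurable_nn_integral) measurable
  from nn_integral_PInf_AE[OF this fin] show ?thesis
  proof (rule AE_mp, intro AE_I2 impI)
    fix x assume x: "x \<in> space (PiM J (\<lambda>_. gauss1))"
      and fi: "(\<integral>\<^sup>+y. ennreal (norm (F (x(i:=y)))) \<partial>gauss1) \<noteq> \<infinity>"
    have "(\<lambda>y. x(i:=y)) \<in> measurable gauss1 (PiM (insert i J) (\<lambda>_. gauss1))"
      using x J by (intro measurable_component_update) auto
    then have "(\<lambda>y. F (x(i:=y))) \<in> borel_measurable gauss1"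
      by (rule measurable_compose) simp
    with fi show "integrable gauss1 (\<lambda>y. F (x(i := y)))"
      by (simp add: integrable_iff_bounded less_top)
  qed
qed

text \<open>One-dimensional integration by parts on almost every line in direction i, followed by
  Fubini. It is stated for general \<open>F\<close> because it is applied both to polynomials and to
  products of a polynomial with the solution of a Stein equation evaluated at Z.\<close>

lemma gauss_ibp:
  fixes F F' :: "(nat \<Rightarrow> real) \<Rightarrow> real"
  assumes i: "i < n"
    and D: "\<And>x. ((\<lambda>t. F (x(i := t))) has_real_derivative F' x) (at (x i))"
    and c: "\<And>x s. isCont (\<lambda>t. F' (x(i := t))) s"
    and iF: "integrable (gauss n) F" and iF': "integrable (gauss n) F'"
    and ixF: "integrable (gauss n) (\<lambda>x. x i * F x)"
  shows "(\<integral>x. x i * F x \<partial>gauss n) = (\<integral>x. F' x \<partial>gauss n)"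
proof -
  define J where "J = {..<n} - {i}"
  have J: "finite J" "i \<notin> J" and ins: "{..<n} = insert i J" using i by (auto simp: J_def)
  note I = iF iF' ixF
  note I = I[unfolded gauss_def ins]
  have "(\<integral>x. x i * F x \<partial>gauss n) =
    (\<integral>x. (\<integral>y. y * F (x(i:=y)) \<partial>gauss1) \<partial>PiM J (\<lambda>_. gauss1))"
    unfolding gauss_def ins using gauss_pair.product_integral_insert[OF J I(3)] by simp
  also have "\<dots> = (\<integral>x. (\<integral>y. F' (x(i:=y)) \<partial>gauss1) \<partial>PiM J (\<lambda>_. gauss1))"
  proof (rule integral_cong_AE)
    show "(\<lambda>x. \<integral>y. y * F (x(i := y)) \<partial>gauss1) \<in> borel_measurable (PiM J (\<lambda>_. gauss1))"
      using borel_measurable_integrable[OF I(3)] borel_measurable_integrable[OF I(1)]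
      by (intro gauss1.borel_measurable_lebesgue_integral) (simp, measurable)
    show "(\<lambda>x. \<integral>y. F' (x(i := y)) \<partial>gauss1) \<in> borel_measurable (PiM J (\<lambda>_. gauss1))"
      using borel_measurable_integrable[OF I(2)]
      by (intro gauss1.borel_measurable_lebesgue_integral) (simp, measurable)
    show "AE x in PiM J (\<lambda>_. gauss1). (\<integral>y. y * F (x(i:=y)) \<partial>gauss1) = (\<integral>y. F' (x(i:=y)) \<partial>gauss1)"
      using AE_integrable_section[OF J I(1)] AE_integrable_section[OF J I(2)]
        AE_integrable_section[OF J I(3)]
    proof eventually_elim
      case (elim x)
      show ?case
      proof (rule std_normal_ibp)
        fix s show "((\<lambda>y. F (x(i := y))) has_real_derivative F' (x(i := s))) (at s)"
          using D[of "x(i := s)"] by simp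
      qed (use c elim in auto)
    qed
  qed
  also have "\<dots> = (\<integral>x. F' x \<partial>gauss n)"
    unfolding gauss_def ins using gauss_pair.product_integral_insert[OF J I(2)] by simp
  finally show ?thesis .
qed

lemma integrable_gauss1_even_power: "integrable gauss1 (\<lambda>y::real. (1 + y\<^sup>2) ^ k)"
proof -
  have "(\<lambda>y::real. (1 + y\<^sup>2) ^ k) = (\<lambda>y. \<Sum>j\<le>k. of_nat (k choose j) * y ^ (2 * j))"
    by (rule ext, subst add.commute, subst binomial_ring) (simp add: power_mult)
  moreover have "integrable gauss1 \<dots>"
    by (intro Bochner_Integration.integrable_sum integrable_mult_right integrable_std_normal_distribution_moment)
  ultimately show ?thesis by simp
qed

subsection \<open>Polynomials in independent standard normal variables\<close>

text \<open>Polynomials are a predicate on functions rather than a syntactic type, so products and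
  partial derivatives are the pointwise ones, and measurability, growth and differentiability follow
  by induction on the construction.\<close>

inductive poly_fun :: "nat \<Rightarrow> ((nat \<Rightarrow> real) \<Rightarrow> real) \<Rightarrow> bool" for n where
  poly_const: "poly_fun n (\<lambda>x. c)"
| poly_coord: "i < n \<Longrightarrow> poly_fun n (\<lambda>x. x i)"
| poly_add: "poly_fun n F \<Longrightarrow> poly_fun n G \<Longrightarrow> poly_fun n (\<lambda>x. F x + G x)"
| poly_mult: "poly_fun n F \<Longrightarrow> poly_fun n G \<Longrightarrow> poly_fun n (\<lambda>x. F x * G x)"

lemma poly_cmult: "poly_fun n F \<Longrightarrow> poly_fun n (\<lambda>x. c * F x)"
  by (rule poly_mult[OF poly_const])

lemma poly_uminus: "poly_fun n F \<Longrightarrow> poly_fun n (\<lambda>x. - F x)"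
  using poly_cmult[of n F "-1"] by simp

lemma poly_diff: "poly_fun n F \<Longrightarrow> poly_fun n G \<Longrightarrow> poly_fun n (\<lambda>x. F x - G x)"
  using poly_add[OF _ poly_uminus, of n F G] by simp

lemma poly_divide: "poly_fun n F \<Longrightarrow> poly_fun n (\<lambda>x. F x / c)"
  using poly_cmult[of n F "inverse c"] by (simp add: field_simps)

lemma poly_power: "poly_fun n F \<Longrightarrow> poly_fun n (\<lambda>x. F x ^ k)"
  by (induction k) (auto intro: poly_const poly_mult)

lemma poly_sum: "(\<And>i. i \<in> I \<Longrightarrow> poly_fun n (F i)) \<Longrightarrow> poly_fun n (\<lambda>x. \<Sum>i\<in>I. F i x)"
  by (induction I rule: infinite_finite_induct) (auto intro: poly_const poly_add)

lemmas poly_intros = poly_const poly_coord poly_add poly_cmult poly_mult poly_uminus poly_diff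
  poly_divide poly_power poly_sum

text \<open>A bound of product form is chosen because its integral over the product measure
  factorizes. All factors are at least 1, so adding exponents dominates both summands of a sum, just
  as it does for a product.\<close>

lemma poly_fun_bound:
  assumes "poly_fun n F"
  shows "\<exists>C k. 0 \<le> C \<and> (\<forall>x. \<bar>F x\<bar> \<le> C * (\<Prod>i<n. (1 + (x i)\<^sup>2) ^ k))"
  using assms
proof induction
  case (poly_const c)
  show ?case by (rule exI[of _ "\<bar>c\<bar>"], rule exI[of _ 0]) simp
next
  case (poly_coord i)
  have "\<bar>x i\<bar> \<le> 1 * (\<Prod>i<n. (1 + (x i)\<^sup>2) ^ 1)" for x :: "nat \<Rightarrow> real"
  proof -
    have "\<bar>x i\<bar> \<le> 1 + (x i)\<^sup>2"
      using sum_squares_bound[of 1 "\<bar>x i\<bar>"] by simp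
    also have "\<dots> = (\<Prod>j\<in>{i}. 1 + (x j)\<^sup>2)" by simp
    also have "\<dots> \<le> (\<Prod>j<n. 1 + (x j)\<^sup>2)"
      using poly_coord by (intro prod_mono2) auto
    finally show ?thesis by simp
  qed
  then show ?case by (intro exI[of _ 1]) auto
next
  case (poly_add F G)
  then obtain C k D l where C: "0 \<le> C" "\<And>x. \<bar>F x\<bar> \<le> C * (\<Prod>i<n. (1 + (x i)\<^sup>2) ^ k)"
    and D: "0 \<le> D" "\<And>x. \<bar>G x\<bar> \<le> D * (\<Prod>i<n. (1 + (x i)\<^sup>2) ^ l)" by blast
  have "\<bar>F x + G x\<bar> \<le> (C + D) * (\<Prod>i<n. (1 + (x i)\<^sup>2) ^ (k + l))" for x
  proof -
    have "(\<Prod>i<n. (1 + (x i)\<^sup>2) ^ k) \<le> (\<Prod>i<n. (1 + (x i)\<^sup>2) ^ (k + l))"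
      by (intro prod_mono conjI power_increasing) auto
    moreover have "(\<Prod>i<n. (1 + (x i)\<^sup>2) ^ l) \<le> (\<Prod>i<n. (1 + (x i)\<^sup>2) ^ (k + l))"
      by (intro prod_mono conjI power_increasing) auto
    ultimately show ?thesis
      using C(2)[of x] D(2)[of x] mult_left_mono[OF _ C(1)] mult_left_mono[OF _ D(1)]
      by (smt (verit) distrib_right)
  qed
  then show ?case using C D by (intro exI[of _ "C + D"]) auto
next
  case (poly_mult F G)
  then obtain C k D l where C: "0 \<le> C" "\<And>x. \<bar>F x\<bar> \<le> C * (\<Prod>i<n. (1 + (x i)\<^sup>2) ^ k)"
    and D: "0 \<le> D" "\<And>x. \<bar>G x\<bar> \<le> D * (\<Prod>i<n. (1 + (x i)\<^sup>2) ^ l)" by blast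
  have "\<bar>F x * G x\<bar> \<le> (C * D) * (\<Prod>i<n. (1 + (x i)\<^sup>2) ^ (k + l))" for x
  proof -
    have "\<bar>F x\<bar> * \<bar>G x\<bar> \<le> (C * (\<Prod>i<n. (1 + (x i)\<^sup>2) ^ k)) * (D * (\<Prod>i<n. (1 + (x i)\<^sup>2) ^ l))"
      using C D by (intro mult_mono) (auto intro!: mult_nonneg_nonneg prod_nonneg)
    then show ?thesis by (simp add: abs_mult power_add prod.distrib mult_ac)
  qed
  then show ?case using C D by (intro exI[of _ "C * D"]) auto
qed

lemma poly_fun_measurable: "poly_fun n F \<Longrightarrow> F \<in> borel_measurable (gauss n)"
  by (induction rule: poly_fun.induct) auto

lemma poly_fun_integrable: "poly_fun n F \<Longrightarrow> integrable (gauss n) F"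
proof -
  assume F: "poly_fun n F"
  from poly_fun_bound[OF F] obtain C k
    where C: "0 \<le> C" "\<And>x. \<bar>F x\<bar> \<le> C * (\<Prod>i<n. (1 + (x i)\<^sup>2) ^ k)" by blast
  show ?thesis
  proof (rule Bochner_Integration.integrable_bound)
    show "integrable (gauss n) (\<lambda>x. C * (\<Prod>i<n. (1 + (x i)\<^sup>2) ^ k))"
      unfolding gauss_def
      by (intro integrable_mult_right gauss_pair.product_integrable_prod integrable_gauss1_even_power) auto
    show "AE x in gauss n. norm (F x) \<le> norm (C * (\<Prod>i<n. (1 + (x i)\<^sup>2) ^ k))"
      using C by (intro AE_I2) (auto intro: order_trans[OF C(2)])
  qed (rule poly_fun_measurable[OF F])
qed

text \<open>Taking \<open>deriv\<close> of the section makes \<open>pd i\<close> a total operation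
  that can be iterated; on \<open>poly_fun\<close> it is the genuine partial derivative by
  \<open>DERIV_pd\<close>.\<close>

definition pd :: "nat \<Rightarrow> ((nat \<Rightarrow> real) \<Rightarrow> real) \<Rightarrow> (nat \<Rightarrow> real) \<Rightarrow> real" where
  "pd i F x = deriv (\<lambda>t. F (x(i := t))) (x i)"

lemma pd_eqI:
  "(\<And>x. ((\<lambda>t. F (x(i := t))) has_real_derivative F' x) (at (x i))) \<Longrightarrow> pd i F = F'"
  unfolding pd_def by (intro ext DERIV_imp_deriv)

lemma poly_fun_pd_aux:
  "poly_fun n F \<Longrightarrow> \<exists>F'. poly_fun n F' \<and> (\<forall>x. ((\<lambda>t. F (x(i := t))) has_real_derivative F' x) (at (x i)))"
proof (induction rule: poly_fun.induct)
  case (poly_const c)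
  show ?case by (rule exI[of _ "\<lambda>x. 0"]) (auto intro: poly_fun.poly_const)
next
  case (poly_coord j)
  then show ?case
    by (intro exI[of _ "\<lambda>x. if i = j then 1 else 0"]) (auto intro: poly_fun.poly_const)
next
  case (poly_add F G)
  then obtain F' G' where p: "poly_fun n F'" "poly_fun n G'"
    and F': "\<And>x. ((\<lambda>t. F (x(i := t))) has_real_derivative F' x) (at (x i))"
    and G': "\<And>x. ((\<lambda>t. G (x(i := t))) has_real_derivative G' x) (at (x i))"
    by blast
  show ?case
  proof (intro exI[of _ "\<lambda>x. F' x + G' x"] conjI allI)
    show "poly_fun n (\<lambda>x. F' x + G' x)" using p by (auto intro: poly_intros)
    fix x show "((\<lambda>t. F (x(i := t)) + G (x(i := t))) has_real_derivative F' x + G' x) (at (x i))"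
      using DERIV_add[OF F'[of x] G'[of x]] by simp
  qed
next
  case (poly_mult F G)
  then obtain F' G' where p: "poly_fun n F'" "poly_fun n G'"
    and F': "\<And>x. ((\<lambda>t. F (x(i := t))) has_real_derivative F' x) (at (x i))"
    and G': "\<And>x. ((\<lambda>t. G (x(i := t))) has_real_derivative G' x) (at (x i))"
    by blast
  show ?case
  proof (intro exI[of _ "\<lambda>x. F' x * G x + F x * G' x"] conjI allI)
    show "poly_fun n (\<lambda>x. F' x * G x + F x * G' x)" using p poly_mult by (auto intro: poly_intros)
    fix x show "((\<lambda>t. F (x(i := t)) * G (x(i := t))) has_real_derivative F' x * G x + F x * G' x) (at (x i))"
      using DERIV_mult[OF F'[of x] G'[of x]] by (simp add: mult_ac add_ac)
  qed
qed

lemma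
  assumes "poly_fun n F"
  shows poly_pd: "poly_fun n (pd i F)"
    and DERIV_pd: "((\<lambda>t. F (x(i := t))) has_real_derivative pd i F x) (at (x i))"
proof -
  from poly_fun_pd_aux[OF assms, of i] obtain F' where F': "poly_fun n F'"
    "\<And>x. ((\<lambda>t. F (x(i := t))) has_real_derivative F' x) (at (x i))" by blast
  then have "pd i F = F'" by (intro pd_eqI)
  with F' show "poly_fun n (pd i F)" "((\<lambda>t. F (x(i := t))) has_real_derivative pd i F x) (at (x i))"
    by auto
qed

lemma DERIV_pd': "poly_fun n F \<Longrightarrow> ((\<lambda>t. F (x(i := t))) has_real_derivative pd i F (x(i := s))) (at s)"
  using DERIV_pd[of n F "x(i := s)" i] by simp

lemma isCont_poly_section: "poly_fun n F \<Longrightarrow> isCont (\<lambda>t. F (x(i := t))) s"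
  using DERIV_pd' DERIV_isCont by blast

lemma pd_const: "pd i (\<lambda>x. c) = (\<lambda>x. 0)" by (rule pd_eqI) simp

lemma pd_add: "poly_fun n F \<Longrightarrow> poly_fun n G \<Longrightarrow> pd i (\<lambda>x. F x + G x) = (\<lambda>x. pd i F x + pd i G x)"
  by (rule pd_eqI) (intro DERIV_add DERIV_pd)

lemma pd_cmult: "poly_fun n F \<Longrightarrow> pd i (\<lambda>x. c * F x) = (\<lambda>x. c * pd i F x)"
  by (rule pd_eqI) (intro DERIV_cmult DERIV_pd)

lemma pd_diff: "poly_fun n F \<Longrightarrow> poly_fun n G \<Longrightarrow> pd i (\<lambda>x. F x - G x) = (\<lambda>x. pd i F x - pd i G x)"
  by (rule pd_eqI) (intro DERIV_diff DERIV_pd)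

lemma pd_mult:
  assumes "poly_fun n F" "poly_fun n G"
  shows "pd i (\<lambda>x. F x * G x) = (\<lambda>x. pd i F x * G x + F x * pd i G x)"
proof (rule pd_eqI)
  fix x show "((\<lambda>t. F (x(i := t)) * G (x(i := t))) has_real_derivative pd i F x * G x + F x * pd i G x) (at (x i))"
    using DERIV_mult[OF DERIV_pd[OF assms(1), of x i] DERIV_pd[OF assms(2), of x i]] by (simp add: mult_ac add_ac)
qed

text \<open>
  Minus the Ornstein-Uhlenbeck generator, and its bilinear gradient operator.
\<close>

definition opA :: "nat \<Rightarrow> ((nat \<Rightarrow> real) \<Rightarrow> real) \<Rightarrow> (nat \<Rightarrow> real) \<Rightarrow> real" where
  "opA n F x = (\<Sum>i<n. x i * pd i F x - pd i (pd i F) x)"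

definition Gam :: "nat \<Rightarrow> ((nat \<Rightarrow> real) \<Rightarrow> real) \<Rightarrow> ((nat \<Rightarrow> real) \<Rightarrow> real) \<Rightarrow> (nat \<Rightarrow> real) \<Rightarrow> real" where
  "Gam n F G x = (\<Sum>i<n. pd i F x * pd i G x)"

lemma Gam_commute: "Gam n F G = Gam n G F"
  by (auto simp: Gam_def mult.commute)

lemma poly_Gam: "poly_fun n F \<Longrightarrow> poly_fun n G \<Longrightarrow> poly_fun n (Gam n F G)"
  unfolding Gam_def[abs_def] by (intro poly_intros poly_pd)

lemma poly_opA: "poly_fun n F \<Longrightarrow> poly_fun n (opA n F)"
  unfolding opA_def[abs_def] by (intro poly_intros poly_pd) auto

lemma opA_const: "opA n (\<lambda>x. c) = (\<lambda>x. 0)"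
  by (simp add: opA_def[abs_def] pd_const)

lemma opA_add: "poly_fun n F \<Longrightarrow> poly_fun n G \<Longrightarrow> opA n (\<lambda>x. F x + G x) = (\<lambda>x. opA n F x + opA n G x)"
  by (simp add: opA_def[abs_def] pd_add poly_pd[of n] pd_add[OF poly_pd[of n] poly_pd[of n]]
      sum.distrib[symmetric] algebra_simps fun_eq_iff)

lemma opA_diff: "poly_fun n F \<Longrightarrow> poly_fun n G \<Longrightarrow> opA n (\<lambda>x. F x - G x) = (\<lambda>x. opA n F x - opA n G x)"
  by (simp add: opA_def[abs_def] pd_diff poly_pd[of n] pd_diff[OF poly_pd[of n] poly_pd[of n]]
      sum_subtractf[symmetric] algebra_simps fun_eq_iff)

lemma opA_cmult: "poly_fun n F \<Longrightarrow> opA n (\<lambda>x. c * F x) = (\<lambda>x. c * opA n F x)"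
  by (simp add: opA_def[abs_def] pd_cmult pd_cmult[OF poly_pd[of n]]
      sum_distrib_left algebra_simps fun_eq_iff)

lemma opA_sum:
  "finite I \<Longrightarrow> (\<And>i. i \<in> I \<Longrightarrow> poly_fun n (F i)) \<Longrightarrow> opA n (\<lambda>x. \<Sum>i\<in>I. F i x) = (\<lambda>x. \<Sum>i\<in>I. opA n (F i) x)"
  by (induction I rule: finite_induct) (simp_all add: opA_const opA_add poly_sum)

text \<open>The first-order part of A obeys the Leibniz rule, and the second-order part violates it
  by the cross term of the second derivatives. For eigenfunctions this expresses Gamma(F,G) through
  A applied to the product FG.\<close>

lemma opA_mult:
  assumes F: "poly_fun n F" and G: "poly_fun n G"
  shows "opA n (\<lambda>x. F x * G x) = (\<lambda>x. F x * opA n G x + G x * opA n F x - 2 * Gam n F G x)"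
proof -
  have 2: "pd i (pd i (\<lambda>x. F x * G x)) =
    (\<lambda>x. pd i (pd i F) x * G x + 2 * (pd i F x * pd i G x) + F x * pd i (pd i G) x)" for i
    using F G by (simp add: pd_mult[of n] pd_add[of n] poly_mult poly_pd fun_eq_iff)
  have 1: "pd i (\<lambda>x. F x * G x) = (\<lambda>x. pd i F x * G x + F x * pd i G x)" for i
    using F G by (rule pd_mult)
  show ?thesis
    unfolding opA_def[abs_def] Gam_def 2 unfolding 1
    by (rule ext) (simp add: sum_distrib_left sum_subtractf[symmetric]
        sum.distrib[symmetric] algebra_simps)
qed

lemma poly_ibp:
  assumes "i < n" "poly_fun n F"
  shows "(\<integral>x. x i * F x \<partial>gauss n) = (\<integral>x. pd i F x \<partial>gauss n)"
  using assms
  by (intro gauss_ibp DERIV_pd isCont_poly_section poly_pd poly_fun_integrable)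
     (auto intro!: poly_intros intro: poly_pd)

text \<open>Integration by parts in coordinate i is applied to F times \<open>pd i G\<close>; the
  term with the second derivative of G is cancelled by the one in A. The right-hand side is
  symmetric in F and G, so A is symmetric and its eigenspaces are orthogonal.\<close>

lemma integral_opA:
  assumes F: "poly_fun n F" and G: "poly_fun n G"
  shows "(\<integral>x. F x * opA n G x \<partial>gauss n) = (\<integral>x. Gam n F G x \<partial>gauss n)"
proof -
  note P = poly_fun_integrable poly_pd F G
  have "(\<integral>x. F x * (x i * pd i G x - pd i (pd i G) x) \<partial>gauss n) = (\<integral>x. pd i F x * pd i G x \<partial>gauss n)"
    if i: "i < n" for i
  proof -
    have "(\<integral>x. x i * (F x * pd i G x) \<partial>gauss n) = (\<integral>x. pd i F x * pd i G x + F x * pd i (pd i G) x \<partial>gauss n)"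
      using F G i by (subst poly_ibp) (auto intro: poly_intros poly_pd simp: pd_mult[of n] poly_pd)
    also have "\<dots> = (\<integral>x. pd i F x * pd i G x \<partial>gauss n) + (\<integral>x. F x * pd i (pd i G) x \<partial>gauss n)"
      by (intro Bochner_Integration.integral_add poly_fun_integrable poly_mult poly_pd F G)
    finally have *: "(\<integral>x. x i * (F x * pd i G x) \<partial>gauss n) - (\<integral>x. F x * pd i (pd i G) x \<partial>gauss n)
       = (\<integral>x. pd i F x * pd i G x \<partial>gauss n)" by simp
    have "(\<integral>x. x i * (F x * pd i G x) - F x * pd i (pd i G) x \<partial>gauss n)
        = (\<integral>x. x i * (F x * pd i G x) \<partial>gauss n) - (\<integral>x. F x * pd i (pd i G) x \<partial>gauss n)"
      by (intro Bochner_Integration.integral_diff poly_fun_integrable poly_mult poly_pd F G poly_coord i)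
    with * show ?thesis by (simp add: algebra_simps)
  qed
  then have "(\<Sum>i<n. \<integral>x. F x * (x i * pd i G x - pd i (pd i G) x) \<partial>gauss n) = (\<Sum>i<n. \<integral>x. pd i F x * pd i G x \<partial>gauss n)"
    by simp
  also have "(\<Sum>i<n. \<integral>x. F x * (x i * pd i G x - pd i (pd i G) x) \<partial>gauss n) = (\<integral>x. F x * opA n G x \<partial>gauss n)"
    unfolding opA_def sum_distrib_left
    by (rule Bochner_Integration.integral_sum[symmetric])
       (auto intro!: poly_fun_integrable poly_intros poly_pd F G)
  also have "(\<Sum>i<n. \<integral>x. pd i F x * pd i G x \<partial>gauss n) = (\<integral>x. Gam n F G x \<partial>gauss n)"
    unfolding Gam_def
    by (rule Bochner_Integration.integral_sum[symmetric])
       (auto intro!: poly_fun_integrable poly_intros poly_pd F G)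
  finally show ?thesis .
qed

lemma opA_symmetric:
  "poly_fun n F \<Longrightarrow> poly_fun n G \<Longrightarrow> (\<integral>x. F x * opA n G x \<partial>gauss n) = (\<integral>x. G x * opA n F x \<partial>gauss n)"
  by (simp add: integral_opA Gam_commute)

lemma eigen_orthogonal:
  assumes "poly_fun n F" "poly_fun n G" and F: "opA n F = (\<lambda>x. a * F x)" and G: "opA n G = (\<lambda>x. b * G x)"
    and "a \<noteq> b"
  shows "(\<integral>x. F x * G x \<partial>gauss n) = 0"
proof -
  have "b * (\<integral>x. F x * G x \<partial>gauss n) = (\<integral>x. F x * opA n G x \<partial>gauss n)"
    by (subst G) (simp add: mult.left_commute)
  also have "\<dots> = (\<integral>x. G x * opA n F x \<partial>gauss n)" using assms by (intro opA_symmetric)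
  also have "\<dots> = a * (\<integral>x. F x * G x \<partial>gauss n)"
    by (subst F) (simp add: mult.left_commute mult.commute)
  finally show ?thesis using \<open>a \<noteq> b\<close> by simp
qed

section \<open>Hermite polynomials: derivative and differential equation\<close>

lemma DERIV_hermite: "(hermite p has_real_derivative real p * hermite (p - 1) x) (at x)"
proof (induction p x rule: hermite.induct)
  case (1 x) then show ?case by (simp add: fun_eq_iff[symmetric])
next
  case (2 x) then show ?case by simp
next
  case (3 n x)
  have "((\<lambda>x. x * hermite (Suc n) x - real (Suc n) * hermite n x) has_real_derivative
      (1 * hermite (Suc n) x + (real (Suc n) * hermite n x) * x) - real (Suc n) * (real n * hermite (n - 1) x)) (at x)"
    using 3 by (intro DERIV_diff DERIV_mult DERIV_cmult DERIV_ident) auto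
  also have "(1 * hermite (Suc n) x + (real (Suc n) * hermite n x) * x) - real (Suc n) * (real n * hermite (n - 1) x)
     = real (Suc (Suc n)) * hermite (Suc n) x"
    by (cases n) (auto simp: algebra_simps)
  finally show ?case by simp
qed

text \<open>This is Hermite's equation y H' - H'' = p H with both derivatives written out. Truncated
  subtraction is harmless: for p < 2 the coefficient in front of the affected term is 0.\<close>

lemma hermite_ode:
  "y * (real p * hermite (p - 1) y) - real p * (real (p - 1) * hermite (p - 2) y) = real p * hermite p y"
proof (cases p rule: nat.exhaust)
  case (Suc q)
  then show ?thesis by (cases q) (auto simp: algebra_simps)
qed simp

subsection \<open>Eigenfunctions and products of eigenfunctions\<close>

text \<open>The generators are what the integral of the p-th tensor power of a unit vector becomes
  in orthonormal Gaussian coordinates. Taking all unit vectors \<open>a\<close> at once gives a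
  linear class that \<open>pd i\<close> maps into the class of one order less.\<close>

inductive chaos :: "nat \<Rightarrow> nat \<Rightarrow> ((nat \<Rightarrow> real) \<Rightarrow> real) \<Rightarrow> bool" for n p where
  chaos_zero: "chaos n p (\<lambda>x. 0)"
| chaos_hermite: "(\<Sum>i<n. (a i)\<^sup>2) = 1 \<Longrightarrow> chaos n p (\<lambda>x. hermite p (\<Sum>i<n. a i * x i))"
| chaos_add: "chaos n p F \<Longrightarrow> chaos n p G \<Longrightarrow> chaos n p (\<lambda>x. F x + G x)"
| chaos_cmult: "chaos n p F \<Longrightarrow> chaos n p (\<lambda>x. c * F x)"

lemma poly_hermite: "poly_fun n L \<Longrightarrow> poly_fun n (\<lambda>x. hermite p (L x))"
proof (induction p rule: induct_nat_012)
  case (ge2 m)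
  then show ?case unfolding hermite.simps by (intro poly_intros) auto
qed (auto intro: poly_const)

lemma poly_linear: "poly_fun n (\<lambda>x. \<Sum>i<n. a i * x i)"
  by (intro poly_intros) auto

lemma pd_hermite_linear:
  assumes "i < n"
  shows "pd i (\<lambda>x. hermite p (\<Sum>j<n. a j * x j)) = (\<lambda>x. real p * a i * hermite (p - 1) (\<Sum>j<n. a j * x j))"
proof (rule pd_eqI)
  fix x :: "nat \<Rightarrow> real"
  have "((\<lambda>t. \<Sum>j<n. a j * (x(i := t)) j) has_real_derivative (\<Sum>j<n. if j = i then a j else 0)) (at (x i))"
  proof (rule DERIV_sum)
    fix j show "((\<lambda>t. a j * (x(i := t)) j) has_real_derivative (if j = i then a j else 0)) (at (x i))"
      by (auto intro!: derivative_eq_intros)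
  qed
  moreover have "(\<Sum>j<n. if j = i then a j else 0) = a i" using assms by simp
  ultimately have "((\<lambda>t. \<Sum>j<n. a j * (x(i := t)) j) has_real_derivative a i) (at (x i))" by simp
  from DERIV_chain2[OF DERIV_hermite this, of p]
  show "((\<lambda>t. hermite p (\<Sum>j<n. a j * (x(i := t)) j)) has_real_derivative
      real p * a i * hermite (p - 1) (\<Sum>j<n. a j * x j)) (at (x i))"
    by (simp add: mult_ac)
qed

lemma chaos_poly: "chaos n p F \<Longrightarrow> poly_fun n F"
  by (induction rule: chaos.induct) (auto intro: poly_intros poly_hermite poly_linear)

lemma chaos_sum: "finite I \<Longrightarrow> (\<And>i. i \<in> I \<Longrightarrow> chaos n p (F i)) \<Longrightarrow> chaos n p (\<lambda>x. \<Sum>i\<in>I. F i x)"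
  by (induction I rule: finite_induct) (auto intro: chaos_zero chaos_add)

lemma chaos_0: "chaos n 0 F \<Longrightarrow> \<exists>c. F = (\<lambda>x. c)"
  by (induction rule: chaos.induct) auto

text \<open>On generators, the derivative of Hermite order p + 1 is p + 1 times that of order p,
  along the same vector \<open>a\<close>. This is the lowering step behind the inductions on the
  order.\<close>

lemma chaos_pd:
  assumes "i < n" "chaos n (Suc p) F" shows "chaos n p (pd i F)"
  using assms(2)
proof induction
  case chaos_zero then show ?case by (simp add: pd_const chaos.chaos_zero)
next
  case (chaos_hermite a)
  then show ?case
    unfolding pd_hermite_linear[OF assms(1)] by (auto intro: chaos.chaos_cmult chaos.chaos_hermite)
next
  case (chaos_add F G)
  then show ?case by (simp add: pd_add[of n] chaos_poly chaos.chaos_add)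
next
  case (chaos_cmult F c)
  then show ?case by (simp add: pd_cmult[of n] chaos_poly chaos.chaos_cmult)
qed

text \<open>For F = H(L) with L the linear form of \<open>a\<close>, the gradient part of A sums to
  L H'(L), and the Laplacian to H''(L) because the squares of the coefficients add up to 1. What
  remains is \<open>hermite_ode\<close>.\<close>

lemma chaos_opA: "chaos n p F \<Longrightarrow> opA n F = (\<lambda>x. real p * F x)"
proof (induction rule: chaos.induct)
  case chaos_zero then show ?case by (simp add: opA_const)
next
  case (chaos_hermite a)
  let ?L = "\<lambda>x. \<Sum>j<n. a j * x j"
  have "pd i (pd i (\<lambda>x. hermite p (?L x))) = (\<lambda>x. (a i)\<^sup>2 * (real p * (real (p - 1) * hermite (p - 2) (?L x))))"
    if "i < n" for i
    using that
    by (simp add: pd_hermite_linear pd_cmult[OF poly_hermite[OF poly_linear]] fun_eq_iff power2_eq_square)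
       (simp add: numeral_2_eq_2)
  moreover have "x i * pd i (\<lambda>x. hermite p (?L x)) x = a i * x i * (real p * hermite (p - 1) (?L x))"
    if "i < n" for i x
    using that by (simp add: pd_hermite_linear)
  ultimately have "opA n (\<lambda>x. hermite p (?L x)) =
    (\<lambda>x. (\<Sum>i<n. a i * x i * (real p * hermite (p - 1) (?L x))) -
         (\<Sum>i<n. (a i)\<^sup>2 * (real p * (real (p - 1) * hermite (p - 2) (?L x)))))"
    unfolding opA_def[abs_def] sum_subtractf[symmetric]
    by (intro ext sum.cong refl) simp
  also have "\<dots> = (\<lambda>x. ?L x * (real p * hermite (p - 1) (?L x)) - real p * (real (p - 1) * hermite (p - 2) (?L x)))"
    unfolding sum_distrib_right[symmetric] chaos_hermite by simp
  also have "\<dots> = (\<lambda>x. real p * hermite p (?L x))" by (simp only: hermite_ode)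
  finally show ?case .
next
  case (chaos_add F G)
  then show ?case by (simp add: opA_add chaos_poly algebra_simps)
next
  case (chaos_cmult F c)
  then show ?case by (simp add: opA_cmult chaos_poly algebra_simps)
qed

text \<open>Sums of products are needed, not just single products, since Gamma(F,G) is already the
  sum over i of the products of partial derivatives. Scalars can be absorbed into a factor.\<close>

inductive chaos2 :: "nat \<Rightarrow> nat \<Rightarrow> nat \<Rightarrow> ((nat \<Rightarrow> real) \<Rightarrow> real) \<Rightarrow> bool" for n p q where
  chaos2_prod: "chaos n p F \<Longrightarrow> chaos n q G \<Longrightarrow> chaos2 n p q (\<lambda>x. F x * G x)"
| chaos2_add: "chaos2 n p q F \<Longrightarrow> chaos2 n p q G \<Longrightarrow> chaos2 n p q (\<lambda>x. F x + G x)"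

lemma chaos2_zero: "chaos2 n p q (\<lambda>x. 0)"
  using chaos2_prod[OF chaos_zero chaos_zero] by simp

lemma chaos2_sum: "finite I \<Longrightarrow> (\<And>i. i \<in> I \<Longrightarrow> chaos2 n p q (F i)) \<Longrightarrow> chaos2 n p q (\<lambda>x. \<Sum>i\<in>I. F i x)"
  by (induction I rule: finite_induct) (auto intro: chaos2_zero chaos2_add)

lemma chaos2_poly: "chaos2 n p q F \<Longrightarrow> poly_fun n F"
  by (induction rule: chaos2.induct) (auto intro: poly_intros chaos_poly)

text \<open>
  \<open>opB n (p + q)\<close> is normalized so that it maps a product of elements of the chaoses \<open>p\<close> and \<open>q\<close> to
  their \<open>Gam\<close>.
\<close>

definition opB :: "nat \<Rightarrow> nat \<Rightarrow> ((nat \<Rightarrow> real) \<Rightarrow> real) \<Rightarrow> (nat \<Rightarrow> real) \<Rightarrow> real" where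
  "opB n s F x = (real s * F x - opA n F x) / 2"

lemma opB_add: "poly_fun n F \<Longrightarrow> poly_fun n G \<Longrightarrow> opB n s (\<lambda>x. F x + G x) = (\<lambda>x. opB n s F x + opB n s G x)"
  by (simp add: opB_def fun_eq_iff opA_add field_simps)

lemma opB_prod:
  assumes "chaos n p F" "chaos n q G"
  shows "opB n (p + q) (\<lambda>x. F x * G x) = Gam n F G"
  using assms by (simp add: opB_def[abs_def] opA_mult[of n] chaos_poly chaos_opA fun_eq_iff field_simps)

lemma chaos2_Gam:
  assumes "chaos n (Suc p) F" "chaos n (Suc q) G"
  shows "chaos2 n p q (Gam n F G)"
  unfolding Gam_def[abs_def] using assms by (intro chaos2_sum chaos2_prod chaos_pd) auto

lemma chaos2_opB: "chaos2 n (Suc p) (Suc q) Q \<Longrightarrow> chaos2 n p q (opB n (Suc p + Suc q) Q)"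
proof (induction rule: chaos2.induct)
  case (chaos2_prod F G)
  then show ?case by (simp only: opB_prod chaos2_Gam)
next
  case (chaos2_add F G)
  then show ?case by (simp only: opB_add chaos2_poly chaos2.chaos2_add)
qed

lemma Gam_const: "Gam n (\<lambda>x. c) F = (\<lambda>x. 0)" by (simp add: Gam_def[abs_def] pd_const)

text \<open>A factor of order 0 is constant, so every Gamma vanishes. Hence Q itself is an
  eigenfunction of A with eigenvalue p + q, the end of the recursion on the orders.\<close>

lemma chaos2_opB_0: "chaos2 n p q Q \<Longrightarrow> p = 0 \<or> q = 0 \<Longrightarrow> opB n (p + q) Q = (\<lambda>x. 0)"
proof (induction rule: chaos2.induct)
  case (chaos2_prod F G)
  have "Gam n F G = (\<lambda>x. 0)"
    using chaos2_prod chaos_0[of n F] chaos_0[of n G] Gam_commute[of n F G] by (auto simp: Gam_const)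
  then show ?case using chaos2_prod by (simp only: opB_prod)
next
  case (chaos2_add F G)
  then show ?case by (simp add: opB_add chaos2_poly)
qed

text \<open>
  \<open>opB n (p + q)\<close> lowers both orders by one, and \<open>opB n (p + q - 2) = opB n (p + q) - 1\<close>. So an
  eigendecomposition of \<open>opB n (p + q) Q\<close> accounts for all of \<open>Q\<close> but a component that
  \<open>opB n (p + q)\<close> annihilates.
\<close>

lemma chaos2_decomposition:
  assumes "chaos2 n p q Q"
  shows "\<exists>R. (\<forall>l \<le> min p q. poly_fun n (R l) \<and> opA n (R l) = (\<lambda>x. (real (p + q) - 2 * real l) * R l x))
    \<and> Q = (\<lambda>x. \<Sum>l\<le>min p q. R l x)"
  using assms
proof (induction p arbitrary: q Q)
  case 0
  then have "opB n (0 + q) Q = (\<lambda>x. 0)" by (intro chaos2_opB_0) auto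
  then have "opA n Q = (\<lambda>x. real q * Q x)" by (simp add: opB_def[abs_def] fun_eq_iff)
  then show ?case using 0 by (intro exI[of _ "\<lambda>l. Q"]) (auto intro: chaos2_poly)
next
  case (Suc p)
  show ?case
  proof (cases q)
    case 0
    with Suc have "opB n (Suc p + q) Q = (\<lambda>x. 0)" by (intro chaos2_opB_0) auto
    then have "opA n Q = (\<lambda>x. (1 + real p) * Q x)" by (simp add: opB_def[abs_def] fun_eq_iff 0)
    then show ?thesis using Suc 0 by (intro exI[of _ "\<lambda>l. Q"]) (auto intro: chaos2_poly)
  next
    case q: (Suc q')
    let ?B = "opB n (Suc p + q) Q" and ?m = "min p q'"
    note Qp = chaos2_poly[OF Suc.prems]
    have "chaos2 n p q' ?B" unfolding q using Suc.prems unfolding q by (rule chaos2_opB)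
    from Suc.IH[OF this] obtain R where R: "\<And>l. l \<le> ?m \<Longrightarrow> poly_fun n (R l)"
      "\<And>l. l \<le> ?m \<Longrightarrow> opA n (R l) = (\<lambda>x. (real (p + q') - 2 * real l) * R l x)"
      and B: "?B = (\<lambda>x. \<Sum>l\<le>?m. R l x)" by blast
    \<comment> \<open>\<open>R l\<close> has eigenvalue p + q' - 2l under A, hence eigenvalue ((p +
      q' + 2) - (p + q' - 2l)) / 2 = l + 1 under \<open>opB n (Suc p + q)\<close>. So
      \<open>S l\<close> is a preimage of \<open>R l\<close>.\<close>
    define S where "S l = (\<lambda>x. R l x / real (Suc l))" for l
    have Sp: "poly_fun n (S l)" if "l \<le> ?m" for l
      unfolding S_def by (intro poly_divide R that)
    have SA: "opA n (S l) = (\<lambda>x. (real (p + q') - 2 * real l) * S l x)" if "l \<le> ?m" for l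
      using opA_cmult[OF R(1)[OF that], of "1 / real (Suc l)"] R(2)[OF that] by (simp add: S_def)
    \<comment> \<open>The remainder is annihilated by \<open>opB n (Suc p + q)\<close>, that is, an
      eigenfunction of A with the top eigenvalue.\<close>
    define T where "T = (\<lambda>x. Q x - (\<Sum>l\<le>?m. S l x))"
    have Tp: "poly_fun n T" unfolding T_def by (intro poly_intros Qp Sp) auto
    have "opA n T = (\<lambda>x. opA n Q x - (\<Sum>l\<le>?m. (real (p + q') - 2 * real l) * S l x))"
    proof -
      have "opA n (\<lambda>x. \<Sum>l\<le>?m. S l x) = (\<lambda>x. \<Sum>l\<le>?m. opA n (S l) x)"
        by (rule opA_sum) (simp_all add: Sp)
      also have "\<dots> = (\<lambda>x. \<Sum>l\<le>?m. (real (p + q') - 2 * real l) * S l x)"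
        by (intro ext sum.cong refl) (simp add: SA)
      finally show ?thesis
        unfolding T_def by (subst opA_diff[OF Qp]) (rule poly_sum, rule Sp, simp_all)
    qed
    also have "\<dots> = (\<lambda>x. real (Suc p + q) * T x)"
    proof
      fix x
      have "opA n Q x = real (Suc p + q) * Q x - 2 * ?B x" by (simp add: opB_def field_simps)
      also have "2 * ?B x = (\<Sum>l\<le>?m. 2 * real (Suc l) * S l x)"
        unfolding B sum_distrib_left
        by (intro sum.cong refl) (simp add: S_def field_simps del: of_nat_Suc)
      finally have "opA n Q x - (\<Sum>l\<le>?m. (real (p + q') - 2 * real l) * S l x)
         = real (Suc p + q) * Q x - (\<Sum>l\<le>?m. 2 * real (Suc l) * S l x + (real (p + q') - 2 * real l) * S l x)"
        by (simp add: sum.distrib)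
      also have "(\<Sum>l\<le>?m. 2 * real (Suc l) * S l x + (real (p + q') - 2 * real l) * S l x) =
          real (Suc p + q) * (\<Sum>l\<le>?m. S l x)"
        unfolding sum_distrib_left by (intro sum.cong) (auto simp: q algebra_simps)
      finally show "opA n Q x - (\<Sum>l\<le>?m. (real (p + q') - 2 * real l) * S l x) = real (Suc p + q) * T x"
        by (simp add: T_def right_diff_distrib)
    qed
    finally have TA: "opA n T = (\<lambda>x. real (Suc p + q) * T x)" .
    \<comment> \<open>The index shifts by one: p + q' - 2k equals (Suc p + q) - 2 (k + 1), so
      \<open>S k\<close> becomes component k + 1, and \<open>T\<close> takes the vacant place
      0.\<close>
    define R' where "R' l = (case l of 0 \<Rightarrow> T | Suc k \<Rightarrow> S k)" for l
    have m: "min (Suc p) q = Suc ?m" by (simp add: q)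
    show ?thesis
    proof (intro exI[of _ R'] conjI allI impI)
      fix l assume l: "l \<le> min (Suc p) q"
      show "poly_fun n (R' l)" using l Tp Sp by (auto simp: R'_def m split: nat.split)
      show "opA n (R' l) = (\<lambda>x. (real (Suc p + q) - 2 * real l) * R' l x)"
        using l by (auto simp: R'_def m q TA SA algebra_simps split: nat.split)
    next
      show "Q = (\<lambda>x. \<Sum>l\<le>min (Suc p) q. R' l x)"
        unfolding m sum.atMost_Suc_shift by (simp add: R'_def T_def)
    qed
  qed
qed

lemma integral_sum_mult_sum:
  assumes "finite I" "finite J" "\<And>i. i \<in> I \<Longrightarrow> poly_fun n (F i)" "\<And>j. j \<in> J \<Longrightarrow> poly_fun n (G j)"
  shows "(\<integral>x. (\<Sum>i\<in>I. F i x) * (\<Sum>j\<in>J. G j x) \<partial>gauss n) = (\<Sum>i\<in>I. \<Sum>j\<in>J. \<integral>x. F i x * G j x \<partial>gauss n)"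
proof -
  have "(\<integral>x. (\<Sum>i\<in>I. F i x) * (\<Sum>j\<in>J. G j x) \<partial>gauss n) = (\<Sum>i\<in>I. \<integral>x. (\<Sum>j\<in>J. F i x * G j x) \<partial>gauss n)"
    unfolding sum_product
    by (rule Bochner_Integration.integral_sum) (simp add: poly_fun_integrable poly_sum poly_mult assms)
  also have "\<dots> = (\<Sum>i\<in>I. \<Sum>j\<in>J. \<integral>x. F i x * G j x \<partial>gauss n)"
    by (intro sum.cong refl Bochner_Integration.integral_sum)
      (simp add: poly_fun_integrable poly_mult assms)
  finally show ?thesis .
qed

text \<open>On the orthogonal components of Q the operator \<open>opB n (p + q)\<close> is
  multiplication by l = 0, ..., min p q. The two integrals are therefore the sums of l
  \<parallel>R_l\<parallel>^2 and of l^2 \<parallel>R_l\<parallel>^2, and l^2 \<le> (min p q)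
  l.\<close>

lemma chaos2_quadratic:
  assumes "chaos2 n p q Q"
  shows chaos2_opB_nonneg: "0 \<le> (\<integral>x. Q x * opB n (p + q) Q x \<partial>gauss n)"
    and chaos2_opB_le: "(\<integral>x. (opB n (p + q) Q x)\<^sup>2 \<partial>gauss n) \<le> real (min p q) * (\<integral>x. Q x * opB n (p + q) Q x \<partial>gauss n)"
proof -
  let ?m = "min p q"
  from chaos2_decomposition[OF assms] obtain R where R: "\<And>l. l \<le> ?m \<Longrightarrow> poly_fun n (R l)"
      "\<And>l. l \<le> ?m \<Longrightarrow> opA n (R l) = (\<lambda>x. (real (p + q) - 2 * real l) * R l x)"
      and Q: "Q = (\<lambda>x. \<Sum>l\<le>?m. R l x)" by blast
  have B: "opB n (p + q) Q x = (\<Sum>l\<le>?m. real l * R l x)" for x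
  proof -
    have "opA n Q = (\<lambda>x. \<Sum>l\<le>?m. (real (p + q) - 2 * real l) * R l x)"
      unfolding Q using R by (subst opA_sum) auto
    then have "opB n (p + q) Q x = ((\<Sum>l\<le>?m. real (p + q) * R l x) - (\<Sum>l\<le>?m. (real (p + q) - 2 * real l) * R l x)) / 2"
      by (simp add: opB_def Q sum_distrib_left)
    also have "\<dots> = (\<Sum>l\<le>?m. real l * R l x)"
      unfolding sum_subtractf[symmetric] sum_divide_distrib by (intro sum.cong) (auto simp: algebra_simps)
    finally show ?thesis .
  qed
  have orth: "(\<integral>x. R i x * R j x \<partial>gauss n) = (if i = j then (\<integral>x. (R i x)\<^sup>2 \<partial>gauss n) else 0)"
    if "i \<le> ?m" "j \<le> ?m" for i j
  proof (cases "i = j")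
    case False
    then show ?thesis
      using eigen_orthogonal[OF R(1)[OF that(1)] R(1)[OF that(2)] R(2)[OF that(1)] R(2)[OF that(2)]] by simp
  qed (simp add: power2_eq_square)
  have 1: "(\<integral>x. Q x * opB n (p + q) Q x \<partial>gauss n) = (\<Sum>l\<le>?m. real l * (\<integral>x. (R l x)\<^sup>2 \<partial>gauss n))"
  proof -
    have "(\<integral>x. Q x * opB n (p + q) Q x \<partial>gauss n) = (\<Sum>i\<le>?m. \<Sum>j\<le>?m. \<integral>x. R i x * (real j * R j x) \<partial>gauss n)"
      unfolding B unfolding Q by (rule integral_sum_mult_sum) (simp_all add: poly_cmult R)
    also have "\<dots> = (\<Sum>i\<le>?m. \<Sum>j\<le>?m. if i = j then real j * (\<integral>x. (R i x)\<^sup>2 \<partial>gauss n) else 0)"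
      by (intro sum.cong refl) (auto simp: mult.left_commute orth)
    finally show ?thesis by simp
  qed
  have 2: "(\<integral>x. (opB n (p + q) Q x)\<^sup>2 \<partial>gauss n) = (\<Sum>l\<le>?m. real l * (real l * (\<integral>x. (R l x)\<^sup>2 \<partial>gauss n)))"
  proof -
    have "(\<integral>x. (opB n (p + q) Q x)\<^sup>2 \<partial>gauss n) = (\<Sum>i\<le>?m. \<Sum>j\<le>?m. \<integral>x. (real i * R i x) * (real j * R j x) \<partial>gauss n)"
      unfolding B power2_eq_square by (rule integral_sum_mult_sum) (simp_all add: poly_cmult R)
    also have "\<dots> = (\<Sum>i\<le>?m. \<Sum>j\<le>?m. if i = j then real i * (real j * (\<integral>x. (R i x)\<^sup>2 \<partial>gauss n)) else 0)"
    proof (intro sum.cong refl)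
      fix i j assume "i \<in> {..?m}" "j \<in> {..?m}"
      moreover have "(\<integral>x. (real i * R i x) * (real j * R j x) \<partial>gauss n) = real i * (real j * (\<integral>x. R i x * R j x \<partial>gauss n))"
        by (simp add: mult_ac flip: integral_mult_right_zero)
      ultimately show "(\<integral>x. (real i * R i x) * (real j * R j x) \<partial>gauss n) =
          (if i = j then real i * (real j * (\<integral>x. (R i x)\<^sup>2 \<partial>gauss n)) else 0)"
        using orth[of i j] by auto
    qed
    finally show ?thesis by simp
  qed
  show "0 \<le> (\<integral>x. Q x * opB n (p + q) Q x \<partial>gauss n)"
    unfolding 1 by (intro sum_nonneg mult_nonneg_nonneg) auto
  show "(\<integral>x. (opB n (p + q) Q x)\<^sup>2 \<partial>gauss n) \<le> real ?m * (\<integral>x. Q x * opB n (p + q) Q x \<partial>gauss n)"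
    unfolding 1 2 sum_distrib_left[of "real ?m"]
    by (intro sum_mono mult_right_mono) (auto intro!: mult_nonneg_nonneg)
qed

lemma chaos2_orthogonal:
  assumes Q: "chaos2 n p q Q" and Q': "chaos2 n p' q' Q'" and par: "odd (p + q + p' + q')"
  shows "(\<integral>x. Q x * Q' x \<partial>gauss n) = 0"
proof -
  let ?m = "min p q" and ?m' = "min p' q'"
  from chaos2_decomposition[OF Q] obtain R where R: "\<And>l. l \<le> ?m \<Longrightarrow> poly_fun n (R l)"
      "\<And>l. l \<le> ?m \<Longrightarrow> opA n (R l) = (\<lambda>x. (real (p + q) - 2 * real l) * R l x)"
      and Q: "Q = (\<lambda>x. \<Sum>l\<le>?m. R l x)" by blast
  from chaos2_decomposition[OF Q'] obtain R' where R': "\<And>l. l \<le> ?m' \<Longrightarrow> poly_fun n (R' l)"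
      "\<And>l. l \<le> ?m' \<Longrightarrow> opA n (R' l) = (\<lambda>x. (real (p' + q') - 2 * real l) * R' l x)"
      and Q': "Q' = (\<lambda>x. \<Sum>l\<le>?m'. R' l x)" by blast
  have "(\<integral>x. Q x * Q' x \<partial>gauss n) = (\<Sum>i\<le>?m. \<Sum>j\<le>?m'. \<integral>x. R i x * R' j x \<partial>gauss n)"
    unfolding Q Q' by (rule integral_sum_mult_sum) (simp_all add: R R')
  also have "\<dots> = 0"
  proof (intro sum.neutral ballI)
    fix i j assume i: "i \<in> {..?m}" and j: "j \<in> {..?m'}"
    \<comment> \<open>Eigenvalues of the two functions have the parities of p + q and of p' + q',
      which are opposite.\<close>
    have "real (p + q) - 2 * real i \<noteq> real (p' + q') - 2 * real j"
    proof
      assume "real (p + q) - 2 * real i = real (p' + q') - 2 * real j"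
      then have "real (p + q + 2 * j) = real (p' + q' + 2 * i)" by simp
      then have "p + q + 2 * j = p' + q' + 2 * i" using of_nat_eq_iff by blast
      then have "p + q + p' + q' = 2 * (p' + q' + i - j)" by linarith
      then show False using par by simp
    qed
    then show "(\<integral>x. R i x * R' j x \<partial>gauss n) = 0"
      using i j by (intro eigen_orthogonal[OF R(1) R'(1) R(2) R'(2)]) auto
  qed
  finally show ?thesis .
qed

text \<open>Integration is the inner product with the constant 1, an eigenfunction with eigenvalue
  0, whereas all eigenvalues occurring in Q are odd.\<close>

lemma chaos2_integral_eq_0:
  assumes Q: "chaos2 n p q Q" and par: "odd (p + q)"
  shows "(\<integral>x. Q x \<partial>gauss n) = 0"
proof -
  let ?m = "min p q"
  from chaos2_decomposition[OF Q] obtain R where R: "\<And>l. l \<le> ?m \<Longrightarrow> poly_fun n (R l)"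
      "\<And>l. l \<le> ?m \<Longrightarrow> opA n (R l) = (\<lambda>x. (real (p + q) - 2 * real l) * R l x)"
      and Q: "Q = (\<lambda>x. \<Sum>l\<le>?m. R l x)" by blast
  have "(\<integral>x. Q x \<partial>gauss n) = (\<Sum>l\<le>?m. \<integral>x. R l x * 1 \<partial>gauss n)"
    unfolding Q by (subst Bochner_Integration.integral_sum) (simp_all add: poly_fun_integrable R)
  also have "\<dots> = 0"
  proof (intro sum.neutral ballI)
    fix l assume l: "l \<in> {..?m}"
    have "real (p + q) - 2 * real l \<noteq> 0"
    proof
      assume "real (p + q) - 2 * real l = 0"
      then have "real (p + q) = real (2 * l)" by simp
      then have "p + q = 2 * l" using of_nat_eq_iff by blast
      then show False using par by simp
    qed
    then show "(\<integral>x. R l x * 1 \<partial>gauss n) = 0"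
      using l by (intro eigen_orthogonal[OF R(1) poly_const R(2), where b = 0]) (auto simp: opA_const)
  qed
  finally show ?thesis .
qed

subsection \<open>Moment inequalities\<close>

lemma Gam_mult:
  assumes "poly_fun n F" "poly_fun n G"
  shows "Gam n (\<lambda>x. F x * G x) H = (\<lambda>x. F x * Gam n G H x + G x * Gam n F H x)"
  using assms by (simp add: Gam_def[abs_def] pd_mult[of n] fun_eq_iff sum_distrib_left
      sum.distrib[symmetric] algebra_simps)

lemma Gam_add:
  assumes "poly_fun n F" "poly_fun n G"
  shows "Gam n (\<lambda>x. F x + G x) H = (\<lambda>x. Gam n F H x + Gam n G H x)"
  using assms by (simp add: Gam_def[abs_def] pd_add[of n] fun_eq_iff
      sum.distrib[symmetric] algebra_simps)

lemma Gam_cmult: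
  assumes "poly_fun n F"
  shows "Gam n (\<lambda>x. c * F x) H = (\<lambda>x. c * Gam n F H x)"
  using assms by (simp add: Gam_def[abs_def] pd_cmult[of n] fun_eq_iff sum_distrib_left algebra_simps)

lemma integral_Gam_chaos:
  assumes "chaos n p X" "poly_fun n G"
  shows "(\<integral>x. Gam n G X x \<partial>gauss n) = real p * (\<integral>x. G x * X x \<partial>gauss n)"
  using integral_opA[OF assms(2) chaos_poly[OF assms(1)]] assms
  by (simp add: chaos_opA mult.left_commute[of _ "real p"])

lemma Cauchy_Schwarz_poly:
  assumes "poly_fun n F" "poly_fun n G"
  shows "(\<integral>x. F x * G x \<partial>gauss n)\<^sup>2 \<le> (\<integral>x. (F x)\<^sup>2 \<partial>gauss n) * (\<integral>x. (G x)\<^sup>2 \<partial>gauss n)"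
  using assms by (intro Cauchy_Schwarz_integral poly_fun_measurable poly_fun_integrable poly_power)

text \<open>The eigenvalue identity p E[G X] = E Gamma(G,X) with G = X Y^2. The term Y^2 Gamma(X,X)
  is kept as a sum over i so that an induction can be applied to each \<open>pd i X\<close>; the
  choice Y = 1 gives the energy identity that follows.\<close>

lemma chaos_ibp_product:
  assumes X: "chaos n p X" and Y: "poly_fun n Y"
  shows "real p * (\<integral>x. (X x)\<^sup>2 * (Y x)\<^sup>2 \<partial>gauss n) =
    (\<Sum>i<n. \<integral>x. (pd i X x)\<^sup>2 * (Y x)\<^sup>2 \<partial>gauss n) + 2 * (\<integral>x. X x * Y x * Gam n X Y x \<partial>gauss n)"
proof -
  note Xp = chaos_poly[OF X] and Y
  note P = poly_Gam poly_power poly_mult Xp Y poly_pd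
  have "real p * (\<integral>x. (X x)\<^sup>2 * (Y x)\<^sup>2 \<partial>gauss n) = real p * (\<integral>x. (X x * (Y x * Y x)) * X x \<partial>gauss n)"
    by (simp add: power2_eq_square mult_ac)
  also have "\<dots> = (\<integral>x. Gam n (\<lambda>x. X x * (Y x * Y x)) X x \<partial>gauss n)"
    by (rule integral_Gam_chaos[OF X, symmetric]) (intro poly_mult Xp Y)
  also have "Gam n (\<lambda>x. X x * (Y x * Y x)) X = (\<lambda>x. (\<Sum>i<n. (pd i X x)\<^sup>2 * (Y x)\<^sup>2) + 2 * (X x * Y x * Gam n X Y x))"
    using Gam_commute[of n X Y]
    by (simp add: Gam_mult[OF Xp poly_mult[OF Y Y]] Gam_mult[OF Y Y] fun_eq_iff algebra_simps)
       (simp add: Gam_def power2_eq_square sum_distrib_left mult_ac)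
  also have "(\<integral>x. \<dots> x \<partial>gauss n) = (\<integral>x. (\<Sum>i<n. (pd i X x)\<^sup>2 * (Y x)\<^sup>2) \<partial>gauss n) + (\<integral>x. 2 * (X x * Y x * Gam n X Y x) \<partial>gauss n)"
    by (intro Bochner_Integration.integral_add poly_fun_integrable poly_sum poly_cmult P)
  also have "(\<integral>x. (\<Sum>i<n. (pd i X x)\<^sup>2 * (Y x)\<^sup>2) \<partial>gauss n) = (\<Sum>i<n. \<integral>x. (pd i X x)\<^sup>2 * (Y x)\<^sup>2 \<partial>gauss n)"
    by (intro Bochner_Integration.integral_sum poly_fun_integrable P)
  finally show ?thesis by simp
qed

lemma sum_integral_pd_sq:
  assumes X: "chaos n p X"
  shows "(\<Sum>i<n. \<integral>x. (pd i X x)\<^sup>2 \<partial>gauss n) = real p * (\<integral>x. (X x)\<^sup>2 \<partial>gauss n)"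
  using chaos_ibp_product[OF X poly_const[of n 1]] by (simp add: Gam_def pd_const)

text \<open>The quadratic-form estimates for Q = X Y, on which \<open>opB n (p + q)\<close> acts as
  Gamma(X,Y).\<close>

lemma integral_Gam_nonneg:
  assumes "chaos n p X" "chaos n q Y"
  shows "0 \<le> (\<integral>x. X x * Y x * Gam n X Y x \<partial>gauss n)"
    and "(\<integral>x. (Gam n X Y x)\<^sup>2 \<partial>gauss n) \<le> real (min p q) * (\<integral>x. X x * Y x * Gam n X Y x \<partial>gauss n)"
  using chaos2_quadratic[OF chaos2_prod[OF assms]] assms by (simp_all add: opB_prod)

text \<open>
  Integrating by parts in \<open>X\<close> only, rather than in \<open>X\<close> and \<open>Y\<close>, gives the factor \<open>2/p\<close> instead of
  \<open>4/(p + q)\<close>; by symmetry one may then take the smaller of \<open>p\<close> and \<open>q\<close>.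
\<close>

lemma integral_sq_mult_sq_ge:
  assumes "chaos n p X" "chaos n q Y"
  shows "(\<integral>x. (X x)\<^sup>2 \<partial>gauss n) * (\<integral>x. (Y x)\<^sup>2 \<partial>gauss n) \<le> (\<integral>x. (X x)\<^sup>2 * (Y x)\<^sup>2 \<partial>gauss n)"
    and "real p * ((\<integral>x. (X x)\<^sup>2 \<partial>gauss n) * (\<integral>x. (Y x)\<^sup>2 \<partial>gauss n)) + 2 * (\<integral>x. X x * Y x * Gam n X Y x \<partial>gauss n)
      \<le> real p * (\<integral>x. (X x)\<^sup>2 * (Y x)\<^sup>2 \<partial>gauss n)"
proof -
  have "(\<integral>x. (X x)\<^sup>2 \<partial>gauss n) * (\<integral>x. (Y x)\<^sup>2 \<partial>gauss n) \<le> (\<integral>x. (X x)\<^sup>2 * (Y x)\<^sup>2 \<partial>gauss n) \<and>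
    real p * ((\<integral>x. (X x)\<^sup>2 \<partial>gauss n) * (\<integral>x. (Y x)\<^sup>2 \<partial>gauss n)) + 2 * (\<integral>x. X x * Y x * Gam n X Y x \<partial>gauss n)
      \<le> real p * (\<integral>x. (X x)\<^sup>2 * (Y x)\<^sup>2 \<partial>gauss n)"
    using assms(1)
  proof (induction p arbitrary: X)
    case 0
    then obtain c where X: "X = (\<lambda>x. c)" using chaos_0 by blast
    show ?case unfolding X Gam_const by (simp add: gauss.prob_space)
  next
    case (Suc p)
    let ?E = "\<lambda>F. integral\<^sup>L (gauss n) F"
    have "real (Suc p) * (?E (\<lambda>x. (X x)\<^sup>2) * ?E (\<lambda>x. (Y x)\<^sup>2)) =
        (\<Sum>i<n. ?E (\<lambda>x. (pd i X x)\<^sup>2) * ?E (\<lambda>x. (Y x)\<^sup>2))"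
      unfolding sum_distrib_right[symmetric] sum_integral_pd_sq[OF Suc.prems] by (rule mult.assoc[symmetric])
    \<comment> \<open>Each \<open>pd i X\<close> has order p, so the first inequality of the
      induction hypothesis applies with it in place of X.\<close>
    also have "\<dots> \<le> (\<Sum>i<n. ?E (\<lambda>x. (pd i X x)\<^sup>2 * (Y x)\<^sup>2))"
      using Suc.IH[OF chaos_pd[OF _ Suc.prems]] by (intro sum_mono) auto
    finally have 1: "real (Suc p) * (?E (\<lambda>x. (X x)\<^sup>2) * ?E (\<lambda>x. (Y x)\<^sup>2)) + 2 * ?E (\<lambda>x. X x * Y x * Gam n X Y x)
        \<le> real (Suc p) * ?E (\<lambda>x. (X x)\<^sup>2 * (Y x)\<^sup>2)"
      using chaos_ibp_product[OF Suc.prems chaos_poly[OF assms(2)]] by simp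
    \<comment> \<open>The first inequality follows from the second because E[X Y Gamma(X,Y)] is
      nonnegative.\<close>
    then have "real (Suc p) * (?E (\<lambda>x. (X x)\<^sup>2) * ?E (\<lambda>x. (Y x)\<^sup>2)) \<le> real (Suc p) * ?E (\<lambda>x. (X x)\<^sup>2 * (Y x)\<^sup>2)"
      using integral_Gam_nonneg(1)[OF Suc.prems assms(2)] by linarith
    then have "?E (\<lambda>x. (X x)\<^sup>2) * ?E (\<lambda>x. (Y x)\<^sup>2) \<le> ?E (\<lambda>x. (X x)\<^sup>2 * (Y x)\<^sup>2)"
      by (subst (asm) mult_le_cancel_left_pos) auto
    with 1 show ?case by simp
  qed
  then show "(\<integral>x. (X x)\<^sup>2 \<partial>gauss n) * (\<integral>x. (Y x)\<^sup>2 \<partial>gauss n) \<le> (\<integral>x. (X x)\<^sup>2 * (Y x)\<^sup>2 \<partial>gauss n)"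
    and "real p * ((\<integral>x. (X x)\<^sup>2 \<partial>gauss n) * (\<integral>x. (Y x)\<^sup>2 \<partial>gauss n)) + 2 * (\<integral>x. X x * Y x * Gam n X Y x \<partial>gauss n)
      \<le> real p * (\<integral>x. (X x)\<^sup>2 * (Y x)\<^sup>2 \<partial>gauss n)" by auto
qed

text \<open>The eigenvalue identity tested against X^3, together with the chain rule Gamma(X^3,X) =
  3 X^2 Gamma(X,X).\<close>

lemma integral_power4_chaos:
  assumes X: "chaos n p X"
  shows "real p * (\<integral>x. (X x) ^ 4 \<partial>gauss n) = 3 * (\<integral>x. (X x)\<^sup>2 * Gam n X X x \<partial>gauss n)"
proof -
  note Xp = chaos_poly[OF X]
  have "real p * (\<integral>x. (X x) ^ 4 \<partial>gauss n) = real p * (\<integral>x. (X x * (X x * X x)) * X x \<partial>gauss n)"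
    by (simp add: power4_eq_xxxx mult_ac)
  also have "\<dots> = (\<integral>x. Gam n (\<lambda>x. X x * (X x * X x)) X x \<partial>gauss n)"
    by (rule integral_Gam_chaos[OF X, symmetric]) (intro poly_mult Xp)
  also have "Gam n (\<lambda>x. X x * (X x * X x)) X = (\<lambda>x. 3 * ((X x)\<^sup>2 * Gam n X X x))"
    by (simp add: Gam_mult[OF Xp poly_mult[OF Xp Xp]] Gam_mult[OF Xp Xp] fun_eq_iff power2_eq_square)
  finally show ?thesis by simp
qed

text \<open>
  By \<open>integral_power4_chaos\<close> and Cauchy-Schwarz, \<open>p\<^sup>2 E X\<^sup>4 \<le> 9 E \<Gamma>(X,X)\<^sup>2\<close>, and the right-hand side only
  involves the derivatives of \<open>X\<close>, which lie in the chaos of order \<open>p - 1\<close>.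
\<close>

lemma chaos_hypercontractive:
  assumes "chaos n p X"
  shows "(\<integral>x. (X x) ^ 4 \<partial>gauss n) \<le> 9 ^ p * (\<integral>x. (X x)\<^sup>2 \<partial>gauss n)\<^sup>2"
  using assms
proof (induction p arbitrary: X)
  case 0
  then obtain c where X: "X = (\<lambda>x. c)" using chaos_0 by blast
  show ?case unfolding X by (simp add: gauss.prob_space)
next
  case (Suc p)
  let ?E = "\<lambda>F. integral\<^sup>L (gauss n) F" and ?p = "real (Suc p)"
  define a where "a = ?E (\<lambda>x. (X x) ^ 4)"
  define v where "v = ?E (\<lambda>x. (X x)\<^sup>2)"
  define e where "e i = ?E (\<lambda>x. (pd i X x)\<^sup>2)" for i
  note Xp = chaos_poly[OF Suc.prems]
  have a0: "0 \<le> a" and e0: "\<And>i. 0 \<le> e i" unfolding a_def e_def by simp_all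
  have se: "(\<Sum>i<n. e i) = ?p * v" unfolding e_def v_def by (rule sum_integral_pd_sq[OF Suc.prems])
  have "?E (\<lambda>x. (Gam n X X x)\<^sup>2) = (\<Sum>i<n. \<Sum>j<n. ?E (\<lambda>x. (pd i X x)\<^sup>2 * (pd j X x)\<^sup>2))"
    unfolding Gam_def power2_eq_square
    by (rule integral_sum_mult_sum) (auto intro: poly_intros poly_pd Xp)
  \<comment> \<open>Cauchy-Schwarz reduces the mixed moments of two derivatives to their fourth
    moments, to which the induction hypothesis applies. Since the bound is a product of a term in i
    and a term in j, the double sum becomes the square of the total energy.\<close>
  also have "\<dots> \<le> (\<Sum>i<n. \<Sum>j<n. 9 ^ p * (e i * e j))"
  proof (intro sum_mono)
    fix i j assume ij: "i \<in> {..<n}" "j \<in> {..<n}"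
    have "(?E (\<lambda>x. (pd i X x)\<^sup>2 * (pd j X x)\<^sup>2))\<^sup>2 \<le> ?E (\<lambda>x. ((pd i X x)\<^sup>2)\<^sup>2) * ?E (\<lambda>x. ((pd j X x)\<^sup>2)\<^sup>2)"
      by (intro Cauchy_Schwarz_poly poly_power poly_pd Xp)
    also have "\<dots> = ?E (\<lambda>x. (pd i X x) ^ 4) * ?E (\<lambda>x. (pd j X x) ^ 4)" by simp
    also have "\<dots> \<le> (9 ^ p * (e i)\<^sup>2) * (9 ^ p * (e j)\<^sup>2)"
      unfolding e_def using ij by (intro mult_mono Suc.IH chaos_pd[OF _ Suc.prems]) auto
    also have "\<dots> = (9 ^ p * (e i * e j))\<^sup>2" by (simp add: power2_eq_square mult_ac)
    finally show "?E (\<lambda>x. (pd i X x)\<^sup>2 * (pd j X x)\<^sup>2) \<le> 9 ^ p * (e i * e j)"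
      by (rule power2_le_imp_le) (simp add: e0)
  qed
  also have "\<dots> = 9 ^ p * (?p * v)\<^sup>2"
    unfolding se[symmetric] power2_eq_square sum_product by (simp add: sum_distrib_left)
  finally have G: "?E (\<lambda>x. (Gam n X X x)\<^sup>2) \<le> 9 ^ p * (?p * v)\<^sup>2" .
  have "(?p * a)\<^sup>2 = 9 * (?E (\<lambda>x. (X x)\<^sup>2 * Gam n X X x))\<^sup>2"
    unfolding a_def integral_power4_chaos[OF Suc.prems] by (simp add: power_mult_distrib)
  also have "\<dots> \<le> 9 * (?E (\<lambda>x. ((X x)\<^sup>2)\<^sup>2) * ?E (\<lambda>x. (Gam n X X x)\<^sup>2))"
    by (intro mult_left_mono Cauchy_Schwarz_poly poly_power poly_Gam Xp) simp
  also have "\<dots> = 9 * (a * ?E (\<lambda>x. (Gam n X X x)\<^sup>2))" by (simp add: a_def)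
  also have "\<dots> \<le> 9 * (a * (9 ^ p * (?p * v)\<^sup>2))"
    by (intro mult_left_mono G a0) simp
  finally have "?p\<^sup>2 * (a * a) \<le> ?p\<^sup>2 * (a * (9 ^ Suc p * v\<^sup>2))"
    by (simp add: power_mult_distrib power2_eq_square mult_ac)
  then have "a * a \<le> a * (9 ^ Suc p * v\<^sup>2)"
    by (subst (asm) mult_le_cancel_left_pos) auto
  then have "a \<le> 9 ^ Suc p * v\<^sup>2"
  proof (cases "a = 0")
    case False
    with a0 have "a > 0" by simp
    with \<open>a * a \<le> a * (9 ^ Suc p * v\<^sup>2)\<close> show ?thesis by (subst (asm) mult_le_cancel_left_pos)
  qed simp
  then show ?case by (simp add: a_def v_def)
qed

text \<open>Write 1 - Gamma(V,Z) as (1 - v) - (al + be + ga), where \<open>al\<close> and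
  \<open>be\<close> are the centred diagonal parts and \<open>ga\<close> the mixed part. All three
  have mean 0, and by parity \<open>ga\<close> is uncorrelated with \<open>al\<close> and
  \<open>be\<close>. On the other side E Z^4 - 3 v^2 splits into the cumulants of X and Y plus 6
  \<open>C\<close>, and the two splittings are compared term by term.\<close>

lemma fourth_moment_bound:
  assumes X: "chaos n p X" and Y: "chaos n q Y" and p: "0 < p" and q: "0 < q" and par: "odd (p + q)"
  defines "Z \<equiv> \<lambda>x. X x + Y x"
  defines "V \<equiv> \<lambda>x. X x / real p + Y x / real q"
  defines "v \<equiv> (\<integral>x. (Z x)\<^sup>2 \<partial>gauss n)"
  shows "(\<integral>x. (1 - Gam n V Z x)\<^sup>2 \<partial>gauss n) \<le> (1 - v)\<^sup>2 + 2/3 * ((\<integral>x. (Z x) ^ 4 \<partial>gauss n) - 3 * v\<^sup>2)"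
proof -
  let ?E = "\<lambda>F. integral\<^sup>L (gauss n) F"
  note Xp = chaos_poly[OF X] and Yp = chaos_poly[OF Y]
  note I = poly_fun_integrable
  obtain p' q' where p': "p = Suc p'" and q': "q = Suc q'" using p q by (metis gr0_implies_Suc)
  define a b where "a = ?E (\<lambda>x. (X x)\<^sup>2)" and "b = ?E (\<lambda>x. (Y x)\<^sup>2)"
  define m where "m = real (min p q)"
  define c where "c = 1 / real p + 1 / real q"
  define N where "N = ?E (\<lambda>x. X x * Y x * Gam n X Y x)"
  define al where "al = (\<lambda>x. Gam n X X x / real p - a)"
  define be where "be = (\<lambda>x. Gam n Y Y x / real q - b)"
  define ga where "ga = (\<lambda>x. c * Gam n X Y x)"
  have alp: "poly_fun n al" and bep: "poly_fun n be" and gap: "poly_fun n ga"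
    unfolding al_def be_def ga_def by (intro poly_intros poly_Gam Xp Yp)+
  have GXX: "chaos2 n p' p' (Gam n X X)" and GYY: "chaos2 n q' q' (Gam n Y Y)" and GXY: "chaos2 n p' q' (Gam n X Y)"
    using X Y unfolding p' q' by (auto intro: chaos2_Gam)
  have XY0: "?E (\<lambda>x. X x * Y x) = 0"
    using chaos2_integral_eq_0[OF chaos2_prod[OF X Y]] par by simp
  have X3Y: "?E (\<lambda>x. (X x * X x) * (X x * Y x)) = 0"
    by (rule chaos2_orthogonal[OF chaos2_prod[OF X X] chaos2_prod[OF X Y]]) (use par in auto)
  have XY3: "?E (\<lambda>x. (Y x * Y x) * (X x * Y x)) = 0"
    by (rule chaos2_orthogonal[OF chaos2_prod[OF Y Y] chaos2_prod[OF X Y]]) (use par in auto)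
  have G0: "?E (Gam n X Y) = 0"
    using chaos2_integral_eq_0[OF GXY] par by (simp add: p' q')
  have GX0: "?E (\<lambda>x. Gam n X X x * Gam n X Y x) = 0" and GY0: "?E (\<lambda>x. Gam n Y Y x * Gam n X Y x) = 0"
    using chaos2_orthogonal[OF GXX GXY] chaos2_orthogonal[OF GYY GXY] par by (simp_all add: p' q')
  have v: "v = a + b"
  proof -
    have "v = ?E (\<lambda>x. (X x)\<^sup>2 + (Y x)\<^sup>2 + 2 * (X x * Y x))"
      unfolding v_def Z_def by (simp add: power2_eq_square algebra_simps)
    also have "\<dots> = a + b + 2 * ?E (\<lambda>x. X x * Y x)"
      unfolding a_def b_def by (simp add: I poly_add poly_power poly_mult Xp Yp)
    finally show ?thesis using XY0 by simp
  qed
  have Z4: "?E (\<lambda>x. (Z x) ^ 4) = ?E (\<lambda>x. (X x) ^ 4) + ?E (\<lambda>x. (Y x) ^ 4) + 6 * ?E (\<lambda>x. (X x)\<^sup>2 * (Y x)\<^sup>2)"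
  proof -
    have "?E (\<lambda>x. (Z x) ^ 4) = ?E (\<lambda>x. (X x) ^ 4 + (Y x) ^ 4 + 6 * ((X x)\<^sup>2 * (Y x)\<^sup>2)
       + 4 * ((X x * X x) * (X x * Y x)) + 4 * ((Y x * Y x) * (X x * Y x)))"
      unfolding Z_def by (intro Bochner_Integration.integral_cong refl) (simp add: power4_eq_xxxx power2_eq_square algebra_simps)
    also have "\<dots> = ?E (\<lambda>x. (X x) ^ 4) + ?E (\<lambda>x. (Y x) ^ 4) + 6 * ?E (\<lambda>x. (X x)\<^sup>2 * (Y x)\<^sup>2)
       + 4 * ?E (\<lambda>x. (X x * X x) * (X x * Y x)) + 4 * ?E (\<lambda>x. (Y x * Y x) * (X x * Y x))"
      by (simp add: I poly_add poly_power poly_mult Xp Yp)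
    finally show ?thesis using X3Y XY3 by simp
  qed
  \<comment> \<open>With both factors equal the estimates read E Gamma^2 \<le> r E[F^2 Gamma] = r^2
    E F^4 / 3, and E Gamma = r E F^2.\<close>
  have single: "?E (\<lambda>x. (Gam n F F x / real r - ?E (\<lambda>x. (F x)\<^sup>2))\<^sup>2) \<le> ?E (\<lambda>x. (F x) ^ 4) / 3 - (?E (\<lambda>x. (F x)\<^sup>2))\<^sup>2
     \<and> ?E (\<lambda>x. Gam n F F x / real r - ?E (\<lambda>x. (F x)\<^sup>2)) = 0"
    if F: "chaos n r F" and r: "0 < r" for F r
  proof -
    let ?u = "?E (\<lambda>x. (F x)\<^sup>2)"
    note Fp = chaos_poly[OF F]
    have m: "?E (Gam n F F) = real r * ?u"
      using integral_Gam_chaos[OF F Fp] by (simp add: power2_eq_square)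
    have "?E (\<lambda>x. (Gam n F F x)\<^sup>2) \<le> real r * ?E (\<lambda>x. (F x)\<^sup>2 * Gam n F F x)"
      using integral_Gam_nonneg(2)[OF F F] by (simp add: power2_eq_square)
    also have "\<dots> = real r * (real r * ?E (\<lambda>x. (F x) ^ 4) / 3)"
      using integral_power4_chaos[OF F] by simp
    finally have G2: "?E (\<lambda>x. (Gam n F F x)\<^sup>2) \<le> (real r)\<^sup>2 * (?E (\<lambda>x. (F x) ^ 4) / 3)"
      by (simp add: power2_eq_square)
    have "?E (\<lambda>x. (Gam n F F x / real r - ?u)\<^sup>2) =
       ?E (\<lambda>x. (Gam n F F x)\<^sup>2 / (real r)\<^sup>2 - (2 * ?u / real r) * Gam n F F x + ?u\<^sup>2)"
      using r by (intro Bochner_Integration.integral_cong refl) (simp add: power2_eq_square field_simps)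
    also have "\<dots> = ?E (\<lambda>x. (Gam n F F x)\<^sup>2) / (real r)\<^sup>2 - (2 * ?u / real r) * ?E (Gam n F F) + ?u\<^sup>2"
      by (simp add: I poly_power poly_Gam Fp gauss.prob_space)
    also have "\<dots> = ?E (\<lambda>x. (Gam n F F x)\<^sup>2) / (real r)\<^sup>2 - ?u\<^sup>2"
      unfolding m using r by (simp add: power2_eq_square)
    also have "\<dots> \<le> ?E (\<lambda>x. (F x) ^ 4) / 3 - ?u\<^sup>2"
      using G2 r by (simp add: divide_le_eq mult.commute)
    finally have 1: "?E (\<lambda>x. (Gam n F F x / real r - ?u)\<^sup>2) \<le> ?E (\<lambda>x. (F x) ^ 4) / 3 - ?u\<^sup>2" .
    have "?E (\<lambda>x. Gam n F F x / real r - ?u) = ?E (Gam n F F) / real r - ?u"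
      by (simp add: I poly_Gam Fp gauss.prob_space)
    with 1 show ?thesis using r m by simp
  qed
  have al2: "?E (\<lambda>x. (al x)\<^sup>2) \<le> ?E (\<lambda>x. (X x) ^ 4) / 3 - a\<^sup>2" and al0: "?E al = 0"
    using single[OF X p] by (simp_all add: al_def a_def)
  have be2: "?E (\<lambda>x. (be x)\<^sup>2) \<le> ?E (\<lambda>x. (Y x) ^ 4) / 3 - b\<^sup>2" and be0: "?E be = 0"
    using single[OF Y q] by (simp_all add: be_def b_def)
  define C where "C = ?E (\<lambda>x. (X x)\<^sup>2 * (Y x)\<^sup>2) - a * b"
  have C0: "0 \<le> C" using integral_sq_mult_sq_ge(1)[OF X Y] by (simp add: C_def a_def b_def)
  have m0: "0 < m" using p q by (simp add: m_def)
  \<comment> \<open>The covariance inequality may be used with X or with Y as the function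
    integrated by parts, giving the factor p or q; hence the minimum.\<close>
  have NC: "2 * N \<le> m * C"
  proof -
    have "2 * N \<le> real p * C"
      using integral_sq_mult_sq_ge(2)[OF X Y] by (simp add: C_def a_def b_def N_def right_diff_distrib)
    moreover have "2 * N \<le> real q * C"
      using integral_sq_mult_sq_ge(2)[OF Y X] Gam_commute[of n X Y]
      by (simp add: C_def a_def b_def N_def right_diff_distrib mult.commute)
    ultimately show ?thesis by (simp add: m_def min_def)
  qed
  \<comment> \<open>This is where the minimum matters: m/p and m/q are both at most 1, so the
    constant does not depend on the ratio of p and q.\<close>
  have cm: "0 \<le> c * m" "c * m \<le> 2"
  proof -
    have "c * m = m / real p + m / real q" by (simp add: c_def field_simps)
    moreover have "m / real p \<le> 1" "m / real q \<le> 1" "0 \<le> m / real p" "0 \<le> m / real q"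
      using p q by (auto simp: m_def)
    ultimately show "0 \<le> c * m" "c * m \<le> 2" by linarith+
  qed
  \<comment> \<open>Two factors m arise, one from E Gamma(X,Y)^2 \<le> m N and one from N \<le> m C
    / 2; together with c^2 they form (c m)^2 \<le> 4.\<close>
  have ga2: "?E (\<lambda>x. (ga x)\<^sup>2) \<le> 2 * C"
  proof -
    have "?E (\<lambda>x. (ga x)\<^sup>2) = c\<^sup>2 * ?E (\<lambda>x. (Gam n X Y x)\<^sup>2)" by (simp add: ga_def power_mult_distrib)
    also have "\<dots> \<le> c\<^sup>2 * (m * N)"
      using integral_Gam_nonneg(2)[OF X Y] by (intro mult_left_mono) (auto simp: m_def N_def)
    also have "\<dots> \<le> c\<^sup>2 * (m * (m * C / 2))"
      using NC m0 by (intro mult_left_mono) auto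
    also have "\<dots> = (c * m)\<^sup>2 * (C / 2)" by (simp add: power2_eq_square)
    also have "\<dots> \<le> 2\<^sup>2 * (C / 2)"
      using cm C0 by (intro mult_right_mono power_mono) auto
    finally show ?thesis by simp
  qed
  have ga0: "?E ga = 0" using G0 by (simp add: ga_def)
  have alga: "?E (\<lambda>x. al x * ga x) = 0"
  proof -
    have "?E (\<lambda>x. al x * ga x) = ?E (\<lambda>x. (c / real p) * (Gam n X X x * Gam n X Y x) - (a * c) * Gam n X Y x)"
      by (simp add: al_def ga_def algebra_simps)
    also have "\<dots> = 0"
      using GX0 G0 by (simp add: I poly_mult poly_Gam Xp Yp)
    finally show ?thesis .
  qed
  have bega: "?E (\<lambda>x. be x * ga x) = 0"
  proof -
    have "?E (\<lambda>x. be x * ga x) = ?E (\<lambda>x. (c / real q) * (Gam n Y Y x * Gam n X Y x) - (b * c) * Gam n X Y x)"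
      by (simp add: be_def ga_def algebra_simps)
    also have "\<dots> = 0"
      using GY0 G0 by (simp add: I poly_mult poly_Gam Xp Yp)
    finally show ?thesis .
  qed
  have Gam: "1 - Gam n V Z x = (1 - v) - (al x + be x + ga x)" for x
  proof -
    have "Gam n V Z x = Gam n X X x / real p + Gam n Y Y x / real q + c * Gam n X Y x"
    proof -
      have V: "V = (\<lambda>x. (1 / real p) * X x + (1 / real q) * Y x)" by (simp add: V_def)
      have "Gam n V Z x = (1 / real p) * Gam n X Z x + (1 / real q) * Gam n Y Z x"
        unfolding V by (simp only: Gam_add[OF poly_cmult[OF Xp] poly_cmult[OF Yp]] Gam_cmult[OF Xp] Gam_cmult[OF Yp])
      moreover have "Gam n X Z x = Gam n X X x + Gam n X Y x"
        unfolding Z_def Gam_commute[of n X "\<lambda>x. X x + Y x"] Gam_add[OF Xp Yp] by (simp add: Gam_commute)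
      moreover have "Gam n Y Z x = Gam n X Y x + Gam n Y Y x"
        unfolding Z_def Gam_commute[of n Y "\<lambda>x. X x + Y x"] Gam_add[OF Xp Yp] by simp
      ultimately show ?thesis by (simp add: c_def algebra_simps add_divide_distrib)
    qed
    then show ?thesis by (simp add: al_def be_def ga_def v)
  qed
  have "?E (\<lambda>x. (1 - Gam n V Z x)\<^sup>2) \<le> ?E (\<lambda>x. (1 - v)\<^sup>2 + 2 * (al x)\<^sup>2 + 2 * (be x)\<^sup>2 + (ga x)\<^sup>2
       + 2 * (al x * ga x) + 2 * (be x * ga x) - (2 * (1 - v)) * (al x + be x + ga x))"
  proof (rule integral_mono)
    show "integrable (gauss n) (\<lambda>x. (1 - Gam n V Z x)\<^sup>2)"
      unfolding Gam by (intro I poly_intros alp bep gap)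
    show "integrable (gauss n) (\<lambda>x. (1 - v)\<^sup>2 + 2 * (al x)\<^sup>2 + 2 * (be x)\<^sup>2 + (ga x)\<^sup>2
       + 2 * (al x * ga x) + 2 * (be x * ga x) - (2 * (1 - v)) * (al x + be x + ga x))"
      by (intro I poly_intros alp bep gap)
    fix x
    \<comment> \<open>The cross term 2 \<open>al\<close> \<open>be\<close> is not shown to vanish;
      it is absorbed into the squares, which doubles their coefficients.\<close>
    have "0 \<le> (al x - be x)\<^sup>2" by simp
    then show "(1 - Gam n V Z x)\<^sup>2 \<le> (1 - v)\<^sup>2 + 2 * (al x)\<^sup>2 + 2 * (be x)\<^sup>2 + (ga x)\<^sup>2
       + 2 * (al x * ga x) + 2 * (be x * ga x) - (2 * (1 - v)) * (al x + be x + ga x)"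
      unfolding Gam by (simp add: power2_eq_square algebra_simps)
  qed
  also have "\<dots> = (1 - v)\<^sup>2 + 2 * ?E (\<lambda>x. (al x)\<^sup>2) + 2 * ?E (\<lambda>x. (be x)\<^sup>2) + ?E (\<lambda>x. (ga x)\<^sup>2)
       + 2 * ?E (\<lambda>x. al x * ga x) + 2 * ?E (\<lambda>x. be x * ga x) - (2 * (1 - v)) * (?E al + ?E be + ?E ga)"
    by (simp add: I poly_power poly_mult poly_add poly_cmult alp bep gap gauss.prob_space)
  \<comment> \<open>The mixed part costs 2 \<open>C\<close>. It is enlarged to 4 \<open>C\<close> to
    match 2/3 times the 6 \<open>C\<close> contained in the fourth cumulant.\<close>
  also have "\<dots> \<le> (1 - v)\<^sup>2 + 2 * (?E (\<lambda>x. (X x) ^ 4) / 3 - a\<^sup>2) + 2 * (?E (\<lambda>x. (Y x) ^ 4) / 3 - b\<^sup>2) + 4 * C"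
    using al2 be2 ga2 C0 by (simp add: alga bega al0 be0 ga0)
  also have "\<dots> = (1 - v)\<^sup>2 + 2/3 * (?E (\<lambda>x. (Z x) ^ 4) - 3 * v\<^sup>2)"
    unfolding Z4 v C_def by (simp add: power2_eq_square algebra_simps)
  finally show ?thesis .
qed

subsection \<open>Stein's method\<close>

lemma DERIV_std_normal_density: "(std_normal_density has_real_derivative - x * std_normal_density x) (at x)"
  unfolding std_normal_density_def
  by (rule DERIV_cong, (rule derivative_intros refl | simp)+)

lemma integral_gauss1: "f \<in> borel_measurable borel \<Longrightarrow> integral\<^sup>L gauss1 f = (\<integral>x. std_normal_density x * f x \<partial>lborel)"
  for f :: "real \<Rightarrow> real"
  by (simp add: integral_density)

lemma integrable_std_normal_bounded:
  assumes [measurable]: "k \<in> borel_measurable borel" and k: "\<And>t. \<bar>k t\<bar> \<le> (c::real)"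
  shows "integrable lborel (\<lambda>t. k t * std_normal_density t)"
proof (rule Bochner_Integration.integrable_bound)
  show "integrable lborel (\<lambda>t. c * std_normal_density t)" by simp
  show "AE t in lborel. norm (k t * std_normal_density t) \<le> norm (c * std_normal_density t)"
    using k order_trans[OF k abs_ge_self] by (auto simp: abs_mult intro!: mult_right_mono)
qed simp

text \<open>The Mills-ratio argument: on the half-line t \<ge> x the factor x may be replaced by t,
  and t d(t) has the antiderivative -d(t), where d is the normal density.\<close>

lemma std_normal_tail_bound:
  fixes k :: "real \<Rightarrow> real"
  assumes x: "0 \<le> x" and [measurable]: "k \<in> borel_measurable borel" and k: "\<And>t. \<bar>k t\<bar> \<le> indicator {x..} t"
  shows "\<bar>x * (\<integral>t. k t * std_normal_density t \<partial>lborel)\<bar> \<le> std_normal_density x"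
proof -
  have lim: "((\<lambda>t. - std_normal_density t) \<longlongrightarrow> 0) at_top"
    unfolding std_normal_density_def by real_asymp
  have "(\<integral>\<^sup>+t. ennreal (t * std_normal_density t) * indicator {x..} t \<partial>lborel) = ennreal (0 - (- std_normal_density x))"
    using x by (intro nn_integral_FTC_atLeast[OF _ _ _ lim])
      (auto intro!: derivative_eq_intros DERIV_std_normal_density)
  then have "(\<integral>\<^sup>+t. ennreal (t * std_normal_density t * indicator {x..} t) \<partial>lborel) = ennreal (std_normal_density x)"
    by (simp add: indicator_mult_ennreal mult_ac)
  moreover have "AE t in lborel. 0 \<le> t * std_normal_density t * indicator {x..} t"
    using x by (intro AE_I2) (auto simp: indicator_def)
  ultimately have hb: "has_bochner_integral lborel (\<lambda>t. t * std_normal_density t * indicator {x..} t) (std_normal_density x)"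
    by (intro has_bochner_integral_nn_integral) auto
  have "\<bar>x * (\<integral>t. k t * std_normal_density t \<partial>lborel)\<bar> = \<bar>\<integral>t. x * (k t * std_normal_density t) \<partial>lborel\<bar>" by simp
  also have "\<dots> \<le> (\<integral>t. \<bar>x * (k t * std_normal_density t)\<bar> \<partial>lborel)" by (rule integral_abs_bound)
  also have "\<dots> \<le> (\<integral>t. t * std_normal_density t * indicator {x..} t \<partial>lborel)"
  proof (rule integral_mono)
    show "integrable lborel (\<lambda>t. \<bar>x * (k t * std_normal_density t)\<bar>)"
      using k by (intro integrable_abs integrable_mult_right integrable_std_normal_bounded[of _ 1])
        (auto intro: order_trans[OF k] simp: indicator_def)
    show "integrable lborel (\<lambda>t. t * std_normal_density t * indicator {x..} t)"
      using hb by (auto simp: has_bochner_integral_iff)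
    fix t
    show "\<bar>x * (k t * std_normal_density t)\<bar> \<le> t * std_normal_density t * indicator {x..} t"
    proof (cases "t \<ge> x")
      case True
      then have "x * \<bar>k t\<bar> \<le> t * 1" using k[of t] x by (intro mult_mono) auto
      then have "x * \<bar>k t\<bar> * std_normal_density t \<le> t * 1 * std_normal_density t"
        by (intro mult_right_mono) auto
      then show ?thesis using True x by (simp add: abs_mult mult_ac)
    next
      case False
      then show ?thesis using k[of t] by simp
    qed
  qed
  also have "\<dots> = std_normal_density x" using hb by (auto simp: has_bochner_integral_iff)
  finally show ?thesis .
qed

text \<open>With g = h - E h(N), the solution is f(x) = -T(x)/d(x), where T(x) is the integral of g
  d over [x, \<infinity>). The tail bound gives \<bar>x f x\<bar> \<le> 1, and f' = g + x f then
  yields the bound 2. Continuity of h makes \<open>f'\<close> continuous, as the integration by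
  parts requires.\<close>

lemma stein_equation:
  fixes h :: "real \<Rightarrow> real"
  assumes h: "continuous_on UNIV h" and h01: "\<And>x. 0 \<le> h x" "\<And>x. h x \<le> 1"
  obtains f f' where "\<And>x. (f has_real_derivative f' x) (at x)" "\<And>x. isCont f' x"
    "\<And>x. \<bar>f' x\<bar> \<le> 2" "\<And>x. f' x - x * f x = h x - (\<integral>y. h y \<partial>gauss1)"
proof -
  let ?d = std_normal_density
  define \<mu> where "\<mu> = (\<integral>y. h y \<partial>gauss1)"
  define g where "g x = h x - \<mu>" for x
  have [measurable]: "h \<in> borel_measurable borel" using h by (rule borel_measurable_continuous_onI)
  have [measurable]: "g \<in> borel_measurable borel" unfolding g_def[abs_def] by measurable
  have ih: "integrable gauss1 h"
    using h01 by (intro gauss1.integrable_const_bound[of _ 1]) auto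
  have "0 \<le> \<mu>" unfolding \<mu>_def using h01 by simp
  moreover have "\<mu> \<le> 1"
    unfolding \<mu>_def using gauss1.integral_le_const[OF ih] h01 by simp
  ultimately have g1: "\<bar>g x\<bar> \<le> 1" for x using h01[of x] by (auto simp: g_def)
  have gc: "isCont g x" for x
    using h by (auto simp: g_def[abs_def] continuous_on_eq_continuous_at intro!: continuous_intros)
  have dc: "isCont ?d x" for x using DERIV_std_normal_density DERIV_isCont by blast
  have dpos: "?d x > 0" for x by (simp add: normal_density_pos)
  have id: "integrable lborel (\<lambda>t. k t * ?d t)" if "k \<in> borel_measurable borel" "\<And>t. \<bar>k t\<bar> \<le> 1" for k
    using that by (rule integrable_std_normal_bounded)
  have g0: "(\<integral>t. g t * ?d t \<partial>lborel) = 0"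
  proof -
    have "(\<integral>t. g t \<partial>gauss1) = 0"
      unfolding g_def using ih gauss1.prob_space by (simp add: \<mu>_def)
    then show ?thesis by (subst (asm) integral_gauss1) (auto simp: mult.commute)
  qed
  define T where "T x = (\<integral>t. (g t * indicator {x..} t) * ?d t \<partial>lborel)" for x
  have gind: "\<bar>g t * indicator A t\<bar> \<le> 1" for A t using g1[of t] by (auto simp: indicator_def)
  \<comment> \<open>As g has Gaussian mean 0, T is also minus the integral over the left half-line.
    For x < 0 this form, reflected at the origin, puts the tail bound into reach.\<close>
  have T2: "T x = - (\<integral>t. (g t * indicator {..<x} t) * ?d t \<partial>lborel)" for x
  proof -
    have "T x + (\<integral>t. (g t * indicator {..<x} t) * ?d t \<partial>lborel)
       = (\<integral>t. (g t * indicator {x..} t) * ?d t + (g t * indicator {..<x} t) * ?d t \<partial>lborel)"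
      unfolding T_def by (intro Bochner_Integration.integral_add[symmetric] id gind) auto
    also have "\<dots> = (\<integral>t. g t * ?d t \<partial>lborel)"
      by (intro Bochner_Integration.integral_cong) (auto simp: indicator_def)
    finally show ?thesis using g0 by simp
  qed
  \<comment> \<open>T is differentiated by comparison with an antiderivative G of g d: T + G is
    constant.\<close>
  have "\<exists>F. \<forall>x::real. -\<infinity> < ereal x \<longrightarrow> ereal x < \<infinity> \<longrightarrow> (F has_vector_derivative (g x * ?d x)) (at x)"
    by (rule einterval_antiderivative) (auto intro!: continuous_intros gc dc)
  then obtain G where G: "(G has_real_derivative g x * ?d x) (at x)" for x
    by (auto simp: has_real_derivative_iff_has_vector_derivative)
  have TG: "T a - T b = G b - G a" if "a \<le> b" for a b
  proof -
    have "T a - T b = (\<integral>t. (g t * indicator {a..} t) * ?d t - (g t * indicator {b..} t) * ?d t \<partial>lborel)"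
      unfolding T_def by (intro Bochner_Integration.integral_diff[symmetric] id gind) auto
    also have "\<dots> = (\<integral>t. (g t * ?d t) * indicator {a..b} t \<partial>lborel)"
    proof (rule integral_cong_AE)
      show "AE t in lborel. (g t * indicator {a..} t) * ?d t - (g t * indicator {b..} t) * ?d t = (g t * ?d t) * indicator {a..b} t"
        using AE_lborel_singleton[of b] by eventually_elim (use that in \<open>auto simp: indicator_def\<close>)
    qed auto
    also have "\<dots> = G b - G a"
      using that G by (intro integral_FTC_Icc_real) (auto intro!: continuous_intros gc dc)
    finally show ?thesis .
  qed
  have "T x = (T 0 + G 0) - G x" for x
    using TG[of x 0] TG[of 0 x] by (cases "x \<le> 0") auto
  then have T_eq: "T = (\<lambda>x. (T 0 + G 0) - G x)" by blast
  have dT: "(T has_real_derivative - (g x * ?d x)) (at x)" for x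
    by (subst T_eq) (auto intro!: derivative_eq_intros G)
  have xT: "\<bar>x * T x\<bar> \<le> ?d x" for x
  proof (cases "0 \<le> x")
    case True
    show ?thesis unfolding T_def
      by (rule std_normal_tail_bound[OF True]) (use g1 in \<open>auto simp: indicator_def\<close>)
  next
    case False
    have "(\<integral>t. (g t * indicator {..<x} t) * ?d t \<partial>lborel) = (\<integral>t. (g (-t) * indicator {..<x} (-t)) * ?d (-t) \<partial>lborel)"
      using lborel_integral_real_affine[of "-1" "\<lambda>t. (g t * indicator {..<x} t) * ?d t" 0] by simp
    also have "\<dots> = (\<integral>t. (g (-t) * indicator {..<x} (-t)) * ?d t \<partial>lborel)"
      by (simp add: std_normal_density_def)
    finally have "T x = - (\<integral>t. (g (-t) * indicator {..<x} (-t)) * ?d t \<partial>lborel)" using T2 by simp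
    then have "\<bar>x * T x\<bar> = \<bar>(-x) * (\<integral>t. (g (-t) * indicator {..<x} (-t)) * ?d t \<partial>lborel)\<bar>"
      by (simp add: abs_mult)
    also have "\<dots> \<le> ?d (-x)"
      by (rule std_normal_tail_bound) (use False g1 in \<open>auto simp: indicator_def\<close>)
    finally show ?thesis by (simp add: std_normal_density_def)
  qed
  define f where "f x = - T x / ?d x" for x
  \<comment> \<open>Defined so that the Stein equation holds by construction; that it is the
    derivative of \<open>f\<close> is checked by the quotient rule and d' = -x d.\<close>
  define f' where "f' x = g x + x * f x" for x
  have df: "(f has_real_derivative f' x) (at x)" for x
  proof -
    have "((\<lambda>x. - T x / ?d x) has_real_derivative
        (- (- (g x * ?d x)) * ?d x - (- T x) * (- x * ?d x)) / (?d x * ?d x)) (at x)"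
      using dpos[of x] by (intro DERIV_divide DERIV_minus dT DERIV_std_normal_density) auto
    moreover have "(- (- (g x * ?d x)) * ?d x - (- T x) * (- x * ?d x)) / (?d x * ?d x) = f' x"
      using dpos[of x] by (simp add: f'_def f_def field_simps)
    ultimately show ?thesis by (simp add: f_def[abs_def])
  qed
  show thesis
  proof (rule that[of f f'])
    fix x
    show "(f has_real_derivative f' x) (at x)" by (rule df)
    show "isCont f' x"
      unfolding f'_def[abs_def] by (intro continuous_intros gc DERIV_isCont[OF df])
    have "\<bar>x * f x\<bar> \<le> 1"
      using xT[of x] dpos[of x] by (simp add: f_def abs_mult divide_le_eq)
    then show "\<bar>f' x\<bar> \<le> 2" using g1[of x] unfolding f'_def by linarith
    show "f' x - x * f x = h x - (\<integral>y. h y \<partial>gauss1)" by (simp add: f'_def g_def \<mu>_def)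
  qed
qed

text \<open>Dividing X by p and Y by q makes A V = Z. Integration by parts then turns
  E[f'(Z) - Z f(Z)] into E[f'(Z) (1 - Gamma(V,Z))], and Cauchy-Schwarz with \<bar>f'\<bar> \<le> 2
  leaves the second moment estimated in \<open>fourth_moment_bound\<close>.\<close>

lemma chaos_sum_stein_bound:
  fixes h :: "real \<Rightarrow> real"
  assumes h: "continuous_on UNIV h" and h01: "\<And>x. 0 \<le> h x" "\<And>x. h x \<le> 1"
    and X: "chaos n p X" and Y: "chaos n q Y" and p: "0 < p" and q: "0 < q" and par: "odd (p + q)"
  defines "Z \<equiv> \<lambda>x. X x + Y x"
  defines "v \<equiv> (\<integral>x. (Z x)\<^sup>2 \<partial>gauss n)"
  shows "\<bar>(\<integral>x. h (Z x) \<partial>gauss n) - (\<integral>y. h y \<partial>gauss1)\<bar>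
    \<le> 2 * sqrt ((1 - v)\<^sup>2 + 2/3 * ((\<integral>x. (Z x) ^ 4 \<partial>gauss n) - 3 * v\<^sup>2))"
proof -
  let ?E = "\<lambda>F. integral\<^sup>L (gauss n) F"
  obtain f f' where f: "\<And>x. (f has_real_derivative f' x) (at x)" and f'c: "\<And>x. isCont f' x"
    and f'2: "\<And>x. \<bar>f' x\<bar> \<le> 2" and st: "\<And>x. f' x - x * f x = h x - (\<integral>y. h y \<partial>gauss1)"
    using stein_equation[OF h h01] by metis
  have [measurable]: "h \<in> borel_measurable borel" using h by (rule borel_measurable_continuous_onI)
  have [measurable]: "f \<in> borel_measurable borel" "f' \<in> borel_measurable borel"
    using DERIV_isCont[OF f] f'c
    by (auto intro!: borel_measurable_continuous_onI simp: continuous_on_eq_continuous_at)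
  \<comment> \<open>A bounded derivative gives linear growth, so a polynomial times f(Z) is
    dominated by a polynomial and is integrable.\<close>
  have fb: "\<bar>f z\<bar> \<le> \<bar>f 0\<bar> + 2 * \<bar>z\<bar>" for z
  proof -
    have "norm (f z - f 0) \<le> 2 * norm (z - 0)"
      by (rule field_differentiable_bound[where S = UNIV and f' = f']) (use f f'2 in auto)
    then show ?thesis by simp
  qed
  note Xp = chaos_poly[OF X] and Yp = chaos_poly[OF Y]
  have Zp: "poly_fun n Z" unfolding Z_def by (intro poly_intros Xp Yp)
  define V where "V = (\<lambda>x. X x / real p + Y x / real q)"
  have Vp: "poly_fun n V" unfolding V_def by (intro poly_intros Xp Yp)
  note [measurable] = poly_fun_measurable[OF Zp]
  have AV: "opA n V = Z"
  proof -
    have "V = (\<lambda>x. (1 / real p) * X x + (1 / real q) * Y x)" by (simp add: V_def)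
    then show ?thesis
      using p q by (simp add: opA_add[OF poly_cmult[OF Xp] poly_cmult[OF Yp]] opA_cmult Xp Yp
          chaos_opA[OF X] chaos_opA[OF Y] Z_def del: times_divide_eq_left) (simp add: fun_eq_iff)
  qed
  have if1: "integrable (gauss n) (\<lambda>x. F x * f (Z x))" if F: "poly_fun n F" for F
  proof (rule Bochner_Integration.integrable_bound)
    note [measurable] = poly_fun_measurable[OF F]
    show "integrable (gauss n) (\<lambda>x. \<bar>F x\<bar> * \<bar>f 0\<bar> + 2 * \<bar>F x * Z x\<bar>)"
      using F Zp by (intro Bochner_Integration.integrable_add integrable_mult_left integrable_mult_right integrable_abs poly_fun_integrable poly_mult)
    show "AE x in gauss n. norm (F x * f (Z x)) \<le> norm (\<bar>F x\<bar> * \<bar>f 0\<bar> + 2 * \<bar>F x * Z x\<bar>)"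
    proof (rule AE_I2)
      fix x
      have "\<bar>F x\<bar> * \<bar>f (Z x)\<bar> \<le> \<bar>F x\<bar> * (\<bar>f 0\<bar> + 2 * \<bar>Z x\<bar>)" by (intro mult_left_mono fb) auto
      then show "norm (F x * f (Z x)) \<le> norm (\<bar>F x\<bar> * \<bar>f 0\<bar> + 2 * \<bar>F x * Z x\<bar>)"
        by (simp add: abs_mult algebra_simps)
    qed
    show "(\<lambda>x. F x * f (Z x)) \<in> borel_measurable (gauss n)" by measurable
  qed
  have if2: "integrable (gauss n) (\<lambda>x. F x * f' (Z x))" if F: "poly_fun n F" for F
  proof (rule Bochner_Integration.integrable_bound)
    note [measurable] = poly_fun_measurable[OF F]
    show "integrable (gauss n) (\<lambda>x. 2 * \<bar>F x\<bar>)"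
      using F by (intro integrable_mult_right integrable_abs poly_fun_integrable)
    show "AE x in gauss n. norm (F x * f' (Z x)) \<le> norm (2 * \<bar>F x\<bar>)"
      using f'2 by (intro AE_I2) (auto simp: abs_mult mult.commute[of 2] intro!: mult_left_mono)
    show "(\<lambda>x. F x * f' (Z x)) \<in> borel_measurable (gauss n)" by measurable
  qed
  \<comment> \<open>\<open>integral_opA\<close> covers polynomials, whereas f(Z) is not one; its
    argument is repeated in each coordinate with the factor f(Z) in place.\<close>
  have ibp: "?E (\<lambda>x. (x i * pd i V x - pd i (pd i V) x) * f (Z x)) = ?E (\<lambda>x. (pd i V x * pd i Z x) * f' (Z x))"
    if i: "i < n" for i
  proof -
    have "?E (\<lambda>x. x i * (pd i V x * f (Z x))) = ?E (\<lambda>x. pd i (pd i V) x * f (Z x) + (pd i V x * pd i Z x) * f' (Z x))"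
    proof (rule gauss_ibp[OF i])
      fix x
      have "((\<lambda>t. f (Z (x(i := t)))) has_real_derivative f' (Z x) * pd i Z x) (at (x i))"
        using DERIV_chain2[OF _ DERIV_pd[OF Zp], of f "f' (Z x)" x i] f[of "Z x"] by simp
      from DERIV_mult[OF DERIV_pd[OF poly_pd[OF Vp, of i], of x i] this]
      show "((\<lambda>t. pd i V (x(i := t)) * f (Z (x(i := t)))) has_real_derivative
          pd i (pd i V) x * f (Z x) + (pd i V x * pd i Z x) * f' (Z x)) (at (x i))"
        by (simp add: algebra_simps)
    next
      fix x s
      have "isCont (\<lambda>t. f (Z (x(i := t)))) s" "isCont (\<lambda>t. f' (Z (x(i := t)))) s"
        by (rule isCont_o2[OF isCont_poly_section[OF Zp]], use DERIV_isCont[OF f] f'c in blast)+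
      moreover have "isCont (\<lambda>t. pd i (pd i V) (x(i := t))) s" "isCont (\<lambda>t. pd i V (x(i := t))) s"
        "isCont (\<lambda>t. pd i Z (x(i := t))) s"
        by (rule isCont_poly_section[of n], intro poly_pd Vp Zp)+
      ultimately show "isCont (\<lambda>t. pd i (pd i V) (x(i := t)) * f (Z (x(i := t))) + (pd i V (x(i := t)) * pd i Z (x(i := t))) * f' (Z (x(i := t)))) s"
        by (intro isCont_add isCont_mult)
    next
      show "integrable (gauss n) (\<lambda>x. pd i V x * f (Z x))" by (intro if1 poly_pd Vp)
      show "integrable (gauss n) (\<lambda>x. pd i (pd i V) x * f (Z x) + (pd i V x * pd i Z x) * f' (Z x))"
        by (intro Bochner_Integration.integrable_add if1 if2 poly_mult poly_pd Vp Zp)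
      show "integrable (gauss n) (\<lambda>x. x i * (pd i V x * f (Z x)))"
        using if1[OF poly_mult[OF poly_coord[OF i] poly_pd[OF Vp]], of i] by (simp add: mult.assoc)
    qed
    also have "\<dots> = ?E (\<lambda>x. pd i (pd i V) x * f (Z x)) + ?E (\<lambda>x. (pd i V x * pd i Z x) * f' (Z x))"
      by (intro Bochner_Integration.integral_add if1 if2 poly_mult poly_pd Vp Zp)
    finally have "?E (\<lambda>x. (pd i V x * pd i Z x) * f' (Z x)) =
        ?E (\<lambda>x. (x i * pd i V x) * f (Z x)) - ?E (\<lambda>x. pd i (pd i V) x * f (Z x))" by (simp add: mult.assoc)
    also have "\<dots> = ?E (\<lambda>x. (x i * pd i V x) * f (Z x) - pd i (pd i V) x * f (Z x))"
      by (intro Bochner_Integration.integral_diff[symmetric] if1 poly_mult poly_pd Vp poly_coord i)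
    finally show ?thesis by (simp add: left_diff_distrib)
  qed
  have "?E (\<lambda>x. Z x * f (Z x)) = ?E (\<lambda>x. \<Sum>i<n. (x i * pd i V x - pd i (pd i V) x) * f (Z x))"
  proof (intro Bochner_Integration.integral_cong refl)
    fix x
    have "Z x = (\<Sum>i<n. x i * pd i V x - pd i (pd i V) x)"
      using fun_cong[OF AV, of x] by (simp add: opA_def)
    then show "Z x * f (Z x) = (\<Sum>i<n. (x i * pd i V x - pd i (pd i V) x) * f (Z x))"
      by (simp only: sum_distrib_right[symmetric])
  qed
  also have "\<dots> = (\<Sum>i<n. ?E (\<lambda>x. (x i * pd i V x - pd i (pd i V) x) * f (Z x)))"
    by (intro Bochner_Integration.integral_sum if1 poly_intros poly_pd Vp) auto
  also have "\<dots> = (\<Sum>i<n. ?E (\<lambda>x. (pd i V x * pd i Z x) * f' (Z x)))"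
    by (intro sum.cong refl ibp) auto
  also have "\<dots> = ?E (\<lambda>x. \<Sum>i<n. (pd i V x * pd i Z x) * f' (Z x))"
    by (intro Bochner_Integration.integral_sum[symmetric] if2 poly_intros poly_pd Vp Zp)
  also have "\<dots> = ?E (\<lambda>x. Gam n V Z x * f' (Z x))" by (simp add: Gam_def sum_distrib_right)
  finally have ZfZ: "?E (\<lambda>x. Z x * f (Z x)) = ?E (\<lambda>x. Gam n V Z x * f' (Z x))" .
  note Gp = poly_Gam[OF Vp Zp]
  have i0: "integrable (gauss n) (\<lambda>x. f' (Z x))" using if2[OF poly_const[of n 1]] by simp
  have ihZ: "integrable (gauss n) (\<lambda>x. h (Z x))"
    using h01 by (intro gauss.integrable_const_bound[of _ 1]) auto
  have "?E (\<lambda>x. h (Z x)) - (\<integral>y. h y \<partial>gauss1) = ?E (\<lambda>x. h (Z x) - (\<integral>y. h y \<partial>gauss1))"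
    using ihZ by (simp add: gauss.prob_space)
  also have "\<dots> = ?E (\<lambda>x. f' (Z x) - Z x * f (Z x))" by (simp add: st)
  also have "\<dots> = ?E (\<lambda>x. f' (Z x)) - ?E (\<lambda>x. Gam n V Z x * f' (Z x))"
    unfolding ZfZ[symmetric] by (intro Bochner_Integration.integral_diff i0 if1 Zp)
  also have "\<dots> = ?E (\<lambda>x. f' (Z x) - Gam n V Z x * f' (Z x))"
    by (intro Bochner_Integration.integral_diff[symmetric] i0 if2 Gp)
  also have "\<dots> = ?E (\<lambda>x. f' (Z x) * (1 - Gam n V Z x))" by (simp add: algebra_simps)
  finally have eq: "?E (\<lambda>x. h (Z x)) - (\<integral>y. h y \<partial>gauss1) = ?E (\<lambda>x. f' (Z x) * (1 - Gam n V Z x))" .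
  have "(?E (\<lambda>x. f' (Z x) * (1 - Gam n V Z x)))\<^sup>2 \<le> ?E (\<lambda>x. (f' (Z x))\<^sup>2) * ?E (\<lambda>x. (1 - Gam n V Z x)\<^sup>2)"
  proof (rule Cauchy_Schwarz_integral)
    note [measurable] = poly_fun_measurable[OF Gp]
    show "(\<lambda>x. 1 - Gam n V Z x) \<in> borel_measurable (gauss n)" by measurable
    show "integrable (gauss n) (\<lambda>x. (f' (Z x))\<^sup>2)"
      using power_mono[OF f'2, of _ 2] by (intro gauss.integrable_const_bound[of _ 4]) auto
    show "integrable (gauss n) (\<lambda>x. (1 - Gam n V Z x)\<^sup>2)" by (intro poly_fun_integrable poly_intros Gp)
  qed measurable
  also have "\<dots> \<le> 4 * ((1 - v)\<^sup>2 + 2/3 * (?E (\<lambda>x. (Z x) ^ 4) - 3 * v\<^sup>2))"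
  proof (rule mult_mono)
    have i4: "integrable (gauss n) (\<lambda>x. (f' (Z x))\<^sup>2)"
      using power_mono[OF f'2, of _ 2] by (intro gauss.integrable_const_bound[of _ 4]) auto
    show "?E (\<lambda>x. (f' (Z x))\<^sup>2) \<le> 4"
      using power_mono[OF f'2, of _ 2] by (intro gauss.integral_le_const[OF i4]) auto
    show "?E (\<lambda>x. (1 - Gam n V Z x)\<^sup>2) \<le> (1 - v)\<^sup>2 + 2/3 * (?E (\<lambda>x. (Z x) ^ 4) - 3 * v\<^sup>2)"
      unfolding v_def V_def Z_def by (rule fourth_moment_bound[OF X Y p q par])
  qed auto
  finally have "\<bar>?E (\<lambda>x. f' (Z x) * (1 - Gam n V Z x))\<bar> \<le> sqrt (4 * ((1 - v)\<^sup>2 + 2/3 * (?E (\<lambda>x. (Z x) ^ 4) - 3 * v\<^sup>2)))"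
    by (rule real_le_rsqrt[OF order_trans[rotated]]) simp
  then show ?thesis unfolding eq real_sqrt_mult by (simp only: real_sqrt_four)
qed

subsection \<open>Gaussian families\<close>

text \<open>The characteristic function is recorded at 1 only: other arguments t are reached by
  applying the result to t V, which is again Gaussian. The Dirac case is separate because V/s is not
  defined there.\<close>

lemma (in prob_space) centered_normal_moments:
  assumes [measurable]: "V \<in> borel_measurable M" and s: "0 \<le> s" and d: "distr M borel V = centered_normal s"
  shows "integrable M (\<lambda>x. (V x)\<^sup>2)" and "(\<integral>x. (V x)\<^sup>2 \<partial>M) = s\<^sup>2"
    and "(\<integral>x. iexp (V x) \<partial>M) = of_real (exp (- s\<^sup>2 / 2))"
proof -
  have "integrable M (\<lambda>x. (V x)\<^sup>2) \<and> (\<integral>x. (V x)\<^sup>2 \<partial>M) = s\<^sup>2 \<and> (\<integral>x. iexp (V x) \<partial>M) = of_real (exp (- s\<^sup>2 / 2))"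
  proof (cases "s = 0")
    case True
    have "centered_normal s = return borel 0" using True by (simp add: centered_normal_def)
    have "AE x in distr M borel V. x = 0"
      unfolding d \<open>centered_normal s = return borel 0\<close> by (subst AE_return) auto
    then have V0: "AE x in M. V x = 0" by (subst (asm) AE_distr_iff) auto
    have "integrable M (\<lambda>x. (V x)\<^sup>2)"
      by (subst integrable_cong_AE[where g = "\<lambda>x. 0"]) (use V0 in auto)
    moreover have "(\<integral>x. (V x)\<^sup>2 \<partial>M) = (\<integral>x. 0 \<partial>M)"
      by (intro integral_cong_AE) (use V0 in auto)
    moreover have "(\<integral>x. iexp (V x) \<partial>M) = (\<integral>x. 1 \<partial>M)"
      by (intro integral_cong_AE) (use V0 in auto)
    ultimately show ?thesis using True by (simp add: prob_space)
  next
    case False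
    with s have s: "0 < s" by simp
    have "distributed M lborel V (normal_density 0 s)"
      unfolding distributed_def using d s
      by (simp add: centered_normal_def cong: distr_cong)
    then have dU: "distributed M lborel (\<lambda>x. V x / s) std_normal_density"
      using normal_standard_normal_convert[OF s, of V 0] by simp
    define U where "U x = V x / s" for x
    have [measurable]: "U \<in> borel_measurable M" unfolding U_def[abs_def] by measurable
    have lawU: "distr M borel U = std_normal_distribution"
      using dU unfolding distributed_def U_def[abs_def] by (simp cong: distr_cong)
    have V: "V x = s * U x" for x using s by (simp add: U_def)
    have "integrable (distr M borel U) (\<lambda>x. x ^ 2)"
      unfolding lawU by (rule integrable_std_normal_distribution_moment)
    then have iU: "integrable M (\<lambda>x. (U x)\<^sup>2)" by (subst (asm) integrable_distr_eq) auto
    have "(\<integral>x. (U x)\<^sup>2 \<partial>M) = (\<integral>x. x\<^sup>2 \<partial>std_normal_distribution)"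
      unfolding lawU[symmetric] by (subst integral_distr) auto
    also have "\<dots> = 1"
      using std_normal_distribution_even_moments[of 1] by (simp add: has_bochner_integral_iff)
    finally have "(\<integral>x. (V x)\<^sup>2 \<partial>M) = s\<^sup>2" by (simp add: V power_mult_distrib)
    moreover have "integrable M (\<lambda>x. (V x)\<^sup>2)" using iU by (simp add: V power_mult_distrib)
    moreover have "(\<integral>x. iexp (V x) \<partial>M) = char (distr M borel U) s"
      unfolding char_def by (subst integral_distr) (auto simp: V)
    ultimately show ?thesis by (simp add: lawU char_std_normal_distribution)
  qed
  then show "integrable M (\<lambda>x. (V x)\<^sup>2)" and "(\<integral>x. (V x)\<^sup>2 \<partial>M) = s\<^sup>2"
    and "(\<integral>x. iexp (V x) \<partial>M) = of_real (exp (- s\<^sup>2 / 2))" by auto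
qed

text \<open>The process is linear in its index only almost surely, so the linear structure used is
  that of finite combinations of the random variables themselves; these are what the definition of a
  Gaussian family speaks about.\<close>

definition gauss_span :: "('i \<Rightarrow> 'w \<Rightarrow> real) \<Rightarrow> 'i set \<Rightarrow> ('w \<Rightarrow> real) set" where
  "gauss_span W T = {V. \<exists>A c. finite A \<and> A \<subseteq> T \<and> V = (\<lambda>\<omega>. \<Sum>t\<in>A. c t * W t \<omega>)}"

lemma gauss_span_base: "t \<in> T \<Longrightarrow> W t \<in> gauss_span W T"
  unfolding gauss_span_def by (intro CollectI exI[of _ "{t}"] exI[of _ "\<lambda>_. 1"]) auto

lemma gauss_span_zero: "(\<lambda>\<omega>. 0) \<in> gauss_span W T"
  unfolding gauss_span_def by (intro CollectI exI[of _ "{}"]) auto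

lemma gauss_span_cmult: "V \<in> gauss_span W T \<Longrightarrow> (\<lambda>\<omega>. a * V \<omega>) \<in> gauss_span W T"
  unfolding gauss_span_def
proof clarify
  fix A c assume "finite A" "A \<subseteq> T"
  then show "\<exists>B d. finite B \<and> B \<subseteq> T \<and> (\<lambda>\<omega>. a * (\<Sum>t\<in>A. c t * W t \<omega>)) = (\<lambda>\<omega>. \<Sum>t\<in>B. d t * W t \<omega>)"
    by (intro exI[of _ A] exI[of _ "\<lambda>t. a * c t"]) (auto simp: sum_distrib_left mult.assoc)
qed

lemma gauss_span_add:
  assumes "V \<in> gauss_span W T" "V' \<in> gauss_span W T"
  shows "(\<lambda>\<omega>. V \<omega> + V' \<omega>) \<in> gauss_span W T"
proof -
  from assms obtain A c B d where A: "finite A" "A \<subseteq> T" "V = (\<lambda>\<omega>. \<Sum>t\<in>A. c t * W t \<omega>)"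
    and B: "finite B" "B \<subseteq> T" "V' = (\<lambda>\<omega>. \<Sum>t\<in>B. d t * W t \<omega>)"
    unfolding gauss_span_def by blast
  define e where "e t = (if t \<in> A then c t else 0) + (if t \<in> B then d t else 0)" for t
  have "V \<omega> + V' \<omega> = (\<Sum>t\<in>A \<union> B. e t * W t \<omega>)" for \<omega>
  proof -
    have "V \<omega> = (\<Sum>t\<in>A \<union> B. (if t \<in> A then c t else 0) * W t \<omega>)"
      unfolding A(3) using A B by (intro sum.mono_neutral_cong_left) auto
    moreover have "V' \<omega> = (\<Sum>t\<in>A \<union> B. (if t \<in> B then d t else 0) * W t \<omega>)"
      unfolding B(3) using A B by (intro sum.mono_neutral_cong_left) auto
    ultimately show ?thesis by (simp add: e_def distrib_right sum.distrib)
  qed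
  then show ?thesis
    unfolding gauss_span_def using A B by (intro CollectI exI[of _ "A \<union> B"] exI[of _ e]) auto
qed

lemma gauss_span_sum:
  "finite I \<Longrightarrow> (\<And>i. i \<in> I \<Longrightarrow> V i \<in> gauss_span W T) \<Longrightarrow> (\<lambda>\<omega>. \<Sum>i\<in>I. V i \<omega>) \<in> gauss_span W T"
  by (induction I rule: finite_induct) (auto intro: gauss_span_zero gauss_span_add)

lemma (in prob_space)
  assumes g: "centered_gaussian_family M T W" and V: "V \<in> gauss_span W T"
  shows gauss_span_measurable: "V \<in> borel_measurable M"
    and gauss_span_integrable_sq: "integrable M (\<lambda>x. (V x)\<^sup>2)"
    and gauss_span_char: "(\<integral>x. iexp (V x) \<partial>M) = of_real (exp (- (\<integral>x. (V x)\<^sup>2 \<partial>M) / 2))"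
proof -
  from V obtain A c where A: "finite A" "A \<subseteq> T" and Vd: "V = (\<lambda>\<omega>. \<Sum>t\<in>A. c t * W t \<omega>)"
    unfolding gauss_span_def by blast
  show m: "V \<in> borel_measurable M"
    unfolding Vd using g A by (auto simp: centered_gaussian_family_def intro!: borel_measurable_sum borel_measurable_times)
  from g A obtain s where "0 \<le> s" "distr M borel V = centered_normal s"
    unfolding centered_gaussian_family_def Vd by blast
  from centered_normal_moments[OF m this]
  show "integrable M (\<lambda>x. (V x)\<^sup>2)" "(\<integral>x. iexp (V x) \<partial>M) = of_real (exp (- (\<integral>x. (V x)\<^sup>2 \<partial>M) / 2))"
    by auto
qed

text \<open>
  The summand \<open>2\<close> makes \<open>2 + g\<close> a positive density; under the tilted measure \<open>V\<close> still has the
  characteristic function of a standard normal variable.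
\<close>

lemma (in prob_space) std_normal_tilt_real:
  fixes g V :: "'a \<Rightarrow> real"
  assumes [measurable]: "g \<in> borel_measurable M" "V \<in> borel_measurable M" "A \<in> sets borel"
    and g1: "\<And>x. \<bar>g x\<bar> \<le> 1"
    and ch: "\<And>t. (\<integral>x. iexp (t * V x) \<partial>M) = of_real (exp (- t\<^sup>2 / 2))"
    and gch: "\<And>t. (\<integral>x. of_real (g x) * iexp (t * V x) \<partial>M) = of_real (c * exp (- t\<^sup>2 / 2))"
  shows "(\<integral>x. (2 + g x) * indicator A (V x) \<partial>M) = (2 + c) * measure gauss1 A"
proof -
  have ig: "integrable M g" using g1 by (intro integrable_const_bound[of _ 1]) auto
  \<comment> \<open>At t = 0 the hypothesis identifies \<open>c\<close> as the mean of
    \<open>g\<close>, so 2 + c is the total mass of the density 2 + g.\<close>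
  have gc: "(\<integral>x. g x \<partial>M) = c"
    using gch[of 0] by simp
  have "- 1 \<le> c"
    using g1 unfolding gc[symmetric] by (intro integral_ge_const[OF ig]) (auto simp: abs_le_iff minus_le_iff)
  then have c: "2 + c > 0" by simp
  define w where "w x = (2 + g x) / (2 + c)" for x
  have [measurable]: "w \<in> borel_measurable M" unfolding w_def[abs_def] by measurable
  have w0: "0 \<le> w x" for x
    using g1[of x] c by (simp add: w_def abs_le_iff)
  have iw: "integrable M w" unfolding w_def[abs_def] using ig by simp
  have w1: "(\<integral>x. w x \<partial>M) = 1"
    using ig c by (simp add: w_def[abs_def] gc prob_space)
  define Q where "Q = density M (\<lambda>x. ennreal (w x))"
  have "emeasure Q (space Q) = (\<integral>\<^sup>+x. ennreal (w x) \<partial>M)"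
    by (simp add: Q_def emeasure_density nn_integral_set_ennreal cong: nn_integral_cong)
  also have "\<dots> = 1" using iw w0 w1 by (simp add: nn_integral_eq_integral)
  finally interpret Q: prob_space Q by (rule prob_spaceI)
  have [measurable]: "V \<in> borel_measurable Q" by (simp add: Q_def)
  interpret D: real_distribution "distr Q borel V"
    by (rule Q.real_distribution_distr) measurable
  have bi: "integrable M (\<lambda>x. iexp (t * V x))" for t
    by (intro integrable_const_bound[of _ 1]) auto
  have bgi: "integrable M (\<lambda>x. of_real (g x) * iexp (t * V x))" for t
    using g1 by (intro integrable_const_bound[of _ 1]) (auto simp: norm_mult)
  have "char (distr Q borel V) t = char gauss1 t" for t
  proof -
    have "char (distr Q borel V) t = (\<integral>x. iexp (t * V x) \<partial>Q)"
      unfolding char_def by (subst integral_distr) auto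
    also have "\<dots> = (\<integral>x. w x *\<^sub>R iexp (t * V x) \<partial>M)"
      unfolding Q_def by (subst integral_density) (auto simp: w0)
    also have "\<dots> = (\<integral>x. (2 * iexp (t * V x) + of_real (g x) * iexp (t * V x)) / of_real (2 + c) \<partial>M)"
      by (intro Bochner_Integration.integral_cong refl) (simp add: w_def scaleR_conv_of_real algebra_simps add_divide_distrib)
    also have "\<dots> = (2 * (\<integral>x. iexp (t * V x) \<partial>M) + (\<integral>x. of_real (g x) * iexp (t * V x) \<partial>M)) / of_real (2 + c)"
      using bi[of t] bgi[of t] by (subst integral_divide_zero, subst Bochner_Integration.integral_add) auto
    also have "\<dots> = of_real ((2 * exp (- t\<^sup>2 / 2) + c * exp (- t\<^sup>2 / 2)) / (2 + c))"
      unfolding ch gch by simp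
    also have "(2 * exp (- t\<^sup>2 / 2) + c * exp (- t\<^sup>2 / 2)) / (2 + c) = exp (- t\<^sup>2 / 2)"
      using c by (simp add: field_simps)
    finally show ?thesis by (simp add: char_std_normal_distribution)
  qed
  \<comment> \<open>By uniqueness of characteristic functions the tilt does not change the law of V;
    evaluating this law on A gives the claim.\<close>
  then have "distr Q borel V = gauss1"
    by (intro Levy_uniqueness D.real_distribution_axioms real_dist_normal_dist) auto
  then have "measure gauss1 A = measure Q (V -` A \<inter> space Q)"
    by (metis measure_distr \<open>V \<in> borel_measurable Q\<close> assms(3))
  also have "\<dots> = (\<integral>x. indicator A (V x) \<partial>Q)"
    by (subst Bochner_Integration.integral_indicator[symmetric], intro arg_cong2[where f = "integral\<^sup>L"] ext)
       (auto simp: indicator_def intro!: Bochner_Integration.integral_cong)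
  also have "\<dots> = (\<integral>x. w x * indicator A (V x) \<partial>M)"
    unfolding Q_def by (subst integral_density) (auto simp: w0)
  also have "\<dots> = (\<integral>x. (2 + g x) * indicator A (V x) \<partial>M) / (2 + c)"
    by (simp add: w_def flip: integral_divide_zero)
  finally show ?thesis using c by (simp add: field_simps)
qed

text \<open>The summand 2 is removed by subtracting the case g = 0, c = 0.\<close>

lemma (in prob_space) std_normal_tilt:
  fixes g V :: "'a \<Rightarrow> real"
  assumes [measurable]: "g \<in> borel_measurable M" "V \<in> borel_measurable M" "A \<in> sets borel"
    and g1: "\<And>x. \<bar>g x\<bar> \<le> 1"
    and ch: "\<And>t. (\<integral>x. iexp (t * V x) \<partial>M) = of_real (exp (- t\<^sup>2 / 2))"
    and gch: "\<And>t. (\<integral>x. of_real (g x) * iexp (t * V x) \<partial>M) = of_real (c * exp (- t\<^sup>2 / 2))"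
  shows "(\<integral>x. g x * indicator A (V x) \<partial>M) = c * measure gauss1 A"
proof -
  have 1: "(\<integral>x. (2 + g x) * indicator A (V x) \<partial>M) = (2 + c) * measure gauss1 A"
    by (rule std_normal_tilt_real[OF assms])
  have 2: "(\<integral>x. (2 + 0) * indicator A (V x) \<partial>M) = (2 + 0) * measure gauss1 A"
    by (rule std_normal_tilt_real) (use ch in auto)
  have "integrable M (\<lambda>x. 2 * indicator A (V x) :: real)"
    by (intro integrable_const_bound[of _ 2]) (auto simp: indicator_def)
  moreover have "integrable M (\<lambda>x. g x * indicator A (V x) :: real)"
    using g1 by (intro integrable_const_bound[of _ 1]) (auto simp: indicator_def)
  ultimately have "(\<integral>x. (2 + g x) * indicator A (V x) \<partial>M) =
      (\<integral>x. 2 * indicator A (V x) \<partial>M) + (\<integral>x. g x * indicator A (V x) \<partial>M)"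
    unfolding distrib_right by (rule Bochner_Integration.integral_add)
  with 1 2 show ?thesis by (simp add: distrib_right)
qed

text \<open>Real and imaginary parts are treated separately. Conjugating the hypothesis at -t gives
  the same identity for the conjugates of \<open>G\<close> and \<open>c\<close>, since exp(-t^2/2)
  is real and even; half-sums and half-differences then give the hypotheses of the real
  case.\<close>

lemma (in prob_space) std_normal_tilt_complex:
  fixes G :: "'a \<Rightarrow> complex" and V :: "'a \<Rightarrow> real"
  assumes [measurable]: "G \<in> borel_measurable M" "V \<in> borel_measurable M" "A \<in> sets borel"
    and g1: "\<And>x. norm (G x) \<le> 1"
    and ch: "\<And>t. (\<integral>x. iexp (t * V x) \<partial>M) = of_real (exp (- t\<^sup>2 / 2))"
    and gch: "\<And>t. (\<integral>x. G x * iexp (t * V x) \<partial>M) = c * of_real (exp (- t\<^sup>2 / 2))"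
  shows "(\<integral>x. G x * indicator A (V x) \<partial>M) = c * of_real (measure gauss1 A)"
proof -
  have [measurable]: "(\<lambda>x. Re (G x)) \<in> borel_measurable M" "(\<lambda>x. Im (G x)) \<in> borel_measurable M"
    "(\<lambda>x. cnj (G x)) \<in> borel_measurable M"
    using borel_measurable_continuous_on[OF continuous_on_cnj[OF continuous_on_id], of G M]
    by (auto intro: borel_measurable_Re borel_measurable_Im)
  have i1: "integrable M (\<lambda>x. G x * iexp (t * V x))" for t
    using g1 by (intro integrable_const_bound[of _ 1]) (auto simp: norm_mult)
  have i2: "integrable M (\<lambda>x. cnj (G x) * iexp (t * V x))" for t
    using g1 by (intro integrable_const_bound[of _ 1]) (auto simp: norm_mult)
  have cg: "(\<integral>x. cnj (G x) * iexp (t * V x) \<partial>M) = cnj c * of_real (exp (- t\<^sup>2 / 2))" for t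
  proof -
    have "(\<integral>x. cnj (G x) * iexp (t * V x) \<partial>M) = (\<integral>x. cnj (G x * iexp (- t * V x)) \<partial>M)"
      by (simp add: exp_cnj)
    also have "\<dots> = cnj (\<integral>x. G x * iexp (- t * V x) \<partial>M)" by (rule Bochner_Integration.integral_cnj)
    finally show ?thesis unfolding gch by simp
  qed
  have "(\<integral>x. of_real (Re (G x)) * iexp (t * V x) \<partial>M) = of_real (Re c * exp (- t\<^sup>2 / 2))" for t
  proof -
    have "of_real (Re z) = (z + cnj z) / 2" for z by (simp add: complex_add_cnj)
    then have "(\<integral>x. of_real (Re (G x)) * iexp (t * V x) \<partial>M) = (\<integral>x. (G x * iexp (t * V x) + cnj (G x) * iexp (t * V x)) / 2 \<partial>M)"
      by (simp only: distrib_right add_divide_distrib times_divide_eq_left)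
    also have "\<dots> = (c + cnj c) / 2 * of_real (exp (- t\<^sup>2 / 2))"
      using i1[of t] i2[of t]
      by (subst integral_divide_zero, subst Bochner_Integration.integral_add) (auto simp only: gch cg distrib_right times_divide_eq_left)
    finally show ?thesis by (simp add: complex_add_cnj)
  qed
  then have re: "(\<integral>x. Re (G x) * indicator A (V x) \<partial>M) = Re c * measure gauss1 A"
    using g1 order_trans[OF abs_Re_le_cmod g1] by (intro std_normal_tilt ch) auto
  have "(\<integral>x. of_real (Im (G x)) * iexp (t * V x) \<partial>M) = of_real (Im c * exp (- t\<^sup>2 / 2))" for t
  proof -
    have *: "of_real (Im z) = (z - cnj z) / (2 * \<i>)" for z by (simp add: complex_diff_cnj) (simp add: complex_eq_iff)
    then have "(\<integral>x. of_real (Im (G x)) * iexp (t * V x) \<partial>M) = (\<integral>x. (G x * iexp (t * V x) - cnj (G x) * iexp (t * V x)) / (2 * \<i>) \<partial>M)"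
      by (simp only: left_diff_distrib diff_divide_distrib times_divide_eq_left)
    also have "\<dots> = (c - cnj c) / (2 * \<i>) * of_real (exp (- t\<^sup>2 / 2))"
      using i1[of t] i2[of t]
      by (subst integral_divide_zero, subst Bochner_Integration.integral_diff) (auto simp only: gch cg left_diff_distrib diff_divide_distrib times_divide_eq_left)
    finally show ?thesis unfolding *[symmetric] by simp
  qed
  then have im: "(\<integral>x. Im (G x) * indicator A (V x) \<partial>M) = Im c * measure gauss1 A"
    using g1 order_trans[OF abs_Im_le_cmod g1] by (intro std_normal_tilt ch) auto
  have i: "integrable M (\<lambda>x. G x * indicator A (V x))"
    using g1 by (intro integrable_const_bound[of _ 1]) (auto simp: indicator_def)
  have Re: "Re (G x * indicator A (V x)) = Re (G x) * indicator A (V x)" and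
    Im: "Im (G x * indicator A (V x)) = Im (G x) * indicator A (V x)" for x
    by (auto simp: indicator_def)
  show ?thesis
  proof (rule complex_eqI)
    show "Re (\<integral>x. G x * indicator A (V x) \<partial>M) = Re (c * of_real (measure gauss1 A))"
      unfolding integral_Re[OF i, symmetric] Re re by simp
    show "Im (\<integral>x. G x * indicator A (V x) \<partial>M) = Im (c * of_real (measure gauss1 A))"
      unfolding integral_Im[OF i, symmetric] Im im by simp
  qed
qed

text \<open>
  The indicator functions of the events \<open>U\<^sub>i \<in> A\<^sub>i\<close> replace the characters \<open>exp(i t\<^sub>i U\<^sub>i)\<close> one coordinate at
  a time, so that the one-dimensional uniqueness theorem for characteristic functions suffices.
\<close>

lemma (in prob_space) gaussian_law:
  assumes g: "centered_gaussian_family M T W" and U: "\<And>i. i < n \<Longrightarrow> U i \<in> gauss_span W T"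
    and orth: "\<And>i j. i < n \<Longrightarrow> j < n \<Longrightarrow> (\<integral>x. U i x * U j x \<partial>M) = (if i = j then 1 else 0)"
  shows "(\<lambda>x. \<lambda>i\<in>{..<n}. U i x) \<in> measurable M (gauss n)"
    and "distr M (gauss n) (\<lambda>x. \<lambda>i\<in>{..<n}. U i x) = gauss n"
proof -
  have Um[measurable]: "U i \<in> borel_measurable M" if "i < n" for i
    using gauss_span_measurable[OF g U[OF that]] .
  have Usq: "integrable M (\<lambda>x. (U i x)\<^sup>2)" if "i < n" for i
    using gauss_span_integrable_sq[OF g U[OF that]] .
  show m: "(\<lambda>x. \<lambda>i\<in>{..<n}. U i x) \<in> measurable M (gauss n)"
    unfolding measurable_cong_sets[OF refl sets_gauss] by (rule measurable_restrict) auto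
  \<comment> \<open>A combination of the U_i is again in the Gaussian span, and orthonormality makes
    its variance the sum of the squared coefficients.\<close>
  have ch: "(\<integral>x. iexp (\<Sum>i\<in>I. t i * U i x) \<partial>M) = of_real (exp (- (\<Sum>i\<in>I. (t i)\<^sup>2) / 2))"
    if I: "I \<subseteq> {..<n}" for I t
  proof -
    have fI: "finite I" using I finite_subset by blast
    have V: "(\<lambda>x. \<Sum>i\<in>I. t i * U i x) \<in> gauss_span W T"
      using I U fI by (intro gauss_span_sum gauss_span_cmult) auto
    have "(\<integral>x. (\<Sum>i\<in>I. t i * U i x)\<^sup>2 \<partial>M) = (\<integral>x. (\<Sum>i\<in>I. \<Sum>j\<in>I. (t i * t j) * (U i x * U j x)) \<partial>M)"
      by (simp add: power2_eq_square sum_product mult_ac)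
    also have "\<dots> = (\<Sum>i\<in>I. \<Sum>j\<in>I. (t i * t j) * (\<integral>x. U i x * U j x \<partial>M))"
    proof -
      have iU: "integrable M (\<lambda>x. (t i * t j) * (U i x * U j x))" if "i \<in> I" "j \<in> I" for i j
        using that I by (intro integrable_mult_right integrable_mult_L2 Um Usq) auto
      have "(\<integral>x. (\<Sum>i\<in>I. \<Sum>j\<in>I. (t i * t j) * (U i x * U j x)) \<partial>M)
          = (\<Sum>i\<in>I. \<integral>x. (\<Sum>j\<in>I. (t i * t j) * (U i x * U j x)) \<partial>M)"
        by (intro Bochner_Integration.integral_sum Bochner_Integration.integrable_sum iU)
      also have "\<dots> = (\<Sum>i\<in>I. \<Sum>j\<in>I. \<integral>x. (t i * t j) * (U i x * U j x) \<partial>M)"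
        by (intro sum.cong refl Bochner_Integration.integral_sum iU)
      finally show ?thesis by simp
    qed
    also have "\<dots> = (\<Sum>i\<in>I. \<Sum>j\<in>I. if i = j then t i * t j else 0)"
      using I by (intro sum.cong refl) (subst orth, auto)
    also have "\<dots> = (\<Sum>i\<in>I. (t i)\<^sup>2)" using fI by (simp add: power2_eq_square)
    finally show ?thesis using gauss_span_char[OF g V] by simp
  qed
  have U1: "(\<integral>x. iexp (t * U i x) \<partial>M) = of_real (exp (- t\<^sup>2 / 2))" if "i < n" for i t
    using ch[of "{i}" "\<lambda>_. t"] that by simp
  \<comment> \<open>\<open>S\<close> is the set of coordinates whose characters have already been
    replaced by indicators; \<open>S\<close> empty is \<open>ch\<close>, and
    \<open>S = {..<n}\<close> is the product formula for rectangles.\<close>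
  have main: "(\<integral>x. (\<Prod>i\<in>S. indicator (A i) (U i x)) * iexp (\<Sum>i\<in>{..<n} - S. t i * U i x) \<partial>M)
      = (\<Prod>i\<in>S. of_real (measure gauss1 (A i))) * of_real (exp (- (\<Sum>i\<in>{..<n} - S. (t i)\<^sup>2) / 2))"
    if "finite S" "S \<subseteq> {..<n}" and A: "\<And>i. A i \<in> sets borel" for S A t
    using that(1,2)
  proof (induction S arbitrary: t rule: finite_induct)
    case empty
    then show ?case using ch[of "{..<n}" t] by simp
  next
    case (insert j S)
    then have j: "j < n" "j \<notin> S" and S: "S \<subseteq> {..<n}" by auto
    note [measurable] = A
    have Sm[measurable]: "i \<in> S \<Longrightarrow> U i \<in> borel_measurable M" for i using S Um by auto
    define R where "R = {..<n} - insert j S"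
    have R: "{..<n} - S = insert j R" "finite R" "j \<notin> R" using j by (auto simp: R_def)
    have Rm[measurable]: "i \<in> R \<Longrightarrow> U i \<in> borel_measurable M" for i using Um by (auto simp: R_def)
    \<comment> \<open>All factors except that of coordinate j. The induction hypothesis, used with
      \<open>t(j := s)\<close> for every s, is exactly the hypothesis of the tilting lemma; this is
      why \<open>t\<close> is kept arbitrary.\<close>
    define G where "G x = (\<Prod>i\<in>S. indicator (A i) (U i x)) * iexp (\<Sum>i\<in>R. t i * U i x)" for x
    define c where "c = (\<Prod>i\<in>S. of_real (measure gauss1 (A i))) * (of_real (exp (- (\<Sum>i\<in>R. (t i)\<^sup>2) / 2)) :: complex)"
    have "(\<integral>x. G x * indicator (A j) (U j x) \<partial>M) = c * of_real (measure gauss1 (A j))"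
    proof (rule std_normal_tilt_complex)
      show "G \<in> borel_measurable M" unfolding G_def[abs_def] by measurable
      show "norm (G x) \<le> 1" for x
        unfolding G_def norm_mult norm_exp_i_times prod_norm[symmetric]
        by (simp, intro prod_le_1) (auto simp: indicator_def)
      fix s
      have "(\<integral>x. G x * iexp (s * U j x) \<partial>M) =
        (\<integral>x. (\<Prod>i\<in>S. indicator (A i) (U i x)) * iexp (\<Sum>i\<in>{..<n} - S. (t(j := s)) i * U i x) \<partial>M)"
      proof (intro Bochner_Integration.integral_cong refl)
        fix x
        have "(\<Sum>i\<in>R. (t(j := s)) i * U i x) = (\<Sum>i\<in>R. t i * U i x)"
          using R by (intro sum.cong) auto
        then show "G x * iexp (s * U j x) = (\<Prod>i\<in>S. indicator (A i) (U i x)) * iexp (\<Sum>i\<in>{..<n} - S. (t(j := s)) i * U i x)"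
          unfolding G_def R(1) using R by (simp add: exp_add distrib_left mult_ac)
      qed
      also have "\<dots> = (\<Prod>i\<in>S. of_real (measure gauss1 (A i))) * of_real (exp (- (\<Sum>i\<in>{..<n} - S. ((t(j := s)) i)\<^sup>2) / 2))"
        by (rule insert.IH[OF S])
      also have "(\<Sum>i\<in>{..<n} - S. ((t(j := s)) i)\<^sup>2) = s\<^sup>2 + (\<Sum>i\<in>R. ((t(j := s)) i)\<^sup>2)"
        unfolding R(1) using R by simp
      also have "(\<Sum>i\<in>R. ((t(j := s)) i)\<^sup>2) = (\<Sum>i\<in>R. (t i)\<^sup>2)"
        using R by (intro sum.cong) auto
      also have "exp (- (s\<^sup>2 + (\<Sum>i\<in>R. (t i)\<^sup>2)) / 2) = exp (- (\<Sum>i\<in>R. (t i)\<^sup>2) / 2) * exp (- s\<^sup>2 / 2)"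
        by (simp flip: exp_add add: field_simps)
      finally show "(\<integral>x. G x * iexp (s * U j x) \<partial>M) = c * of_real (exp (- s\<^sup>2 / 2))"
        by (simp add: c_def mult.assoc)
    qed (use j A U1 in auto)
    then show ?case
      using insert.hyps by (simp add: G_def c_def R_def[symmetric] mult_ac)
  qed
  show "distr M (gauss n) (\<lambda>x. \<lambda>i\<in>{..<n}. U i x) = gauss n"
    unfolding gauss_def
  proof (rule gauss_pair.PiM_eqI)
    fix A assume A: "\<And>i. i \<in> {..<n} \<Longrightarrow> A i \<in> sets gauss1"
    \<comment> \<open>\<open>main\<close> asks for Borel sets at all indices, so the family is
      padded beyond n.\<close>
    define B where "B i = (if i < n then A i else {})" for i
    have B[measurable]: "B i \<in> sets borel" for i using A by (auto simp: B_def)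
    have PB: "Pi\<^sub>E {..<n} A = Pi\<^sub>E {..<n} B" by (intro PiE_cong) (auto simp: B_def)
    have BS: "Pi\<^sub>E {..<n} B \<in> sets (gauss n)"
      unfolding gauss_def using B by (intro sets_PiM_I_finite) auto
    have "emeasure (distr M (gauss n) (\<lambda>x. \<lambda>i\<in>{..<n}. U i x)) (Pi\<^sub>E {..<n} B)
       = emeasure M {x \<in> space M. \<forall>i<n. U i x \<in> B i}"
    proof -
      have "(\<lambda>x. \<lambda>i\<in>{..<n}. U i x) -` (Pi\<^sub>E {..<n} B) \<inter> space M = {x \<in> space M. \<forall>i<n. U i x \<in> B i}"
        unfolding vimage_def by (simp only: mem_Collect_eq restrict_PiE_iff) auto
      then show ?thesis by (simp only: emeasure_distr[OF m BS])
    qed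
    also have "\<dots> = ennreal (\<Prod>i<n. measure gauss1 (B i))"
    proof -
      have S: "{x \<in> space M. \<forall>i<n. U i x \<in> B i} \<in> sets M"
      proof -
        have "{x \<in> space M. U i x \<in> B i} \<in> sets M" if "i < n" for i
          using Um[OF that] B by measurable
        then have "{x \<in> space M. \<forall>i\<in>{..<n}. U i x \<in> B i} \<in> sets M" by (intro sets.sets_Collect_finite_All) auto
        then show ?thesis by (simp add: Ball_def)
      qed
      have "of_real (measure M {x \<in> space M. \<forall>i<n. U i x \<in> B i}) = (\<integral>x. of_real (indicator {x \<in> space M. \<forall>i<n. U i x \<in> B i} x) \<partial>M :: complex)"
        using S by (simp add: Int_absorb2 sets.sets_into_space)
      also have "\<dots> = (\<integral>x. (\<Prod>i<n. indicator (B i) (U i x)) * iexp (\<Sum>i\<in>{..<n} - {..<n}. 0 * U i x) \<partial>M)"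
      proof (intro Bochner_Integration.integral_cong refl)
        fix x assume x: "x \<in> space M"
        have "(\<Prod>i<n. indicator (B i) (U i x) :: complex) = (if \<forall>i<n. U i x \<in> B i then 1 else 0)"
        proof (cases "\<forall>i<n. U i x \<in> B i")
          case False
          then obtain i where "i < n" "U i x \<notin> B i" by blast
          then show ?thesis using False by (simp, intro bexI[of _ i]) auto
        qed simp
        then show "of_real (indicator {x \<in> space M. \<forall>i<n. U i x \<in> B i} x) =
            (\<Prod>i<n. indicator (B i) (U i x)) * iexp (\<Sum>i\<in>{..<n} - {..<n}. 0 * U i x)"
          using x by (simp add: indicator_def)
      qed
      also have "\<dots> = (\<Prod>i<n. of_real (measure gauss1 (B i)))"
        using main[of "{..<n}" B "\<lambda>_. 0"] B by simp
      finally have "measure M {x \<in> space M. \<forall>i<n. U i x \<in> B i} = (\<Prod>i<n. measure gauss1 (B i))"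
        by (simp flip: of_real_prod)
      then show ?thesis by (simp add: emeasure_eq_measure)
    qed
    also have "\<dots> = (\<Prod>i<n. emeasure gauss1 (B i))"
      by (simp add: gauss1.emeasure_eq_measure prod_ennreal)
    also have "\<dots> = (\<Prod>i<n. emeasure gauss1 (A i))" by (intro prod.cong) (auto simp: B_def)
    finally show "emeasure (distr M (Pi\<^sub>M {..<n} (\<lambda>_. gauss1)) (\<lambda>x. \<lambda>i\<in>{..<n}. U i x)) (Pi\<^sub>E {..<n} A) =
        (\<Prod>i<n. emeasure gauss1 (A i))"
      unfolding PB gauss_def .
  qed auto
qed

text \<open>The orthogonalization is carried out on the random variables in L2(P), not on their
  indices, so that the U_i stay literally in the Gaussian span. The V_k are recovered almost surely,
  because a residual of variance 0 is discarded.\<close>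

lemma (in prob_space) gram_schmidt:
  fixes N :: nat
  assumes g: "centered_gaussian_family M T W"
    and V: "\<And>k. k < N \<Longrightarrow> V k \<in> gauss_span W T"
  shows "\<exists>(n::nat) U a. (\<forall>i<n. U i \<in> gauss_span W T)
    \<and> (\<forall>i<n. \<forall>j<n. (\<integral>x. U i x * U j x \<partial>M) = (if i = j then 1 else 0))
    \<and> (\<forall>k<N. AE x in M. V k x = (\<Sum>i<n. a k i * U i x))"
  using V
proof (induction N)
  case 0
  show ?case by (intro exI[of _ 0]) auto
next
  case (Suc N)
  have "\<exists>(n::nat) U a. (\<forall>i<n. U i \<in> gauss_span W T)
    \<and> (\<forall>i<n. \<forall>j<n. (\<integral>x. U i x * U j x \<partial>M) = (if i = j then 1 else 0))
    \<and> (\<forall>k<N. AE x in M. V k x = (\<Sum>i<n. a k i * U i x))"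
    by (rule Suc.IH) (simp add: Suc.prems)
  then obtain n :: nat and U a where IH: "\<forall>i<n. U i \<in> gauss_span W T"
    "\<forall>i<n. \<forall>j<n. (\<integral>x. U i x * U j x \<partial>M) = (if i = j then 1 else 0)"
    "\<forall>k<N. AE x in M. V k x = (\<Sum>i<n. a k i * U i x)" by blast
  note U = IH(1)[rule_format] and orth = IH(2)[rule_format] and a = IH(3)[rule_format]
  have mm: "V' \<in> borel_measurable M" if "V' \<in> gauss_span W T" for V' using gauss_span_measurable[OF g that] .
  have ii: "integrable M (\<lambda>x. V1 x * V2 x)" if "V1 \<in> gauss_span W T" "V2 \<in> gauss_span W T" for V1 V2
    using that by (intro integrable_mult_L2 mm gauss_span_integrable_sq[OF g])
  define b where "b i = (\<integral>x. V N x * U i x \<partial>M)" for i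
  \<comment> \<open>The residual of \<open>V N\<close> after projection onto the variables found so
    far.\<close>
  define r where "r = (\<lambda>x. V N x + (\<Sum>i<n. (- b i) * U i x))"
  have VN: "V N \<in> gauss_span W T" using Suc.prems by simp
  have r: "r \<in> gauss_span W T"
    unfolding r_def by (intro gauss_span_add gauss_span_sum gauss_span_cmult VN U) auto
  have rU: "(\<integral>x. r x * U j x \<partial>M) = 0" if j: "j < n" for j
  proof -
    have "(\<integral>x. r x * U j x \<partial>M) = (\<integral>x. V N x * U j x + (\<Sum>i<n. (- b i) * (U i x * U j x)) \<partial>M)"
      by (simp add: r_def distrib_right sum_distrib_right mult.assoc)
    also have "\<dots> = b j + (\<Sum>i<n. (- b i) * (\<integral>x. U i x * U j x \<partial>M))"
    proof -
      have i: "integrable M (\<lambda>x. (- b i) * (U i x * U j x))" if "i < n" for i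
        using that j by (intro integrable_mult_right ii U)
      have "(\<integral>x. V N x * U j x + (\<Sum>i<n. (- b i) * (U i x * U j x)) \<partial>M)
          = b j + (\<integral>x. (\<Sum>i<n. (- b i) * (U i x * U j x)) \<partial>M)"
        unfolding b_def[of j]
        by (intro Bochner_Integration.integral_add Bochner_Integration.integrable_sum ii VN U j i) auto
      also have "(\<integral>x. (\<Sum>i<n. (- b i) * (U i x * U j x)) \<partial>M) = (\<Sum>i<n. \<integral>x. (- b i) * (U i x * U j x) \<partial>M)"
        by (intro Bochner_Integration.integral_sum i) auto
      finally show ?thesis by simp
    qed
    also have "\<dots> = b j + (\<Sum>i<n. if i = j then - b i else 0)"
      using j by (intro arg_cong2[where f = "(+)"] sum.cong refl) (subst orth, auto)
    also have "\<dots> = 0" using j by simp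
    finally show ?thesis .
  qed
  define s where "s = (\<integral>x. (r x)\<^sup>2 \<partial>M)"
  have s0: "0 \<le> s" unfolding s_def by simp
  show ?case
  proof (cases "s = 0")
    \<comment> \<open>The residual vanishes almost surely, so no new variable is added.\<close>
    case True
    then have "AE x in M. (r x)\<^sup>2 = 0"
      using integral_nonneg_eq_0_iff_AE[OF gauss_span_integrable_sq[OF g r]] by (simp add: s_def)
    then have aN: "AE x in M. V N x = (\<Sum>i<n. b i * U i x)"
      by eventually_elim (simp add: r_def sum_negf)
    show ?thesis
      using U orth a aN by (intro exI[of _ n] exI[of _ U] exI[of _ "a(N := b)"]) (auto simp: less_Suc_eq)
  next
    case False
    with s0 have s: "s > 0" by simp
    define U' where "U' = U(n := (\<lambda>x. (1 / sqrt s) * r x))"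
    define a' where "a' k i = (if k = N then (if i = n then sqrt s else b i) else (if i = n then 0 else a k i))" for k i
    have U'1: "U' i \<in> gauss_span W T" if "i < Suc n" for i
      using that U r by (auto simp: U'_def less_Suc_eq intro!: gauss_span_cmult[of _ _ _ "1 / sqrt s", simplified])
    have "(\<integral>x. U' i x * U' j x \<partial>M) = (if i = j then 1 else 0)" if "i < Suc n" "j < Suc n" for i j
    proof -
      consider "i < n" "j < n" | "i = n" "j < n" | "i < n" "j = n" | "i = n" "j = n" using \<open>i < Suc n\<close> \<open>j < Suc n\<close> by linarith
      then show ?thesis
      proof cases
        case 1 then show ?thesis by (simp add: U'_def orth)
      next
        case 2 then show ?thesis using rU[of j] by (simp add: U'_def)
      next
        case 3 then show ?thesis using rU[of i] by (simp add: U'_def mult.commute)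
      next
        case 4
        have "(\<integral>x. U' n x * U' n x \<partial>M) = (\<integral>x. (r x)\<^sup>2 / s \<partial>M)"
          using s by (intro Bochner_Integration.integral_cong refl) (simp add: U'_def power2_eq_square)
        also have "\<dots> = 1" using s by (simp add: s_def)
        finally show ?thesis using 4 by simp
      qed
    qed
    moreover have "AE x in M. V k x = (\<Sum>i<Suc n. a' k i * U' i x)" if "k < Suc N" for k
    proof (cases "k = N")
      case True
      have "V N x = (\<Sum>i<Suc n. a' N i * U' i x)" for x
      proof -
        have "(\<Sum>i<n. a' N i * U' i x) = (\<Sum>i<n. b i * U i x)"
          by (intro sum.cong) (auto simp: a'_def U'_def)
        moreover have "a' N n * U' n x = r x" using s by (simp add: a'_def U'_def)
        ultimately show ?thesis by (simp add: r_def sum_negf)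
      qed
      then show ?thesis using True by simp
    next
      case False
      with that have "k < N" by simp
      have "(\<Sum>i<Suc n. a' k i * U' i x) = (\<Sum>i<n. a k i * U i x)" for x
        using False by (simp add: a'_def) (intro sum.cong, auto simp: U'_def)
      then show ?thesis using a[OF \<open>k < N\<close>] by simp
    qed
    ultimately show ?thesis using U'1 by (intro exI[of _ "Suc n"] exI[of _ U'] exI[of _ a']) blast
  qed
qed

subsection \<open>Density of the tensor powers\<close>

lemma L2_measurable: "f \<in> L2 M \<Longrightarrow> f \<in> borel_measurable M"
  and L2_integrable: "f \<in> L2 M \<Longrightarrow> integrable M (\<lambda>x. (f x)\<^sup>2)"
  by (auto simp: L2_def)

lemma L2_dominated:
  assumes "f \<in> borel_measurable M" "integrable M (\<lambda>x. (w x)\<^sup>2)" "\<And>x. x \<in> space M \<Longrightarrow> \<bar>f x\<bar> \<le> w x"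
  shows "f \<in> L2 M"
  unfolding L2_def
proof (intro CollectI conjI)
  show "integrable M (\<lambda>x. (f x)\<^sup>2)"
  proof (rule Bochner_Integration.integrable_bound[OF assms(2)])
    show "(\<lambda>x. (f x)\<^sup>2) \<in> borel_measurable M" using assms(1) by measurable
    show "AE x in M. norm ((f x)\<^sup>2) \<le> norm ((w x)\<^sup>2)"
    proof (rule AE_I2)
      fix x assume "x \<in> space M"
      then have "\<bar>f x\<bar> \<le> \<bar>w x\<bar>" using assms(3) by fastforce
      then show "norm ((f x)\<^sup>2) \<le> norm ((w x)\<^sup>2)" using power_mono[of "\<bar>f x\<bar>" "\<bar>w x\<bar>" 2] by simp
    qed
  qed
qed (rule assms(1))

lemma L2_cmult: "f \<in> L2 M \<Longrightarrow> (\<lambda>x. c * f x) \<in> L2 M"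
  by (auto simp: L2_def power_mult_distrib)

lemma L2_zero: "(\<lambda>x. 0) \<in> L2 M"
  by (auto simp: L2_def)

lemma L2_add:
  assumes f: "f \<in> L2 M" and g: "g \<in> L2 M"
  shows "(\<lambda>x. f x + g x) \<in> L2 M"
proof -
  note [measurable] = L2_measurable[OF f] L2_measurable[OF g]
  have "integrable M (\<lambda>x. (f x)\<^sup>2 + 2 * (f x * g x) + (g x)\<^sup>2)"
    by (intro Bochner_Integration.integrable_add integrable_mult_right integrable_mult_L2 L2_integrable f g) measurable
  then have "integrable M (\<lambda>x. (f x + g x)\<^sup>2)" by (simp add: power2_eq_square algebra_simps)
  then show ?thesis by (auto simp: L2_def)
qed

lemma L2_diff: "f \<in> L2 M \<Longrightarrow> g \<in> L2 M \<Longrightarrow> (\<lambda>x. f x - g x) \<in> L2 M"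
  using L2_add[OF _ L2_cmult[of g M "-1"], of f] by simp

lemma L2_sum: "(\<And>i. i \<in> I \<Longrightarrow> f i \<in> L2 M) \<Longrightarrow> (\<lambda>x. \<Sum>i\<in>I. f i x) \<in> L2 M"
  by (induction I rule: infinite_finite_induct) (auto intro: L2_zero L2_add)

lemma L2_triangle_sq:
  assumes f: "f \<in> L2 M" and g: "g \<in> L2 M"
  shows "(\<integral>x. (f x + g x)\<^sup>2 \<partial>M) \<le> 2 * (\<integral>x. (f x)\<^sup>2 \<partial>M) + 2 * (\<integral>x. (g x)\<^sup>2 \<partial>M)"
proof -
  have "(\<integral>x. (f x + g x)\<^sup>2 \<partial>M) \<le> (\<integral>x. 2 * (f x)\<^sup>2 + 2 * (g x)\<^sup>2 \<partial>M)"
  proof (rule integral_mono)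
    show "integrable M (\<lambda>x. (f x + g x)\<^sup>2)" by (rule L2_integrable[OF L2_add[OF f g]])
    show "integrable M (\<lambda>x. 2 * (f x)\<^sup>2 + 2 * (g x)\<^sup>2)"
      using L2_integrable[OF f] L2_integrable[OF g] by simp
    fix x
    have "0 \<le> (f x - g x)\<^sup>2" by simp
    then show "(f x + g x)\<^sup>2 \<le> 2 * (f x)\<^sup>2 + 2 * (g x)\<^sup>2" by (simp add: power2_eq_square algebra_simps)
  qed
  also have "\<dots> = 2 * (\<integral>x. (f x)\<^sup>2 \<partial>M) + 2 * (\<integral>x. (g x)\<^sup>2 \<partial>M)"
    using L2_integrable[OF f] L2_integrable[OF g] by simp
  finally show ?thesis .
qed

section \<open>Closure of a subspace of L2\<close>

definition approx_by :: "'a measure \<Rightarrow> ('a \<Rightarrow> real) set \<Rightarrow> ('a \<Rightarrow> real) \<Rightarrow> bool" where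
  "approx_by M R f \<longleftrightarrow> f \<in> L2 M \<and> (\<forall>e>0. \<exists>g\<in>R. (\<integral>x. (f x - g x)\<^sup>2 \<partial>M) < e)"

locale L2_subspace =
  fixes M :: "'a measure" and R :: "('a \<Rightarrow> real) set"
  assumes R_L2: "g \<in> R \<Longrightarrow> g \<in> L2 M"
    and R_zero: "(\<lambda>x. 0) \<in> R"
    and R_add: "g \<in> R \<Longrightarrow> h \<in> R \<Longrightarrow> (\<lambda>x. g x + h x) \<in> R"
    and R_cmult: "g \<in> R \<Longrightarrow> (\<lambda>x. c * g x) \<in> R"
begin

text \<open>Members of \<open>R\<close> are functions on the whole type, whereas approximation only
  sees their values on \<open>space M\<close>; this bridges the two, for instance for indicators of
  sets of extensional functions.\<close>

lemma approx_cong: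
  assumes "f \<in> R" "f' \<in> L2 M" "\<And>x. x \<in> space M \<Longrightarrow> f' x = f x"
  shows "approx_by M R f'"
  unfolding approx_by_def
proof (intro conjI allI impI bexI)
  fix e :: real assume "0 < e"
  moreover have "(\<integral>x. (f' x - f x)\<^sup>2 \<partial>M) = (\<integral>x. 0 \<partial>M)"
    using assms(3) by (intro Bochner_Integration.integral_cong) auto
  ultimately show "(\<integral>x. (f' x - f x)\<^sup>2 \<partial>M) < e" by simp
qed (use assms in auto)

lemma approx_add:
  assumes f: "approx_by M R f" and f': "approx_by M R f'"
  shows "approx_by M R (\<lambda>x. f x + f' x)"
  unfolding approx_by_def
proof (intro conjI allI impI)
  have L: "f \<in> L2 M" "f' \<in> L2 M" using f f' by (auto simp: approx_by_def)
  then show "(\<lambda>x. f x + f' x) \<in> L2 M" by (rule L2_add)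
  fix e :: real assume "0 < e"
  then have e4: "0 < e / 4" by simp
  obtain g where g: "g \<in> R" "(\<integral>x. (f x - g x)\<^sup>2 \<partial>M) < e / 4" using f e4 unfolding approx_by_def by blast
  obtain g' where g': "g' \<in> R" "(\<integral>x. (f' x - g' x)\<^sup>2 \<partial>M) < e / 4" using f' e4 unfolding approx_by_def by blast
  have "(\<integral>x. ((f x - g x) + (f' x - g' x))\<^sup>2 \<partial>M) \<le> 2 * (\<integral>x. (f x - g x)\<^sup>2 \<partial>M) + 2 * (\<integral>x. (f' x - g' x)\<^sup>2 \<partial>M)"
    by (intro L2_triangle_sq L2_diff L R_L2 g g')
  with g g' have "(\<integral>x. (f x + f' x - (g x + g' x))\<^sup>2 \<partial>M) < e" by (simp add: algebra_simps)
  then show "\<exists>g\<in>R. (\<integral>x. (f x + f' x - g x)\<^sup>2 \<partial>M) < e"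
    using R_add[OF g(1) g'(1)] by (intro bexI[of _ "\<lambda>x. g x + g' x"])
qed

lemma approx_cmult:
  assumes f: "approx_by M R f"
  shows "approx_by M R (\<lambda>x. c * f x)"
proof (cases "c = 0")
  case True
  then show ?thesis using approx_cong[OF R_zero L2_zero] by simp
next
  case c: False
  show ?thesis
    unfolding approx_by_def
  proof (intro conjI allI impI)
    show "(\<lambda>x. c * f x) \<in> L2 M" using f by (auto simp: approx_by_def intro: L2_cmult)
    fix e :: real assume e: "0 < e"
    have "e / c\<^sup>2 > 0" using c e by simp
    then obtain g where g: "g \<in> R" "(\<integral>x. (f x - g x)\<^sup>2 \<partial>M) < e / c\<^sup>2" using f unfolding approx_by_def by blast
    have "(\<integral>x. (c * f x - c * g x)\<^sup>2 \<partial>M) = c\<^sup>2 * (\<integral>x. (f x - g x)\<^sup>2 \<partial>M)"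
      unfolding right_diff_distrib[symmetric] power_mult_distrib by simp
    also have "\<dots> < e" using g(2) c by (simp add: field_simps)
    finally show "\<exists>g\<in>R. (\<integral>x. (c * f x - g x)\<^sup>2 \<partial>M) < e"
      using R_cmult[OF g(1)] by (intro bexI[of _ "\<lambda>x. c * g x"])
  qed
qed

lemma approx_zero: "approx_by M R (\<lambda>x. 0)"
  by (rule approx_cong[OF R_zero L2_zero]) simp

lemma approx_sum: "finite I \<Longrightarrow> (\<And>i. i \<in> I \<Longrightarrow> approx_by M R (f i)) \<Longrightarrow> approx_by M R (\<lambda>x. \<Sum>i\<in>I. f i x)"
  by (induction I rule: finite_induct) (auto intro: approx_zero approx_add)

lemma approx_diff: "approx_by M R f \<Longrightarrow> approx_by M R g \<Longrightarrow> approx_by M R (\<lambda>x. f x - g x)"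
  using approx_add[OF _ approx_cmult[of g "-1"], of f] by simp

text \<open>A square-integrable majorant \<open>w\<close> bounds the limit too, so the squared
  difference is at most 4 w^2, and dominated convergence turns pointwise convergence into L2
  convergence.\<close>

lemma approx_limit:
  assumes f: "\<And>n. approx_by M R (f n)" and F: "F \<in> borel_measurable M"
    and lim: "\<And>x. x \<in> space M \<Longrightarrow> (\<lambda>n. f n x) \<longlonglongrightarrow> F x"
    and w: "integrable M (\<lambda>x. (w x)\<^sup>2)" "\<And>n x. x \<in> space M \<Longrightarrow> \<bar>f n x\<bar> \<le> w x"
  shows "approx_by M R F"
proof -
  have fL: "f n \<in> L2 M" for n using f by (simp add: approx_by_def)
  have Fw: "\<bar>F x\<bar> \<le> w x" if "x \<in> space M" for x
    using tendsto_rabs[OF lim[OF that]] w(2)[OF that] by (intro LIMSEQ_le_const2) auto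
  have FL: "F \<in> L2 M" by (rule L2_dominated[OF F w(1) Fw])
  note [measurable] = F L2_measurable[OF fL]
  have conv: "(\<lambda>n. \<integral>x. (F x - f n x)\<^sup>2 \<partial>M) \<longlonglongrightarrow> (\<integral>x. 0 \<partial>M)"
  proof (rule integral_dominated_convergence[where w = "\<lambda>x. 4 * (w x)\<^sup>2"])
    show "AE x in M. (\<lambda>n. (F x - f n x)\<^sup>2) \<longlonglongrightarrow> 0"
    proof (rule AE_I2)
      fix x assume "x \<in> space M"
      from tendsto_power[OF tendsto_diff[OF tendsto_const[of "F x"] lim[OF this]], of 2]
      show "(\<lambda>n. (F x - f n x)\<^sup>2) \<longlonglongrightarrow> 0" by simp
    qed
    show "AE x in M. norm ((F x - f n x)\<^sup>2) \<le> 4 * (w x)\<^sup>2" for n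
    proof (rule AE_I2)
      fix x assume "x \<in> space M"
      then have "\<bar>F x - f n x\<bar> \<le> 2 * w x" using Fw[of x] w(2)[of x n] by (auto simp: abs_le_iff)
      then have "\<bar>F x - f n x\<bar>\<^sup>2 \<le> (2 * w x)\<^sup>2" by (rule power_mono) simp
      then show "norm ((F x - f n x)\<^sup>2) \<le> 4 * (w x)\<^sup>2" by (simp add: power_mult_distrib)
    qed
  qed (use w(1) in auto)
  show ?thesis
    unfolding approx_by_def
  proof (intro conjI allI impI FL)
    fix e :: real assume e: "0 < e"
    have "\<forall>\<^sub>F n in sequentially. (\<integral>x. (F x - f n x)\<^sup>2 \<partial>M) < e / 4"
      using conv e by (intro order_tendstoD) auto
    then obtain n where n: "(\<integral>x. (F x - f n x)\<^sup>2 \<partial>M) < e / 4" by (auto dest: eventually_happens)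
    have "0 < e / 4" using e by simp
    then obtain g where g: "g \<in> R" "(\<integral>x. (f n x - g x)\<^sup>2 \<partial>M) < e / 4"
      using f[of n] unfolding approx_by_def by blast
    have "(\<integral>x. ((F x - f n x) + (f n x - g x))\<^sup>2 \<partial>M) \<le> 2 * (\<integral>x. (F x - f n x)\<^sup>2 \<partial>M) + 2 * (\<integral>x. (f n x - g x)\<^sup>2 \<partial>M)"
      by (intro L2_triangle_sq L2_diff FL fL R_L2 g)
    with n g show "\<exists>g\<in>R. (\<integral>x. (F x - g x)\<^sup>2 \<partial>M) < e" by (intro bexI[of _ g]) auto
  qed
qed

end

section \<open>Density of linear combinations of rectangles\<close>

inductive rect_span :: "nat \<Rightarrow> 'a measure \<Rightarrow> ((nat \<Rightarrow> 'a) \<Rightarrow> real) \<Rightarrow> bool" for m M where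
  rect_zero: "rect_span m M (\<lambda>x. 0)"
| rect_step: "rect_span m M F \<Longrightarrow> (\<And>i. i < m \<Longrightarrow> A i \<in> sets M \<and> emeasure M (A i) < \<infinity>) \<Longrightarrow>
    rect_span m M (\<lambda>x. F x + c * (\<Prod>i<m. indicator (A i) (x i)))"

lemma indicator_L2: "A \<in> sets M \<Longrightarrow> emeasure M A < \<infinity> \<Longrightarrow> indicator A \<in> L2 M"
proof -
  assume A: "A \<in> sets M" "emeasure M A < \<infinity>"
  have "(\<lambda>x. (indicator A x :: real)\<^sup>2) = indicator A" by (auto simp: indicator_def)
  then show ?thesis using A by (auto simp: L2_def)
qed

lemma product_L2:
  assumes M: "sigma_finite_measure M" and h: "\<And>i. i < m \<Longrightarrow> h i \<in> L2 M"
  shows "(\<lambda>x. \<Prod>i<m. h i (x i)) \<in> L2 (power_measure m M)"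
proof -
  interpret sigma_finite_measure M by fact
  interpret product_sigma_finite "\<lambda>_::nat. M" by unfold_locales
  have [measurable]: "i < m \<Longrightarrow> h i \<in> borel_measurable M" for i using h L2_measurable by blast
  have "integrable (power_measure m M) (\<lambda>x. \<Prod>i<m. (h i (x i))\<^sup>2)"
    unfolding power_measure_def by (intro product_integrable_prod L2_integrable h) auto
  moreover have "(\<lambda>x. \<Prod>i<m. h i (x i)) \<in> borel_measurable (power_measure m M)"
    unfolding power_measure_def
    by (intro borel_measurable_prod measurable_compose[OF measurable_component_singleton]) auto
  ultimately show ?thesis by (simp add: L2_def prod_power_distrib)
qed

lemma rect_span_L2:
  assumes M: "sigma_finite_measure M"
  shows "rect_span m M F \<Longrightarrow> F \<in> L2 (power_measure m M)"
proof (induction rule: rect_span.induct)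
  case (rect_step F A c)
  then show ?case by (intro L2_add L2_cmult product_L2 M indicator_L2) auto
qed (rule L2_zero)

lemma rect_span_add: "rect_span m M G \<Longrightarrow> rect_span m M F \<Longrightarrow> rect_span m M (\<lambda>x. F x + G x)"
proof (induction rule: rect_span.induct)
  case (rect_step G A c)
  have "rect_span m M (\<lambda>x. (F x + G x) + c * (\<Prod>i<m. indicator (A i) (x i)))"
    by (rule rect_span.rect_step) (use rect_step in auto)
  then show ?case by (simp add: algebra_simps)
qed simp

lemma rect_span_cmult: "rect_span m M F \<Longrightarrow> rect_span m M (\<lambda>x. d * F x)"
proof (induction rule: rect_span.induct)
  case (rect_step F A c)
  have "rect_span m M (\<lambda>x. d * F x + (d * c) * (\<Prod>i<m. indicator (A i) (x i)))"
    by (rule rect_span.rect_step) (use rect_step in auto)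
  then show ?case by (simp add: distrib_left mult.assoc)
qed (simp add: rect_zero)

text \<open>The total measure may be infinite, so the Dynkin argument from rectangles to all
  measurable sets is run inside the boxes \<open>C k\<close>, which have finite measure and exhaust
  the space. Simple functions cut off to these boxes then approximate f.\<close>

lemma rect_span_dense:
  assumes M: "sigma_finite_measure M" and f: "f \<in> L2 (power_measure m M)"
  shows "approx_by (power_measure m M) {F. rect_span m M F} f"
proof -
  let ?N = "power_measure m M"
  interpret sigma_finite_measure M by fact
  interpret product_sigma_finite "\<lambda>_::nat. M" by unfold_locales
  interpret L2_subspace ?N "{F. rect_span m M F}"
    by unfold_locales (auto intro: rect_span_L2[OF M] rect_zero rect_span_add rect_span_cmult)
  obtain E :: "nat \<Rightarrow> 'a set" where E: "range E \<subseteq> sets M" "(\<Union>i. E i) = space M"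
    "\<And>i. emeasure M (E i) \<noteq> \<infinity>" "incseq E" using sigma_finite_incseq by blast
  define C where "C k = ({..<m} \<rightarrow>\<^sub>E E k)" for k
  have Es: "E k \<in> sets M" for k using E(1) by auto
  have Ef: "emeasure M (E k) < \<infinity>" for k using E(3) by (simp add: less_top)
  have Cs[measurable]: "C k \<in> sets ?N" for k
    unfolding C_def power_measure_def by (intro sets_PiM_I_finite Es) auto
  have Cf: "emeasure ?N (C k) < \<infinity>" for k
    unfolding C_def power_measure_def using Es Ef
    by (subst emeasure_PiM) (auto simp: ennreal_prod_eq_top less_top power_less_top_ennreal)
  have IL: "indicator (A \<inter> C k) \<in> L2 ?N" if "A \<in> sets ?N" for A k
    using that Cf[of k] emeasure_mono[of "A \<inter> C k" "C k" ?N] by (intro indicator_L2) (auto intro: le_less_trans)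
  have spN: "space ?N = (\<Pi>\<^sub>E i\<in>{..<m}. space M)" by (simp add: power_measure_def space_PiM)
  \<comment> \<open>Cutting a rectangle with the box \<open>C k\<close> intersects each side with
    \<open>E k\<close>, which gives a rectangle with sides of finite measure.\<close>
  have rect: "approx_by ?N {F. rect_span m M F} (indicator (Pi\<^sub>E {..<m} A \<inter> C k))"
    if A: "\<And>i. i < m \<Longrightarrow> A i \<in> sets M" for A k
  proof (rule approx_cong)
    have "emeasure M (A i \<inter> E k) < \<infinity>" if "i < m" for i
      using Ef[of k] emeasure_mono[of "A i \<inter> E k" "E k" M] Es by (auto intro: le_less_trans)
    then have "rect_span m M (\<lambda>x. 0 + 1 * (\<Prod>i<m. indicator (A i \<inter> E k) (x i)))"
      using A Es by (intro rect_step rect_zero) auto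
    then show "(\<lambda>x. \<Prod>i<m. indicator (A i \<inter> E k) (x i)) \<in> {F. rect_span m M F}" by simp
    have "Pi\<^sub>E {..<m} A \<in> sets ?N"
      unfolding power_measure_def using A by (intro sets_PiM_I_finite) auto
    then show "indicator (Pi\<^sub>E {..<m} A \<inter> C k) \<in> L2 ?N" by (rule IL)
    fix x assume x: "x \<in> space ?N"
    show "(indicator (Pi\<^sub>E {..<m} A \<inter> C k) x :: real) = (\<Prod>i<m. indicator (A i \<inter> E k) (x i))"
    proof (cases "\<forall>i<m. x i \<in> A i \<inter> E k")
      case True
      then have "x \<in> Pi\<^sub>E {..<m} A \<inter> C k" using x by (auto simp: spN C_def PiE_iff)
      then show ?thesis using True by simp
    next
      case False
      then obtain i where i: "i < m" "x i \<notin> A i \<inter> E k" by blast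
      then have "x \<notin> Pi\<^sub>E {..<m} A \<inter> C k" by (auto simp: C_def PiE_iff)
      moreover have "(\<Prod>i<m. indicator (A i \<inter> E k) (x i) :: real) = 0"
        using i by (intro prod_zero) (auto intro!: bexI[of _ i])
      ultimately show ?thesis by simp
    qed
  qed
  have space_C: "approx_by ?N {F. rect_span m M F} (indicator (space ?N \<inter> C k))" for k
    unfolding spN by (rule rect) simp
  have setC: "approx_by ?N {F. rect_span m M F} (indicator (A \<inter> C k))" if A: "A \<in> sets ?N" for A k
  proof -
    let ?G = "prod_algebra {..<m} (\<lambda>_. M)"
    let ?O = "\<Pi>\<^sub>E i\<in>{..<m}. space M"
    have sN: "sets ?N = sigma_sets ?O ?G" by (simp add: power_measure_def sets_PiM)
    have "Int_stable ?G" by (rule Int_stable_prod_algebra)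
    moreover have "?G \<subseteq> Pow ?O" by (rule prod_algebra_sets_into_space)
    moreover have "A \<in> sigma_sets ?O ?G" using A sN by simp
    ultimately show ?thesis
    proof (induction rule: sigma_sets_induct_disjoint)
      case (basic A)
      then obtain X where "A = Pi\<^sub>E {..<m} X" "\<And>i. i < m \<Longrightarrow> X i \<in> sets M"
        by (auto simp: prod_algebra_eq_finite Pi_iff)
      then show ?case using rect by simp
    next
      case empty
      then show ?case using approx_zero by (simp add: indicator_def[abs_def])
    next
      case (compl A)
      have "A \<subseteq> ?O" using compl(1) sN sets.sets_into_space[of A ?N] spN by simp
      then have "(indicator ((?O - A) \<inter> C k) :: _ \<Rightarrow> real) = (\<lambda>x. indicator (space ?N \<inter> C k) x - indicator (A \<inter> C k) x)"
        by (auto simp: spN indicator_def fun_eq_iff)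
      then show ?case using approx_diff[OF space_C compl(2)] by simp
    next
      case (union A)
      have As: "A i \<in> sets ?N" for i using union(2) sN by auto
      \<comment> \<open>Partial unions converge pointwise below the indicator of \<open>C k\<close>,
        which is square integrable because the box has finite measure.\<close>
      show ?case
      proof (rule approx_limit[where w = "indicator (C k)" and f = "\<lambda>n x. \<Sum>i<n. indicator (A i \<inter> C k) x"])
        show "approx_by ?N {F. rect_span m M F} (\<lambda>x. \<Sum>i<n. indicator (A i \<inter> C k) x)" for n
          by (intro approx_sum union(3)) auto
        have "(\<Union>i. A i) \<inter> C k \<in> sets ?N" using As by auto
        then show "indicator ((\<Union>i. A i) \<inter> C k) \<in> borel_measurable ?N" by simp
        show "integrable ?N (\<lambda>x. (indicator (C k) x :: real)\<^sup>2)"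
          using IL[of "space ?N" k] indicator_L2[OF Cs Cf] L2_integrable by blast
        have dj: "(\<Sum>i<n. indicator (A i \<inter> C k) x :: real) = indicator ((\<Union>i<n. A i) \<inter> C k) x" for n x
        proof -
          have "disjoint_family_on (\<lambda>i. A i \<inter> C k) {..<n}"
            using union(1) by (auto simp: disjoint_family_on_def)
          then show ?thesis
            by (subst indicator_UN_disjoint[symmetric]) (auto simp: Int_UN_distrib2)
        qed
        show "\<bar>\<Sum>i<n. indicator (A i \<inter> C k) x\<bar> \<le> (indicator (C k) x :: real)" for n x
          unfolding dj by (auto simp: indicator_def)
        show "(\<lambda>n. \<Sum>i<n. indicator (A i \<inter> C k) x) \<longlonglongrightarrow> (indicator ((\<Union>i. A i) \<inter> C k) x :: real)" for x
        proof (cases "x \<in> (\<Union>i. A i)")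
          case True
          then obtain i where "x \<in> A i" by blast
          have "\<forall>\<^sub>F n in sequentially. (\<Sum>i<n. indicator (A i \<inter> C k) x) = (indicator ((\<Union>i. A i) \<inter> C k) x :: real)"
            unfolding dj
          proof (rule eventually_mono[OF eventually_gt_at_top[of i]])
            fix n assume "i < n"
            then show "indicator ((\<Union>i<n. A i) \<inter> C k) x = (indicator ((\<Union>i. A i) \<inter> C k) x :: real)"
              using \<open>x \<in> A i\<close> by (auto simp: indicator_def)
          qed
          then show ?thesis by (rule tendsto_eventually)
        qed (simp add: indicator_def)
      qed
    qed
  qed
  \<comment> \<open>The approximation by simple functions relative to the base point 0 provides the
    majorant 2 \<bar>f\<bar>.\<close>
  obtain s where s: "\<And>i. simple_function ?N (s i)" "\<And>x. x \<in> space ?N \<Longrightarrow> (\<lambda>i. s i x) \<longlonglongrightarrow> f x"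
    "\<And>i x. x \<in> space ?N \<Longrightarrow> norm (s i x) \<le> 2 * norm (f x)"
    using borel_measurable_implies_sequence_metric[OF L2_measurable[OF f], of 0]
    unfolding norm_conv_dist by metis
  show ?thesis
  proof (rule approx_limit[where w = "\<lambda>x. 2 * \<bar>f x\<bar>" and f = "\<lambda>n x. s n x * indicator (C n) x"])
    show "approx_by ?N {F. rect_span m M F} (\<lambda>x. s n x * indicator (C n) x)" for n
    proof -
      define h where "h = (\<lambda>x. \<Sum>y\<in>s n ` space ?N. y * indicator ((s n -` {y} \<inter> space ?N) \<inter> C n) x)"
      have fin: "finite (s n ` space ?N)" using s(1) by (simp add: simple_function_def)
      have h: "approx_by ?N {F. rect_span m M F} h"
        unfolding h_def using s(1) fin by (intro approx_sum approx_cmult setC) (auto simp: simple_function_def)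
      have eq: "s n x * indicator (C n) x = h x" if x: "x \<in> space ?N" for x
      proof -
        have "h x = (\<Sum>y\<in>s n ` space ?N. if y = s n x then y * indicator (C n) x else 0)"
          unfolding h_def using x by (intro sum.cong) (auto simp: indicator_def)
        then show ?thesis using x fin by simp
      qed
      have "(\<lambda>x. s n x * indicator (C n) x) \<in> L2 ?N"
      proof -
        have "(\<lambda>x. s n x * indicator (C n) x) \<in> borel_measurable ?N"
          using borel_measurable_simple_function[OF s(1)] by measurable
        moreover have "h \<in> L2 ?N" using h by (simp add: approx_by_def)
        moreover have "integrable ?N (\<lambda>x. (s n x * indicator (C n) x)\<^sup>2) = integrable ?N (\<lambda>x. (h x)\<^sup>2)"
          using eq by (intro Bochner_Integration.integrable_cong) auto
        ultimately show ?thesis by (simp add: L2_def)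
      qed
      moreover have "(\<integral>x. (s n x * indicator (C n) x - g x)\<^sup>2 \<partial>?N) = (\<integral>x. (h x - g x)\<^sup>2 \<partial>?N)" for g
        using eq by (intro Bochner_Integration.integral_cong) auto
      ultimately show ?thesis using h by (simp add: approx_by_def)
    qed
    show "f \<in> borel_measurable ?N" by (rule L2_measurable[OF f])
    show "integrable ?N (\<lambda>x. (2 * \<bar>f x\<bar>)\<^sup>2)" using L2_integrable[OF f] by (simp add: power_mult_distrib)
    fix x assume x: "x \<in> space ?N"
    show "\<bar>s n x * indicator (C n) x\<bar> \<le> 2 * \<bar>f x\<bar>" for n
      using s(3)[OF x, of n] by (auto simp: indicator_def)
    \<comment> \<open>The sum of the indices serves as a common upper bound for the m coordinates,
      so every point lies in all boxes from some index on.\<close>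
    have "\<exists>k. \<forall>i<m. x i \<in> E k"
    proof -
      have "\<forall>i. \<exists>k. i < m \<longrightarrow> x i \<in> E k" using x E(2) by (fastforce simp: spN PiE_iff)
      then obtain K where K: "\<And>i. i < m \<Longrightarrow> x i \<in> E (K i)" by metis
      have "x i \<in> E (\<Sum>j<m. K j)" if "i < m" for i
      proof -
        have "K i \<le> (\<Sum>j<m. K j)" using that by (intro member_le_sum) auto
        then show ?thesis using K[OF that] E(4) by (auto simp: incseq_def)
      qed
      then show ?thesis by blast
    qed
    then obtain k where k: "\<forall>i<m. x i \<in> E k" by blast
    have "\<forall>\<^sub>F n in sequentially. s n x * indicator (C n) x = s n x"
      using eventually_ge_at_top[of k]
    proof eventually_elim
      case (elim n)
      then have "E k \<subseteq> E n" using E(4) by (auto simp: incseq_def)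
      then have "x \<in> C n" using k x by (auto simp: C_def spN PiE_iff)
      then show ?case by simp
    qed
    then show "(\<lambda>n. s n x * indicator (C n) x) \<longlonglongrightarrow> f x"
      using s(2)[OF x] by (subst tendsto_cong)
  qed
qed

text \<open>Since \<pi> fixes every index outside \<open>{..<m}\<close>, composition with it
  preserves extensionality. The preimage of a rectangle is the rectangle with permuted sides, whose
  measure is the same product in another order.\<close>

lemma power_measure_permute:
  assumes M: "sigma_finite_measure M" and \<pi>: "\<pi> permutes {..<m}"
  shows "(\<lambda>x. x \<circ> \<pi>) \<in> measurable (power_measure m M) (power_measure m M)"
    and "distr (power_measure m M) (power_measure m M) (\<lambda>x. x \<circ> \<pi>) = power_measure m M"
proof -
  let ?N = "power_measure m M"
  interpret sigma_finite_measure M by fact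
  interpret product_sigma_finite "\<lambda>_::nat. M" by unfold_locales
  have \<pi>m: "\<pi> i < m \<longleftrightarrow> i < m" for i using permutes_in_image[OF \<pi>, of i] by simp
  have \<pi>n: "\<pi> i = i" if "\<not> i < m" for i using permutes_not_in[OF \<pi>, of i] that by simp
  have spN: "space ?N = (\<Pi>\<^sub>E i\<in>{..<m}. space M)" by (simp add: power_measure_def space_PiM)
  have eq: "x \<circ> \<pi> = (\<lambda>i\<in>{..<m}. x (\<pi> i))" if "x \<in> space ?N" for x
  proof
    fix i show "(x \<circ> \<pi>) i = (\<lambda>i\<in>{..<m}. x (\<pi> i)) i"
      using that PiE_arb[of x "{..<m}" "\<lambda>_. space M" i] by (cases "i < m") (auto simp: spN \<pi>n)
  qed
  have "(\<lambda>x. \<lambda>i\<in>{..<m}. x (\<pi> i)) \<in> measurable ?N ?N"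
    unfolding power_measure_def
    by (intro measurable_restrict measurable_component_singleton) (simp add: \<pi>m)
  then show m: "(\<lambda>x. x \<circ> \<pi>) \<in> measurable ?N ?N" by (subst measurable_cong[OF eq]) auto
  show "distr ?N ?N (\<lambda>x. x \<circ> \<pi>) = ?N"
    unfolding power_measure_def
  proof (rule PiM_eqI)
    fix A assume A: "\<And>i. i \<in> {..<m} \<Longrightarrow> A i \<in> sets M"
    have As: "Pi\<^sub>E {..<m} A \<in> sets ?N" unfolding power_measure_def using A by (intro sets_PiM_I_finite) auto
    have inv: "inv \<pi> permutes {..<m}" by (rule permutes_inv[OF \<pi>])
    have invm: "inv \<pi> i < m \<longleftrightarrow> i < m" for i using permutes_in_image[OF inv, of i] by simp
    have "(\<lambda>x. x \<circ> \<pi>) -` (Pi\<^sub>E {..<m} A) \<inter> space ?N = Pi\<^sub>E {..<m} (\<lambda>i. A (inv \<pi> i))"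
    proof (intro set_eqI iffI)
      fix x assume "x \<in> (\<lambda>x. x \<circ> \<pi>) -` (Pi\<^sub>E {..<m} A) \<inter> space ?N"
      then have x: "x \<in> space ?N" and *: "\<And>i. i < m \<Longrightarrow> x (\<pi> i) \<in> A i" by (auto simp: PiE_iff)
      have "x i \<in> A (inv \<pi> i)" if "i < m" for i
        using *[of "inv \<pi> i"] that invm permutes_inverses(1)[OF \<pi>] by simp
      then show "x \<in> Pi\<^sub>E {..<m} (\<lambda>i. A (inv \<pi> i))" using x by (auto simp: spN PiE_iff)
    next
      fix x assume x: "x \<in> Pi\<^sub>E {..<m} (\<lambda>i. A (inv \<pi> i))"
      have xs: "x \<in> space ?N"
        unfolding spN
      proof (rule PiE_I)
        fix i assume i: "i \<in> {..<m}"
        then have "x i \<in> A (inv \<pi> i)" using x by (auto simp: PiE_iff)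
        then show "x i \<in> space M" using A[of "inv \<pi> i"] invm i sets.sets_into_space by blast
      next
        fix i assume "i \<notin> {..<m}"
        then show "x i = undefined" by (rule PiE_arb[OF x])
      qed
      have "x (\<pi> i) \<in> A i" if "i < m" for i
        using PiE_mem[OF x, of "\<pi> i"] that \<pi>m permutes_inverses(2)[OF \<pi>] by simp
      then show "x \<in> (\<lambda>x. x \<circ> \<pi>) -` (Pi\<^sub>E {..<m} A) \<inter> space ?N"
        using xs by (simp add: eq PiE_iff)
    qed
    then have "emeasure (distr ?N ?N (\<lambda>x. x \<circ> \<pi>)) (Pi\<^sub>E {..<m} A) = emeasure ?N (Pi\<^sub>E {..<m} (\<lambda>i. A (inv \<pi> i)))"
      using emeasure_distr[OF m As] by simp
    also have "\<dots> = (\<Prod>i<m. emeasure M (A (inv \<pi> i)))"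
      unfolding power_measure_def using A invm by (intro emeasure_PiM) auto
    also have "\<dots> = (\<Prod>i<m. emeasure M (A i))"
      using prod.permute[OF inv, of "\<lambda>i. emeasure M (A i)"] by (simp add: o_def)
    finally show "emeasure (distr (Pi\<^sub>M {..<m} (\<lambda>_. M)) (Pi\<^sub>M {..<m} (\<lambda>_. M)) (\<lambda>x. x \<circ> \<pi>)) (Pi\<^sub>E {..<m} A) = (\<Prod>i<m. emeasure M (A i))"
      unfolding power_measure_def .
  qed auto
qed

section \<open>Symmetrization and reduction to tensor powers\<close>

definition symmetrize :: "nat \<Rightarrow> ((nat \<Rightarrow> 'a) \<Rightarrow> real) \<Rightarrow> (nat \<Rightarrow> 'a) \<Rightarrow> real" where
  "symmetrize m g x = (\<Sum>\<pi> | \<pi> permutes {..<m}. g (x \<circ> \<pi>)) / fact m"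

lemma L2_permute:
  assumes M: "sigma_finite_measure M" and \<pi>: "\<pi> permutes {..<m}" and g: "g \<in> L2 (power_measure m M)"
  shows "(\<lambda>x. g (x \<circ> \<pi>)) \<in> L2 (power_measure m M)"
    and "(\<integral>x. (g (x \<circ> \<pi>))\<^sup>2 \<partial>power_measure m M) = (\<integral>x. (g x)\<^sup>2 \<partial>power_measure m M)"
proof -
  let ?N = "power_measure m M"
  note m = power_measure_permute(1)[OF M \<pi>] and d = power_measure_permute(2)[OF M \<pi>]
  note gm[measurable] = L2_measurable[OF g]
  have "(\<lambda>x. g (x \<circ> \<pi>)) \<in> borel_measurable ?N" using measurable_compose[OF m gm] .
  moreover have "integrable ?N (\<lambda>x. (g (x \<circ> \<pi>))\<^sup>2)"
  proof -
    have "integrable (distr ?N ?N (\<lambda>x. x \<circ> \<pi>)) (\<lambda>x. (g x)\<^sup>2)" unfolding d by (rule L2_integrable[OF g])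
    then show ?thesis by (subst (asm) integrable_distr_eq[OF m]) auto
  qed
  ultimately show "(\<lambda>x. g (x \<circ> \<pi>)) \<in> L2 ?N" by (simp add: L2_def)
  have "(\<integral>x. (g x)\<^sup>2 \<partial>?N) = (\<integral>x. (g x)\<^sup>2 \<partial>distr ?N ?N (\<lambda>x. x \<circ> \<pi>))" unfolding d ..
  also have "\<dots> = (\<integral>x. (g (x \<circ> \<pi>))\<^sup>2 \<partial>?N)" by (rule integral_distr[OF m]) measurable
  finally show "(\<integral>x. (g (x \<circ> \<pi>))\<^sup>2 \<partial>?N) = (\<integral>x. (g x)\<^sup>2 \<partial>?N)" ..
qed

text \<open>A symmetric f agrees a.e. with its symmetrization, so f minus the symmetrization of g is
  the average of the permuted copies of f - g. Convexity of the square and permutation invariance of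
  the measure give the bound.\<close>

lemma symmetrize_contraction:
  assumes M: "sigma_finite_measure M" and f: "f \<in> L2_sym m M" and g: "g \<in> L2 (power_measure m M)"
  shows "(\<integral>x. (f x - symmetrize m g x)\<^sup>2 \<partial>power_measure m M) \<le> (\<integral>x. (f x - g x)\<^sup>2 \<partial>power_measure m M)"
proof -
  let ?N = "power_measure m M" and ?S = "{\<pi>. \<pi> permutes {..<m}}"
  have fL: "f \<in> L2 ?N" using f by (simp add: L2_sym_def)
  have fin: "finite ?S" by (rule finite_permutations) simp
  have card: "card ?S = fact m" using card_permutations[of "{..<m}" m] by simp
  define d where "d x = f x - g x" for x
  have dL: "d \<in> L2 ?N" unfolding d_def[abs_def] by (rule L2_diff[OF fL g])
  have dp: "(\<lambda>x. d (x \<circ> \<pi>)) \<in> L2 ?N" if "\<pi> \<in> ?S" for \<pi> using L2_permute(1)[OF M _ dL] that by simp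
  have symL: "symmetrize m g \<in> L2 ?N"
    using L2_cmult[OF L2_sum[of ?S "\<lambda>\<pi> x. g (x \<circ> \<pi>)" ?N], of "1 / fact m"] L2_permute(1)[OF M _ g]
    by (simp add: symmetrize_def[abs_def])
  have "AE x in ?N. \<forall>\<pi>\<in>?S. f (x \<circ> \<pi>) = f x"
    using fin f by (subst AE_finite_all) (auto simp: L2_sym_def)
  then have ae: "AE x in ?N. f x - symmetrize m g x = (\<Sum>\<pi>\<in>?S. d (x \<circ> \<pi>)) / fact m"
  proof eventually_elim
    case (elim x)
    have "(\<Sum>\<pi>\<in>?S. d (x \<circ> \<pi>)) = (\<Sum>\<pi>\<in>?S. f x - g (x \<circ> \<pi>))"
      using elim by (intro sum.cong) (auto simp: d_def)
    also have "\<dots> = fact m * f x - (\<Sum>\<pi>\<in>?S. g (x \<circ> \<pi>))"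
      by (simp add: sum_subtractf card)
    finally show ?case by (simp add: symmetrize_def diff_divide_distrib)
  qed
  have "(\<integral>x. (f x - symmetrize m g x)\<^sup>2 \<partial>?N) \<le> (\<integral>x. (\<Sum>\<pi>\<in>?S. (d (x \<circ> \<pi>))\<^sup>2) / fact m \<partial>?N)"
  proof (rule integral_mono_AE)
    show "integrable ?N (\<lambda>x. (f x - symmetrize m g x)\<^sup>2)" by (rule L2_integrable[OF L2_diff[OF fL symL]])
    show "integrable ?N (\<lambda>x. (\<Sum>\<pi>\<in>?S. (d (x \<circ> \<pi>))\<^sup>2) / fact m)"
      by (intro integrable_divide Bochner_Integration.integrable_sum L2_integrable dp)
    show "AE x in ?N. (f x - symmetrize m g x)\<^sup>2 \<le> (\<Sum>\<pi>\<in>?S. (d (x \<circ> \<pi>))\<^sup>2) / fact m"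
      using ae
    proof eventually_elim
      case (elim x)
      have "(\<Sum>\<pi>\<in>?S. d (x \<circ> \<pi>))\<^sup>2 \<le> (\<Sum>\<pi>\<in>?S. (d (x \<circ> \<pi>))\<^sup>2) * fact m"
        using sum_squared_le_sum_of_squares[of "\<lambda>\<pi>. d (x \<circ> \<pi>)" ?S] by (simp add: card)
      then show ?case unfolding elim by (simp add: power_divide divide_le_eq power2_eq_square field_simps)
    qed
  qed
  also have "\<dots> = (\<Sum>\<pi>\<in>?S. \<integral>x. (d (x \<circ> \<pi>))\<^sup>2 \<partial>?N) / fact m"
    by (subst integral_divide_zero, subst Bochner_Integration.integral_sum) (auto intro: L2_integrable dp)
  also have "\<dots> = (\<integral>x. (d x)\<^sup>2 \<partial>?N)"
    using L2_permute(2)[OF M _ dL] by (simp add: card)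
  finally show ?thesis by (simp add: d_def)
qed

text \<open>Ryser's formula for the permanent. Expanding the product for \<open>S\<close> gives a
  sum over maps into \<open>S\<close>; the signed count of the sets \<open>S\<close> containing the
  image of a map is 1 if the map is onto \<open>{..<m}\<close> and 0 otherwise, and a self-map of a
  finite set that is onto is a permutation.\<close>

lemma polarization:
  fixes b :: "nat \<Rightarrow> nat \<Rightarrow> real"
  shows "(\<Sum>\<pi> | \<pi> permutes {..<m}. \<Prod>i<m. b i (\<pi> i)) =
    (\<Sum>S\<in>Pow {..<m}. (- 1) ^ (m - card S) * (\<Prod>i<m. \<Sum>j\<in>S. b i j))"
proof -
  let ?I = "{..<m}"
  let ?F = "\<Pi>\<^sub>E i\<in>?I. ?I"
  have finF: "finite ?F" by (intro finite_PiE) auto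
  have inner: "(\<Sum>S\<in>Pow ?I. (- 1) ^ (m - card S) * (if \<sigma> ` ?I \<subseteq> S then 1 else 0)) = (if ?I \<subseteq> \<sigma> ` ?I then 1 else (0::real))" for \<sigma> :: "nat \<Rightarrow> nat"
  proof -
    \<comment> \<open>The signed sum over S is read as the expansion of a product over j: the term 1
      means j in S, and the other term, for j not in S, is 0 if j is in the image and -1 otherwise.
      The product vanishes as soon as some j is missed.\<close>
    have "(\<Sum>S\<in>Pow ?I. (- 1) ^ (m - card S) * (if \<sigma> ` ?I \<inter> ?I \<subseteq> S then 1 else (0::real)))
      = (\<Sum>S\<in>Pow ?I. (\<Prod>j\<in>S. 1) * (\<Prod>j\<in>?I - S. if j \<in> \<sigma> ` ?I then 0 else - 1))"
    proof (intro sum.cong refl)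
      fix S assume S: "S \<in> Pow ?I"
      then have fS: "finite S" using finite_subset by auto
      show "(- 1) ^ (m - card S) * (if \<sigma> ` ?I \<inter> ?I \<subseteq> S then 1 else (0::real)) = (\<Prod>j\<in>S. 1) * (\<Prod>j\<in>?I - S. if j \<in> \<sigma> ` ?I then 0 else - 1)"
      proof (cases "\<sigma> ` ?I \<inter> ?I \<subseteq> S")
        case True
        then have "(\<Prod>j\<in>?I - S. if j \<in> \<sigma> ` ?I then 0 else - 1 :: real) = (\<Prod>j\<in>?I - S. - 1)"
          by (intro prod.cong) auto
        also have "\<dots> = (- 1) ^ (m - card S)" using S fS by (simp add: card_Diff_subset)
        finally show ?thesis using True by simp
      next
        case False
        then obtain j where "j \<in> \<sigma> ` ?I" "j \<in> ?I - S" by blast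
        then have "(\<Prod>j\<in>?I - S. if j \<in> \<sigma> ` ?I then 0 else - 1 :: real) = 0"
          by (intro prod_zero) auto
        then show ?thesis using False by simp
      qed
    qed
    also have "\<dots> = (\<Prod>j<m. 1 + (if j \<in> \<sigma> ` ?I then 0 else - 1))"
      by (rule prod_add[symmetric]) simp
    also have "\<dots> = (if ?I \<subseteq> \<sigma> ` ?I then 1 else 0)"
    proof (cases "?I \<subseteq> \<sigma> ` ?I")
      case True
      then show ?thesis by (auto intro!: prod.neutral)
    next
      case False
      then obtain j where "j < m" "j \<notin> \<sigma> ` ?I" by auto
      then have "(\<Prod>j<m. 1 + (if j \<in> \<sigma> ` ?I then 0 else - 1 :: real)) = 0"
        by (intro prod_zero) (auto intro!: bexI[of _ j])
      then show ?thesis using False by simp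
    qed
    finally have 1: "(\<Sum>S\<in>Pow ?I. (- 1) ^ (m - card S) * (if \<sigma> ` ?I \<inter> ?I \<subseteq> S then 1 else (0::real))) = (if ?I \<subseteq> \<sigma> ` ?I then 1 else 0)" .
    show ?thesis
    proof (cases "\<sigma> ` ?I \<subseteq> ?I")
      case True
      then have "\<sigma> ` ?I \<inter> ?I = \<sigma> ` ?I" by blast
      then show ?thesis using 1 by simp
    next
      case False
      then have a: "\<not> \<sigma> ` ?I \<subseteq> S" if "S \<in> Pow ?I" for S using that by blast
      have "\<not> ?I \<subseteq> \<sigma> ` ?I"
      proof
        assume "?I \<subseteq> \<sigma> ` ?I"
        moreover have "card (\<sigma> ` ?I) \<le> card ?I" by (intro card_image_le) simp
        ultimately have "?I = \<sigma> ` ?I" by (intro card_seteq) auto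
        then show False using False by simp
      qed
      moreover have "(\<Sum>S\<in>Pow ?I. (- 1) ^ (m - card S) * (if \<sigma> ` ?I \<subseteq> S then 1 else (0::real))) = 0"
        using a by (intro sum.neutral) auto
      ultimately show ?thesis by simp
    qed
  qed
  have "(\<Sum>S\<in>Pow ?I. (- 1) ^ (m - card S) * (\<Prod>i<m. \<Sum>j\<in>S. b i j))
     = (\<Sum>S\<in>Pow ?I. \<Sum>\<sigma>\<in>?F. (- 1) ^ (m - card S) * (if \<sigma> ` ?I \<subseteq> S then 1 else 0) * (\<Prod>i<m. b i (\<sigma> i)))"
  proof (intro sum.cong refl)
    fix S assume S: "S \<in> Pow ?I"
    then have fS: "finite S" using finite_subset by auto
    have "(\<Prod>i<m. \<Sum>j\<in>S. b i j) = (\<Sum>\<sigma>\<in>(\<Pi>\<^sub>E i\<in>?I. S). \<Prod>i<m. b i (\<sigma> i))"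
      using fS by (intro prod_sum_PiE) auto
    also have "\<dots> = (\<Sum>\<sigma>\<in>?F. if \<sigma> ` ?I \<subseteq> S then (\<Prod>i<m. b i (\<sigma> i)) else 0)"
    proof -
      have "(\<Pi>\<^sub>E i\<in>?I. S) = {\<sigma> \<in> ?F. \<sigma> ` ?I \<subseteq> S}" using S by (auto simp: PiE_iff extensional_def)
      then show ?thesis using finF by (simp add: sum.inter_filter)
    qed
    finally show "(- 1) ^ (m - card S) * (\<Prod>i<m. \<Sum>j\<in>S. b i j) = (\<Sum>\<sigma>\<in>?F. (- 1) ^ (m - card S) * (if \<sigma> ` ?I \<subseteq> S then 1 else 0) * (\<Prod>i<m. b i (\<sigma> i)))"
      by (simp add: sum_distrib_left) (intro sum.cong, auto)
  qed
  also have "\<dots> = (\<Sum>\<sigma>\<in>?F. (\<Sum>S\<in>Pow ?I. (- 1) ^ (m - card S) * (if \<sigma> ` ?I \<subseteq> S then 1 else 0)) * (\<Prod>i<m. b i (\<sigma> i)))"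
    by (subst sum.swap) (simp add: sum_distrib_right)
  also have "\<dots> = (\<Sum>\<sigma>\<in>?F. if ?I \<subseteq> \<sigma> ` ?I then (\<Prod>i<m. b i (\<sigma> i)) else 0)"
    unfolding inner by (intro sum.cong) auto
  also have "\<dots> = (\<Sum>\<sigma>\<in>{\<sigma> \<in> ?F. ?I \<subseteq> \<sigma> ` ?I}. \<Prod>i<m. b i (\<sigma> i))"
    using finF by (simp add: sum.inter_filter)
  \<comment> \<open>Maps in the extensional function space are undefined off \<open>{..<m}\<close>,
    while permutations are the identity there; the witnesses translate between the two
    conventions.\<close>
  also have "\<dots> = (\<Sum>\<pi> | \<pi> permutes ?I. \<Prod>i<m. b i (\<pi> i))"
  proof (rule sum.reindex_bij_witness[where i = "\<lambda>\<pi>. restrict \<pi> ?I" and j = "\<lambda>\<sigma> i. if i < m then \<sigma> i else i"])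
    fix \<sigma> assume \<sigma>: "\<sigma> \<in> {\<sigma> \<in> ?F. ?I \<subseteq> \<sigma> ` ?I}"
    show "restrict (\<lambda>i. if i < m then \<sigma> i else i) ?I = \<sigma>"
      using \<sigma> by (auto simp: fun_eq_iff PiE_iff extensional_def)
    have img: "\<sigma> ` ?I = ?I" using \<sigma> by auto
    have "inj_on \<sigma> ?I" by (rule eq_card_imp_inj_on) (simp_all add: img)
    then have "bij_betw (\<lambda>i. if i < m then \<sigma> i else i) ?I ?I"
      using img by (subst bij_betw_cong[of _ _ \<sigma>]) (auto simp: bij_betw_def)
    then show "(\<lambda>i. if i < m then \<sigma> i else i) \<in> {\<pi>. \<pi> permutes ?I}"
      by (intro CollectI bij_imp_permutes) auto
    show "(\<Prod>i<m. b i (if i < m then \<sigma> i else i)) = (\<Prod>i<m. b i (\<sigma> i))" by (intro prod.cong) auto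
  next
    fix \<pi> assume \<pi>: "\<pi> \<in> {\<pi>. \<pi> permutes ?I}"
    then show "(\<lambda>i. if i < m then restrict \<pi> ?I i else i) = \<pi>"
      by (auto simp: fun_eq_iff permutes_not_in[of \<pi> ?I])
    have "\<pi> ` ?I = ?I" using \<pi> by (auto intro!: permutes_image)
    then have "restrict \<pi> ?I ` ?I = ?I" by simp
    then show "restrict \<pi> ?I \<in> {\<sigma> \<in> ?F. ?I \<subseteq> \<sigma> ` ?I}"
      using permutes_in_image[of \<pi> ?I] \<pi> by (auto simp del: image_restrict_eq)
  qed
  finally show ?thesis by simp
qed

text \<open>All of \<open>L2 M\<close> is allowed for \<open>h\<close>, since the sums of indicators
  produced by polarization are not normalized; normalization takes place when the integral is
  applied.\<close>

inductive tensor_span :: "nat \<Rightarrow> 'a measure \<Rightarrow> ((nat \<Rightarrow> 'a) \<Rightarrow> real) \<Rightarrow> bool" for m M where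
  tensor_zero: "tensor_span m M (\<lambda>x. 0)"
| tensor_step: "tensor_span m M F \<Longrightarrow> h \<in> L2 M \<Longrightarrow> tensor_span m M (\<lambda>x. F x + c * tensor_power m h x)"

lemma tensor_span_add: "tensor_span m M G \<Longrightarrow> tensor_span m M F \<Longrightarrow> tensor_span m M (\<lambda>x. F x + G x)"
proof (induction rule: tensor_span.induct)
  case (tensor_step G h c)
  have "tensor_span m M (\<lambda>x. (F x + G x) + c * tensor_power m h x)"
    by (rule tensor_span.tensor_step) (use tensor_step in auto)
  then show ?case by (simp add: algebra_simps)
qed simp

lemma tensor_span_sum: "finite I \<Longrightarrow> (\<And>i. i \<in> I \<Longrightarrow> tensor_span m M (F i)) \<Longrightarrow> tensor_span m M (\<lambda>x. \<Sum>i\<in>I. F i x)"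
  by (induction I rule: finite_induct) (auto intro: tensor_zero tensor_span_add)

lemma tensor_span_base: "h \<in> L2 M \<Longrightarrow> tensor_span m M (\<lambda>x. c * tensor_power m h x)"
  using tensor_step[OF tensor_zero, of h M m c] by simp

text \<open>Up to the factor 1/m!, the symmetrized indicator of a rectangle is the permanent of the
  matrix of the values of the indicators of the A_j at the x_i. Polarization expresses it by tensor
  powers of the partial sums of these indicators.\<close>

lemma symmetrize_rect_span:
  "rect_span m M g \<Longrightarrow> tensor_span m M (symmetrize m g)"
proof (induction rule: rect_span.induct)
  case rect_zero
  then show ?case by (simp add: symmetrize_def[abs_def] tensor_zero)
next
  case (rect_step F A c)
  let ?h = "\<lambda>S y. \<Sum>j\<in>S. indicator (A j) y :: real"
  have eq: "symmetrize m (\<lambda>x. F x + c * (\<Prod>i<m. indicator (A i) (x i))) =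
    (\<lambda>x. symmetrize m F x + (\<Sum>S\<in>Pow {..<m}. (c / fact m * (- 1) ^ (m - card S)) * tensor_power m (?h S) x))"
  proof
    fix x :: "nat \<Rightarrow> 'a"
    \<comment> \<open>Summing over inverses and reindexing the product moves the permutation from
      the points to the sets, the form in which \<open>polarization\<close> applies.\<close>
    have "(\<Sum>\<pi> | \<pi> permutes {..<m}. \<Prod>i<m. indicator (A i) ((x \<circ> \<pi>) i) :: real)
       = (\<Sum>\<pi> | \<pi> permutes {..<m}. \<Prod>i<m. indicator (A i) (x (inv \<pi> i)))"
      by (subst sum_permutations_inverse) simp
    also have "\<dots> = (\<Sum>\<pi> | \<pi> permutes {..<m}. \<Prod>i<m. indicator (A (\<pi> i)) (x i))"
    proof (intro sum.cong refl)
      fix \<pi> assume "\<pi> \<in> {\<pi>. \<pi> permutes {..<m}}"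
      then have \<pi>: "\<pi> permutes {..<m}" by simp
      show "(\<Prod>i<m. indicator (A i) (x (inv \<pi> i)) :: real) = (\<Prod>i<m. indicator (A (\<pi> i)) (x i))"
        using prod.permute[OF \<pi>, of "\<lambda>i. indicator (A i) (x (inv \<pi> i)) :: real"] permutes_inverses(2)[OF \<pi>]
        by (simp add: o_def)
    qed
    also have "\<dots> = (\<Sum>S\<in>Pow {..<m}. (- 1) ^ (m - card S) * tensor_power m (?h S) x)"
      unfolding tensor_power_def by (rule polarization)
    finally show "symmetrize m (\<lambda>x. F x + c * (\<Prod>i<m. indicator (A i) (x i))) x =
        symmetrize m F x + (\<Sum>S\<in>Pow {..<m}. (c / fact m * (- 1) ^ (m - card S)) * tensor_power m (?h S) x)"
      by (simp add: symmetrize_def sum.distrib add_divide_distrib sum_distrib_left[symmetric])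
         (simp add: sum_distrib_left sum_divide_distrib mult_ac)
  qed
  have "tensor_span m M (\<lambda>x. (c / fact m * (- 1) ^ (m - card S)) * tensor_power m (?h S) x)"
    if "S \<in> Pow {..<m}" for S
    using that rect_step.hyps(2) by (intro tensor_span_base L2_sum indicator_L2) auto
  then show ?case
    unfolding eq by (intro tensor_span_add[OF _ rect_step.IH] tensor_span_sum) auto
qed

lemma tensor_span_dense:
  assumes M: "sigma_finite_measure M" and f: "f \<in> L2_sym m M" and e: "0 < e"
  shows "\<exists>F. tensor_span m M F \<and> (\<integral>x. (f x - F x)\<^sup>2 \<partial>power_measure m M) < e"
proof -
  have "f \<in> L2 (power_measure m M)" using f by (simp add: L2_sym_def)
  from rect_span_dense[OF M this] e obtain g where g: "rect_span m M g"
    "(\<integral>x. (f x - g x)\<^sup>2 \<partial>power_measure m M) < e" unfolding approx_by_def by blast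
  show ?thesis
    using symmetrize_rect_span[OF g(1)] symmetrize_contraction[OF M f rect_span_L2[OF M g(1)]] g(2)
    by (intro exI[of _ "symmetrize m g"]) auto
qed

lemma tensor_power_L2_sym:
  assumes M: "sigma_finite_measure M" and h: "h \<in> L2 M"
  shows "tensor_power m h \<in> L2_sym m M"
  unfolding L2_sym_def
proof (intro CollectI conjI allI impI AE_I2)
  show "tensor_power m h \<in> L2 (power_measure m M)"
    unfolding tensor_power_def[abs_def] by (rule product_L2[OF M h])
  fix \<pi> x assume "\<pi> permutes {..<m}"
  from prod.permute[OF this, of "\<lambda>i. h (x i)"] show "tensor_power m h (x \<circ> \<pi>) = tensor_power m h x"
    by (simp add: tensor_power_def o_def)
qed

lemma L2_sym_lincomb:
  assumes f: "f \<in> L2_sym m M" and g: "g \<in> L2_sym m M"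
  shows "(\<lambda>x. a * f x + b * g x) \<in> L2_sym m M"
  unfolding L2_sym_def
proof (intro CollectI conjI allI impI)
  show "(\<lambda>x. a * f x + b * g x) \<in> L2 (power_measure m M)"
    using f g by (intro L2_add L2_cmult) (auto simp: L2_sym_def)
  fix \<pi> assume \<pi>: "\<pi> permutes {..<m}"
  have "AE x in power_measure m M. f (x \<circ> \<pi>) = f x" "AE x in power_measure m M. g (x \<circ> \<pi>) = g x"
    using f g \<pi> by (auto simp: L2_sym_def)
  then show "AE x in power_measure m M. a * f (x \<circ> \<pi>) + b * g (x \<circ> \<pi>) = a * f x + b * g x"
    by eventually_elim simp
qed

lemma tensor_span_L2_sym:
  assumes M: "sigma_finite_measure M"
  shows "tensor_span m M F \<Longrightarrow> F \<in> L2_sym m M"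
proof (induction rule: tensor_span.induct)
  case tensor_zero
  show ?case by (simp add: L2_sym_def L2_zero)
next
  case (tensor_step F h c)
  from L2_sym_lincomb[OF tensor_step.IH tensor_power_L2_sym[OF M tensor_step.hyps(2)], of 1 c]
  show ?case by simp
qed

subsection \<open>Multiple Wiener integrals\<close>

text \<open>Used to translate the unit norm of a kernel into a unit coefficient vector, as required
  by the generators of \<open>chaos\<close>.\<close>

lemma gauss_linear_second_moment:
  "(\<integral>x. (\<Sum>i<n. a i * x i)\<^sup>2 \<partial>gauss n) = (\<Sum>i<n. (a i)\<^sup>2)"
proof -
  let ?L = "\<lambda>x. \<Sum>i<n. a i * x i"
  have "(\<integral>x. (?L x)\<^sup>2 \<partial>gauss n) = (\<integral>x. (\<Sum>i<n. a i * (x i * ?L x)) \<partial>gauss n)"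
    by (simp add: power2_eq_square sum_distrib_right mult_ac)
  also have "\<dots> = (\<Sum>i<n. \<integral>x. a i * (x i * ?L x) \<partial>gauss n)"
    by (intro Bochner_Integration.integral_sum poly_fun_integrable poly_cmult poly_mult poly_coord poly_linear) auto
  also have "\<dots> = (\<Sum>i<n. a i * a i)"
  proof (intro sum.cong refl)
    fix i assume i: "i \<in> {..<n}"
    have "pd i ?L = (\<lambda>x. a i)" using pd_hermite_linear[of i n 1 a] i by simp
    then have "(\<integral>x. x i * ?L x \<partial>gauss n) = a i"
      using poly_ibp[OF _ poly_linear, of i n a] i by (simp add: gauss.prob_space)
    then show "(\<integral>x. a i * (x i * ?L x) \<partial>gauss n) = a i * a i" by simp
  qed
  finally show ?thesis by (simp add: power2_eq_square)
qed

locale wiener_chaos = prob_space P for P :: "'w measure" +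
  fixes M :: "'a measure" and W :: "('a \<Rightarrow> real) \<Rightarrow> 'w \<Rightarrow> real"
    and I :: "nat \<Rightarrow> ((nat \<Rightarrow> 'a) \<Rightarrow> real) \<Rightarrow> 'w \<Rightarrow> real"
  assumes sf: "sigma_finite_measure M"
    and isonormal: "isonormal_process P M W"
    and wiener: "m \<ge> 1 \<Longrightarrow> multiple_wiener_integral P M W m (I m)"
begin

lemma I_L2: "m \<ge> 1 \<Longrightarrow> f \<in> L2_sym m M \<Longrightarrow> I m f \<in> L2 P"
  using wiener[of m] by (simp add: multiple_wiener_integral_def)

lemma I_linear:
  "m \<ge> 1 \<Longrightarrow> f \<in> L2_sym m M \<Longrightarrow> g \<in> L2_sym m M \<Longrightarrow>
    AE \<omega> in P. I m (\<lambda>x. a * f x + b * g x) \<omega> = a * I m f \<omega> + b * I m g \<omega>"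
  using wiener[of m] by (simp add: multiple_wiener_integral_def)

lemma I_bounded:
  assumes "m \<ge> 1"
  obtains C where "0 \<le> C" "\<And>f. f \<in> L2_sym m M \<Longrightarrow> (\<integral>\<omega>. (I m f \<omega>)\<^sup>2 \<partial>P) \<le> C * (\<integral>x. (f x)\<^sup>2 \<partial>power_measure m M)"
proof -
  obtain C where C: "\<And>f. f \<in> L2_sym m M \<Longrightarrow> L2_norm P (I m f) \<le> C * L2_norm (power_measure m M) f"
    using wiener[OF assms] unfolding multiple_wiener_integral_def by blast
  show thesis
  proof (rule that[of "C\<^sup>2"])
    fix f assume f: "f \<in> L2_sym m M"
    have "(L2_norm P (I m f))\<^sup>2 \<le> (C * L2_norm (power_measure m M) f)\<^sup>2"
      using C[OF f] by (intro power_mono) (simp_all add: L2_norm_def)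
    then show "(\<integral>\<omega>. (I m f \<omega>)\<^sup>2 \<partial>P) \<le> C\<^sup>2 * (\<integral>x. (f x)\<^sup>2 \<partial>power_measure m M)"
      by (simp add: L2_norm_def power_mult_distrib)
  qed simp
qed

lemma W_measurable: "h \<in> L2 M \<Longrightarrow> W h \<in> borel_measurable P"
  using isonormal by (simp add: isonormal_process_def centered_gaussian_family_def)

text \<open>The integral is prescribed on unit vectors; homogeneity of degree m handles every h of
  nonzero norm. An h of norm 0 cannot be normalized: its tensor power is a null function, and
  boundedness makes the integral vanish almost surely.\<close>

lemma I_tensor_power:
  assumes m: "m \<ge> 1" and h: "h \<in> L2 M"
  shows "\<exists>c h'. h' \<in> L2 M \<and> L2_norm M h' = 1 \<and> (AE \<omega> in P. I m (tensor_power m h) \<omega> = c * hermite m (W h' \<omega>))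
     \<or> (AE \<omega> in P. I m (tensor_power m h) \<omega> = 0)"
proof (cases "L2_norm M h = 0")
  case True
  interpret sigma_finite_measure M by (rule sf)
  interpret product_sigma_finite "\<lambda>_::nat. M" by unfold_locales
  have "(\<integral>x. (tensor_power m h x)\<^sup>2 \<partial>power_measure m M) = (\<integral>x. (\<Prod>i<m. (h (x i))\<^sup>2) \<partial>power_measure m M)"
    by (simp add: tensor_power_def prod_power_distrib)
  also have "\<dots> = (\<Prod>i<m. \<integral>y. (h y)\<^sup>2 \<partial>M)"
    unfolding power_measure_def by (intro product_integral_prod L2_integrable h) auto
  \<comment> \<open>The product is 0 because m is at least 1, so a vanishing factor does
    occur.\<close>
  also have "\<dots> = 0" using True m by (simp add: L2_norm_def)
  finally have 0: "(\<integral>x. (tensor_power m h x)\<^sup>2 \<partial>power_measure m M) = 0" .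
  note T = tensor_power_L2_sym[OF sf h, of m]
  obtain C where "\<And>f. f \<in> L2_sym m M \<Longrightarrow> (\<integral>\<omega>. (I m f \<omega>)\<^sup>2 \<partial>P) \<le> C * (\<integral>x. (f x)\<^sup>2 \<partial>power_measure m M)"
    using I_bounded[OF m] by blast
  from this[OF T] 0 have "(\<integral>\<omega>. (I m (tensor_power m h) \<omega>)\<^sup>2 \<partial>P) = 0"
    by (intro antisym) auto
  then have "AE \<omega> in P. (I m (tensor_power m h) \<omega>)\<^sup>2 = 0"
    using integral_nonneg_eq_0_iff_AE[OF L2_integrable[OF I_L2[OF m T]]] by simp
  then show ?thesis by auto
next
  case False
  define r where "r = L2_norm M h"
  have r: "r > 0" using False by (simp add: r_def L2_norm_def less_le)
  define h' where "h' = (\<lambda>y. (1 / r) * h y)"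
  have h': "h' \<in> L2 M" unfolding h'_def by (rule L2_cmult[OF h])
  have "(\<integral>y. (h' y)\<^sup>2 \<partial>M) = (\<integral>y. (h y)\<^sup>2 \<partial>M) / r\<^sup>2"
    unfolding h'_def power_mult_distrib by (simp add: power_divide)
  also have "(\<integral>y. (h y)\<^sup>2 \<partial>M) = r\<^sup>2" by (simp add: r_def L2_norm_def)
  finally have n: "L2_norm M h' = 1" using r by (simp add: L2_norm_def)
  \<comment> \<open>The summand with coefficient 0 brings the scaling into the two-term form of
    \<open>I_linear\<close>.\<close>
  have t: "tensor_power m h = (\<lambda>x. r ^ m * tensor_power m h' x + 0 * tensor_power m h' x)"
    using r by (simp add: tensor_power_def h'_def fun_eq_iff prod.distrib power_divide prod_dividef)
  have "AE \<omega> in P. I m (tensor_power m h) \<omega> = r ^ m * I m (tensor_power m h') \<omega> + 0 * I m (tensor_power m h') \<omega>"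
    unfolding t by (intro I_linear m tensor_power_L2_sym sf h')
  moreover have "AE \<omega> in P. I m (tensor_power m h') \<omega> = hermite m (W h' \<omega>)"
    using wiener[OF m] h' n by (simp add: multiple_wiener_integral_def)
  ultimately have "AE \<omega> in P. I m (tensor_power m h) \<omega> = r ^ m * hermite m (W h' \<omega>)"
    by eventually_elim simp
  then show ?thesis using h' n by blast
qed

lemma I_tensor_span:
  assumes m: "m \<ge> 1" and F: "tensor_span m M F"
  shows "\<exists>(K::nat) c h. (\<forall>k<K. h k \<in> L2 M \<and> L2_norm M (h k) = 1)
    \<and> (AE \<omega> in P. I m F \<omega> = (\<Sum>k<K. c k * hermite m (W (h k) \<omega>)))"
  using F
proof induction
  case tensor_zero
  have "(\<lambda>x. 0) \<in> L2_sym m M" by (rule tensor_span_L2_sym[OF sf tensor_span.tensor_zero])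
  from I_linear[OF m this this, of 0 0] show ?case by (intro exI[of _ 0]) simp
next
  case (tensor_step F h c)
  then obtain K :: nat and d k where k: "\<And>i. i < K \<Longrightarrow> k i \<in> L2 M \<and> L2_norm M (k i) = 1"
    and F: "AE \<omega> in P. I m F \<omega> = (\<Sum>i<K. d i * hermite m (W (k i) \<omega>))" by blast
  have lin: "AE \<omega> in P. I m (\<lambda>x. 1 * F x + c * tensor_power m h x) \<omega> = 1 * I m F \<omega> + c * I m (tensor_power m h) \<omega>"
    by (intro I_linear m tensor_span_L2_sym tensor_power_L2_sym sf tensor_step)
  from I_tensor_power[OF m tensor_step.hyps(2)] show ?case
  proof (elim exE disjE conjE)
    fix e h' assume h': "h' \<in> L2 M" "L2_norm M h' = 1"
      and t: "AE \<omega> in P. I m (tensor_power m h) \<omega> = e * hermite m (W h' \<omega>)"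
    have "AE \<omega> in P. I m (\<lambda>x. F x + c * tensor_power m h x) \<omega> =
       (\<Sum>i<Suc K. (d(K := c * e)) i * hermite m (W ((k(K := h')) i) \<omega>))"
      using lin F t by eventually_elim (simp add: mult.assoc)
    then show ?case
      using k h' by (intro exI[of _ "Suc K"] exI[of _ "d(K := c * e)"] exI[of _ "k(K := h')"]) (auto simp: less_Suc_eq)
  next
    assume t: "AE \<omega> in P. I m (tensor_power m h) \<omega> = 0"
    have "AE \<omega> in P. I m (\<lambda>x. F x + c * tensor_power m h x) \<omega> = (\<Sum>i<K. d i * hermite m (W (k i) \<omega>))"
      using lin F t by eventually_elim simp
    then show ?case using k by blast
  qed
qed

text \<open>One orthonormal family is built for the kernels of both integrals, so the pair has the
  joint law of two polynomials in the same Gaussian vector. Quantifying over test functions \<psi>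
  of both variables transfers integrability and all moments at once.\<close>

lemma tensor_span_law:
  assumes p: "p \<ge> 1" and q: "q \<ge> 1" and F: "tensor_span p M F" and G: "tensor_span q M G"
  shows "\<exists>n \<xi> \<eta>. chaos n p \<xi> \<and> chaos n q \<eta> \<and>
    (\<forall>\<psi>. case_prod \<psi> \<in> borel_measurable (borel \<Otimes>\<^sub>M borel) \<longrightarrow>
      (integrable P (\<lambda>\<omega>. \<psi> (I p F \<omega>) (I q G \<omega>) :: real) \<longleftrightarrow> integrable (gauss n) (\<lambda>x. \<psi> (\<xi> x) (\<eta> x))) \<and>
      (\<integral>\<omega>. \<psi> (I p F \<omega>) (I q G \<omega>) \<partial>P) = (\<integral>x. \<psi> (\<xi> x) (\<eta> x) \<partial>gauss n))"
proof -
  obtain K1 :: nat and c1 h1 where h1: "\<And>k. k < K1 \<Longrightarrow> h1 k \<in> L2 M \<and> L2_norm M (h1 k) = 1"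
    and X: "AE \<omega> in P. I p F \<omega> = (\<Sum>k<K1. c1 k * hermite p (W (h1 k) \<omega>))"
    using I_tensor_span[OF p F] by blast
  obtain K2 :: nat and c2 h2 where h2: "\<And>k. k < K2 \<Longrightarrow> h2 k \<in> L2 M \<and> L2_norm M (h2 k) = 1"
    and Y: "AE \<omega> in P. I q G \<omega> = (\<Sum>k<K2. c2 k * hermite q (W (h2 k) \<omega>))"
    using I_tensor_span[OF q G] by blast
  \<comment> \<open>The two lists of kernels are concatenated, so that a single Gram-Schmidt
    procedure treats them jointly.\<close>
  define h where "h k = (if k < K1 then h1 k else h2 (k - K1))" for k
  have h: "h k \<in> L2 M \<and> L2_norm M (h k) = 1" if "k < K1 + K2" for k
    using h1[of k] h2[of "k - K1"] that by (auto simp: h_def)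
  have g: "centered_gaussian_family P (L2 M) W" using isonormal by (simp add: isonormal_process_def)
  have "W (h k) \<in> gauss_span W (L2 M)" if "k < K1 + K2" for k using h[OF that] by (intro gauss_span_base) auto
  from gram_schmidt[OF g this, of "K1 + K2" "\<lambda>k. k"]
  have "\<exists>(n::nat) U a. (\<forall>i<n. U i \<in> gauss_span W (L2 M))
    \<and> (\<forall>i<n. \<forall>j<n. (\<integral>x. U i x * U j x \<partial>P) = (if i = j then 1 else 0))
    \<and> (\<forall>k<K1 + K2. AE x in P. W (h k) x = (\<Sum>i<n. a k i * U i x))" by simp
  then obtain n :: nat and U a where U: "\<And>i. i < n \<Longrightarrow> U i \<in> gauss_span W (L2 M)"
    and orth: "\<And>i j. i < n \<Longrightarrow> j < n \<Longrightarrow> (\<integral>x. U i x * U j x \<partial>P) = (if i = j then 1 else 0)"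
    and a: "\<And>k. k < K1 + K2 \<Longrightarrow> AE x in P. W (h k) x = (\<Sum>i<n. a k i * U i x)" by blast
  define \<Phi> where "\<Phi> x = (\<lambda>i\<in>{..<n}. U i x)" for x
  have \<Phi>[measurable]: "\<Phi> \<in> measurable P (gauss n)" and dist: "distr P (gauss n) \<Phi> = gauss n"
    unfolding \<Phi>_def[abs_def] by (intro gaussian_law(1)[OF g] gaussian_law(2)[OF g] U orth; assumption)+
  have a': "AE \<omega> in P. W (h k) \<omega> = (\<Sum>i<n. a k i * \<Phi> \<omega> i)" if "k < K1 + K2" for k
    using a[OF that] by eventually_elim (simp add: \<Phi>_def)
  \<comment> \<open>The isometry of the process gives E W(h_k)^2 = 1, and in the new coordinates
    this variance is the sum of the squared coefficients.\<close>
  have unit: "(\<Sum>i<n. (a k i)\<^sup>2) = 1" if k: "k < K1 + K2" for k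
  proof -
    have [measurable]: "(\<lambda>x. \<Sum>i<n. a k i * x i) \<in> borel_measurable (gauss n)"
      by (rule poly_fun_measurable[OF poly_linear])
    have "(\<Sum>i<n. (a k i)\<^sup>2) = (\<integral>x. (\<Sum>i<n. a k i * x i)\<^sup>2 \<partial>distr P (gauss n) \<Phi>)"
      unfolding dist gauss_linear_second_moment ..
    also have "\<dots> = (\<integral>\<omega>. (\<Sum>i<n. a k i * \<Phi> \<omega> i)\<^sup>2 \<partial>P)"
      by (rule integral_distr) measurable
    also have "\<dots> = (\<integral>\<omega>. (W (h k) \<omega>)\<^sup>2 \<partial>P)"
    proof (rule integral_cong_AE)
      show "AE \<omega> in P. (\<Sum>i<n. a k i * \<Phi> \<omega> i)\<^sup>2 = (W (h k) \<omega>)\<^sup>2"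
        using a'[OF k] by eventually_elim simp
      show "(\<lambda>\<omega>. (\<Sum>i<n. a k i * \<Phi> \<omega> i)\<^sup>2) \<in> borel_measurable P" by measurable
      have [measurable]: "W (h k) \<in> borel_measurable P" using W_measurable h[OF k] by blast
      show "(\<lambda>\<omega>. (W (h k) \<omega>)\<^sup>2) \<in> borel_measurable P" by measurable
    qed
    also have "\<dots> = (\<integral>x. (h k x)\<^sup>2 \<partial>M)"
      using isonormal h[OF k] by (simp add: isonormal_process_def power2_eq_square)
    also have "\<dots> = 1" using h[OF k] by (simp add: L2_norm_def)
    finally show ?thesis .
  qed
  define \<xi> where "\<xi> = (\<lambda>x. \<Sum>k<K1. c1 k * hermite p (\<Sum>i<n. a k i * x i))"
  define \<eta> where "\<eta> = (\<lambda>x. \<Sum>k<K2. c2 k * hermite q (\<Sum>i<n. a (K1 + k) i * x i))"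
  have \<xi>: "chaos n p \<xi>" unfolding \<xi>_def by (intro chaos_sum chaos_cmult chaos_hermite unit) auto
  have \<eta>: "chaos n q \<eta>" unfolding \<eta>_def by (intro chaos_sum chaos_cmult chaos_hermite unit) auto
  have "AE \<omega> in P. \<forall>k\<in>{..<K1 + K2}. W (h k) \<omega> = (\<Sum>i<n. a k i * \<Phi> \<omega> i)"
    using a' by (subst AE_finite_all) auto
  then have XY: "AE \<omega> in P. I p F \<omega> = \<xi> (\<Phi> \<omega>) \<and> I q G \<omega> = \<eta> (\<Phi> \<omega>)"
    using X Y
  proof eventually_elim
    case (elim \<omega>)
    have "hermite p (W (h1 k) \<omega>) = hermite p (\<Sum>i<n. a k i * \<Phi> \<omega> i)" if "k < K1" for k
      using elim(1)[rule_format, of k] that by (simp add: h_def)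
    moreover have "hermite q (W (h2 k) \<omega>) = hermite q (\<Sum>i<n. a (K1 + k) i * \<Phi> \<omega> i)" if "k < K2" for k
      using elim(1)[rule_format, of "K1 + k"] that by (simp add: h_def)
    ultimately show ?case using elim(2,3) by (simp add: \<xi>_def \<eta>_def)
  qed
  note [measurable] = L2_measurable[OF I_L2[OF p tensor_span_L2_sym[OF sf F]]]
    L2_measurable[OF I_L2[OF q tensor_span_L2_sym[OF sf G]]]
    poly_fun_measurable[OF chaos_poly[OF \<xi>]] poly_fun_measurable[OF chaos_poly[OF \<eta>]]
  show ?thesis
  proof (rule exI[of _ n], rule exI[of _ \<xi>], rule exI[of _ \<eta>], rule conjI[OF \<xi> conjI[OF \<eta>]], rule allI, rule impI, rule conjI)
    fix \<psi> :: "real \<Rightarrow> real \<Rightarrow> real"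
    assume psi: "case_prod \<psi> \<in> borel_measurable (borel \<Otimes>\<^sub>M borel)"
    have m1: "(\<lambda>x. \<psi> (\<xi> x) (\<eta> x)) \<in> borel_measurable (gauss n)"
    proof -
      have "(\<lambda>x. (\<xi> x, \<eta> x)) \<in> measurable (gauss n) (borel \<Otimes>\<^sub>M borel)" by measurable
      from measurable_compose[OF this psi] show ?thesis by simp
    qed
    have m2: "(\<lambda>\<omega>. \<psi> (I p F \<omega>) (I q G \<omega>)) \<in> borel_measurable P"
    proof -
      have "(\<lambda>\<omega>. (I p F \<omega>, I q G \<omega>)) \<in> measurable P (borel \<Otimes>\<^sub>M borel)" by measurable
      from measurable_compose[OF this psi] show ?thesis by simp
    qed
    have m3: "(\<lambda>\<omega>. \<psi> (\<xi> (\<Phi> \<omega>)) (\<eta> (\<Phi> \<omega>))) \<in> borel_measurable P"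
      by (rule measurable_compose[OF \<Phi> m1])
    have ae: "AE \<omega> in P. \<psi> (I p F \<omega>) (I q G \<omega>) = \<psi> (\<xi> (\<Phi> \<omega>)) (\<eta> (\<Phi> \<omega>))"
      using XY by eventually_elim simp
    show "integrable P (\<lambda>\<omega>. \<psi> (I p F \<omega>) (I q G \<omega>)) \<longleftrightarrow> integrable (gauss n) (\<lambda>x. \<psi> (\<xi> x) (\<eta> x))"
      using integrable_cong_AE[OF m2 m3 ae] integrable_distr_eq[OF \<Phi> m1] by (simp add: dist)
    show "(\<integral>\<omega>. \<psi> (I p F \<omega>) (I q G \<omega>) \<partial>P) = (\<integral>x. \<psi> (\<xi> x) (\<eta> x) \<partial>gauss n)"
      using integral_cong_AE[OF m2 m3 ae] integral_distr[OF \<Phi> m1] by (simp add: dist)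
  qed
qed

lemma tensor_span_hypercontractive:
  assumes p: "p \<ge> 1" and F: "tensor_span p M F"
  shows "integrable P (\<lambda>\<omega>. (I p F \<omega>) ^ 4)" "(\<integral>\<omega>. (I p F \<omega>) ^ 4 \<partial>P) \<le> 9 ^ p * (\<integral>\<omega>. (I p F \<omega>)\<^sup>2 \<partial>P)\<^sup>2"
proof -
  obtain n \<xi> \<eta> where \<xi>: "chaos n p \<xi>" and int: "\<forall>\<psi>. case_prod \<psi> \<in> borel_measurable (borel \<Otimes>\<^sub>M borel) \<longrightarrow>
      (integrable P (\<lambda>\<omega>. \<psi> (I p F \<omega>) (I p F \<omega>) :: real) \<longleftrightarrow> integrable (gauss n) (\<lambda>x. \<psi> (\<xi> x) (\<eta> x))) \<and>
      (\<integral>\<omega>. \<psi> (I p F \<omega>) (I p F \<omega>) \<partial>P) = (\<integral>x. \<psi> (\<xi> x) (\<eta> x) \<partial>gauss n)"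
    using tensor_span_law[OF p p F F] by (elim exE conjE)
  note int = int[rule_format]
  have m: "case_prod (\<lambda>(x::real) (y::real). x ^ k) \<in> borel_measurable (borel \<Otimes>\<^sub>M borel)" for k :: nat
    unfolding case_prod_beta by measurable
  show "integrable P (\<lambda>\<omega>. (I p F \<omega>) ^ 4)"
    using conjunct1[OF int[OF m[of 4]]] poly_fun_integrable[OF poly_power[OF chaos_poly[OF \<xi>]]] by simp
  show "(\<integral>\<omega>. (I p F \<omega>) ^ 4 \<partial>P) \<le> 9 ^ p * (\<integral>\<omega>. (I p F \<omega>)\<^sup>2 \<partial>P)\<^sup>2"
    using conjunct2[OF int[OF m[of 4]]] conjunct2[OF int[OF m[of 2]]] chaos_hypercontractive[OF \<xi>] by simp
qed

lemma tensor_span_stein_bound: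
  fixes h :: "real \<Rightarrow> real"
  assumes p: "p \<ge> 1" and q: "q \<ge> 1" and par: "odd (p + q)" and F: "tensor_span p M F" and G: "tensor_span q M G"
    and h: "continuous_on UNIV h" and h01: "\<And>x. 0 \<le> h x" "\<And>x. h x \<le> 1"
  defines "Z \<equiv> \<lambda>\<omega>. I p F \<omega> + I q G \<omega>"
  defines "v \<equiv> (\<integral>\<omega>. (Z \<omega>)\<^sup>2 \<partial>P)"
  shows "\<bar>(\<integral>\<omega>. h (Z \<omega>) \<partial>P) - (\<integral>y. h y \<partial>gauss1)\<bar> \<le> 2 * sqrt ((1 - v)\<^sup>2 + 2/3 * ((\<integral>\<omega>. (Z \<omega>) ^ 4 \<partial>P) - 3 * v\<^sup>2))"
proof -
  obtain n \<xi> \<eta> where \<xi>: "chaos n p \<xi>" and \<eta>: "chaos n q \<eta>" and int: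
    "\<forall>\<psi>. case_prod \<psi> \<in> borel_measurable (borel \<Otimes>\<^sub>M borel) \<longrightarrow>
      (integrable P (\<lambda>\<omega>. \<psi> (I p F \<omega>) (I q G \<omega>) :: real) \<longleftrightarrow> integrable (gauss n) (\<lambda>x. \<psi> (\<xi> x) (\<eta> x))) \<and>
      (\<integral>\<omega>. \<psi> (I p F \<omega>) (I q G \<omega>) \<partial>P) = (\<integral>x. \<psi> (\<xi> x) (\<eta> x) \<partial>gauss n)"
    using tensor_span_law[OF p q F G] by (elim exE conjE)
  note int = conjunct2[OF int[rule_format]]
  have [measurable]: "h \<in> borel_measurable borel" using h by (rule borel_measurable_continuous_onI)
  have m: "case_prod (\<lambda>(x::real) (y::real). (x + y) ^ k) \<in> borel_measurable (borel \<Otimes>\<^sub>M borel)" for k :: nat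
    unfolding case_prod_beta by measurable
  have mh: "case_prod (\<lambda>x y. h (x + y)) \<in> borel_measurable (borel \<Otimes>\<^sub>M borel)"
    unfolding case_prod_beta by measurable
  have par': "0 < p" "0 < q" using p q by auto
  from chaos_sum_stein_bound[OF h h01 \<xi> \<eta> par' par]
  show ?thesis
    unfolding v_def Z_def using int[OF mh] int[OF m[of 2]] int[OF m[of 4]] by simp
qed

lemma approximating_sequence:
  assumes m: "m \<ge> 1" and f: "f \<in> L2_sym m M"
  obtains F where "\<And>n::nat. tensor_span m M (F n)" "\<And>n. (\<lambda>x. f x - F n x) \<in> L2_sym m M"
    "\<And>n. (\<integral>x. (f x - F n x)\<^sup>2 \<partial>power_measure m M) < 1 / real (Suc n)"
    "\<And>n. AE \<omega> in P. I m f \<omega> - I m (F n) \<omega> = I m (\<lambda>x. f x - F n x) \<omega>"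
proof -
  have "\<exists>F. tensor_span m M F \<and> (\<integral>x. (f x - F x)\<^sup>2 \<partial>power_measure m M) < 1 / real (Suc n)" for n
    by (rule tensor_span_dense[OF sf f]) simp
  then obtain F where F: "\<And>n::nat. tensor_span m M (F n)"
    "\<And>n. (\<integral>x. (f x - F n x)\<^sup>2 \<partial>power_measure m M) < 1 / real (Suc n)" by metis
  show thesis
  proof (rule that[OF F(1) _ F(2)])
    fix n
    note FL = tensor_span_L2_sym[OF sf F(1)[of n]]
    show "(\<lambda>x. f x - F n x) \<in> L2_sym m M" using L2_sym_lincomb[OF f FL, of 1 "-1"] by simp
    show "AE \<omega> in P. I m f \<omega> - I m (F n) \<omega> = I m (\<lambda>x. f x - F n x) \<omega>"
      using I_linear[OF m f FL, of 1 "-1"] by eventually_elim simp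
  qed
qed

text \<open>For combinations of tensor powers the bound comes from the polynomial case; Fatou's
  lemma along an almost surely convergent subsequence carries it to all kernels. It provides the
  integrability of Z^4 and the convergence of fourth moments under approximation.\<close>

lemma I_hypercontractive:
  assumes m: "m \<ge> 1"
  obtains D where "0 \<le> D" "\<And>f. f \<in> L2_sym m M \<Longrightarrow> integrable P (\<lambda>\<omega>. (I m f \<omega>) ^ 4)"
    "\<And>f. f \<in> L2_sym m M \<Longrightarrow> (\<integral>\<omega>. (I m f \<omega>) ^ 4 \<partial>P) \<le> D * (\<integral>x. (f x)\<^sup>2 \<partial>power_measure m M)\<^sup>2"
proof -
  let ?N = "power_measure m M"
  obtain C where C: "0 \<le> C" "\<And>f. f \<in> L2_sym m M \<Longrightarrow> (\<integral>\<omega>. (I m f \<omega>)\<^sup>2 \<partial>P) \<le> C * (\<integral>x. (f x)\<^sup>2 \<partial>?N)"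
    using I_bounded[OF m] by blast
  \<comment> \<open>9^m is the polynomial constant, and C bounds the second moment of the integral.
    The 2 comes from bounding the squared norm of \<open>F n\<close> by twice that of f plus twice
    that of the difference.\<close>
  define D where "D = 9 ^ m * (C * 2)\<^sup>2"
  have main: "integrable P (\<lambda>\<omega>. (I m f \<omega>) ^ 4) \<and> (\<integral>\<omega>. (I m f \<omega>) ^ 4 \<partial>P) \<le> D * (\<integral>x. (f x)\<^sup>2 \<partial>?N)\<^sup>2"
    if f: "f \<in> L2_sym m M" for f
  proof -
    obtain F where F: "\<And>n::nat. tensor_span m M (F n)" "\<And>n. (\<lambda>x. f x - F n x) \<in> L2_sym m M"
      "\<And>n. (\<integral>x. (f x - F n x)\<^sup>2 \<partial>?N) < 1 / real (Suc n)"
      "\<And>n. AE \<omega> in P. I m f \<omega> - I m (F n) \<omega> = I m (\<lambda>x. f x - F n x) \<omega>"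
      using approximating_sequence[OF m f] by blast
    define X where "X n = I m (F n)" for n
    define b where "b n = 9 ^ m * (C * (2 * (\<integral>x. (f x)\<^sup>2 \<partial>?N) + 2 * (1 / real (Suc n))))\<^sup>2" for n
    have FL: "F n \<in> L2_sym m M" for n by (rule tensor_span_L2_sym[OF sf F(1)])
    have XL: "X n \<in> L2 P" for n unfolding X_def by (rule I_L2[OF m FL])
    have fL: "I m f \<in> L2 P" by (rule I_L2[OF m f])
    note [measurable] = L2_measurable[OF XL] L2_measurable[OF fL]
    have X4: "integrable P (\<lambda>\<omega>. (X n \<omega>) ^ 4)" "(\<integral>\<omega>. (X n \<omega>) ^ 4 \<partial>P) \<le> b n" for n
    proof -
      show "integrable P (\<lambda>\<omega>. (X n \<omega>) ^ 4)" unfolding X_def by (rule tensor_span_hypercontractive[OF m F(1)])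
      have f2: "f \<in> L2 ?N" "(\<lambda>x. f x - F n x) \<in> L2 ?N" using f F(2)[of n] by (auto simp: L2_sym_def)
      have "(\<integral>x. (F n x)\<^sup>2 \<partial>?N) = (\<integral>x. (f x + (- 1) * (f x - F n x))\<^sup>2 \<partial>?N)" by simp
      also have "\<dots> \<le> 2 * (\<integral>x. (f x)\<^sup>2 \<partial>?N) + 2 * (\<integral>x. ((- 1) * (f x - F n x))\<^sup>2 \<partial>?N)"
        by (intro L2_triangle_sq L2_cmult f2)
      also have "(\<integral>x. ((- 1) * (f x - F n x))\<^sup>2 \<partial>?N) = (\<integral>x. (f x - F n x)\<^sup>2 \<partial>?N)"
        by (simp only: power_mult_distrib) simp
      also have "2 * (\<integral>x. (f x)\<^sup>2 \<partial>?N) + 2 * (\<integral>x. (f x - F n x)\<^sup>2 \<partial>?N) \<le> 2 * (\<integral>x. (f x)\<^sup>2 \<partial>?N) + 2 * (1 / real (Suc n))"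
        using F(3)[of n] by linarith
      finally have "C * (\<integral>x. (F n x)\<^sup>2 \<partial>?N) \<le> C * (2 * (\<integral>x. (f x)\<^sup>2 \<partial>?N) + 2 * (1 / real (Suc n)))"
        by (intro mult_left_mono C(1))
      with C(2)[OF FL[of n]] have "(\<integral>\<omega>. (X n \<omega>)\<^sup>2 \<partial>P) \<le> C * (2 * (\<integral>x. (f x)\<^sup>2 \<partial>?N) + 2 * (1 / real (Suc n)))"
        unfolding X_def by linarith
      then have "9 ^ m * (\<integral>\<omega>. (X n \<omega>)\<^sup>2 \<partial>P)\<^sup>2 \<le> b n"
        unfolding b_def by (intro mult_left_mono power_mono) auto
      then show "(\<integral>\<omega>. (X n \<omega>) ^ 4 \<partial>P) \<le> b n"
        using tensor_span_hypercontractive(2)[OF m F(1)[of n]] unfolding X_def by linarith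
    qed
    have "(\<lambda>n. \<integral>\<omega>. norm ((I m f \<omega> - X n \<omega>)\<^sup>2) \<partial>P) \<longlonglongrightarrow> 0"
    proof (rule tendsto_sandwich[OF _ _ tendsto_const])
      show "\<forall>\<^sub>F n in sequentially. (\<integral>\<omega>. norm ((I m f \<omega> - X n \<omega>)\<^sup>2) \<partial>P) \<le> C * (1 / real (Suc n))"
      proof (intro always_eventually allI)
        fix n
        note [measurable] = L2_measurable[OF I_L2[OF m F(2)[of n]]]
        have "(\<integral>\<omega>. norm ((I m f \<omega> - X n \<omega>)\<^sup>2) \<partial>P) = (\<integral>\<omega>. (I m (\<lambda>x. f x - F n x) \<omega>)\<^sup>2 \<partial>P)"
          unfolding X_def
        proof (rule integral_cong_AE)
          show "AE \<omega> in P. norm ((I m f \<omega> - I m (F n) \<omega>)\<^sup>2) = (I m (\<lambda>x. f x - F n x) \<omega>)\<^sup>2"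
            using F(4)[of n] by eventually_elim simp
        qed (use L2_measurable[OF XL[of n]] in \<open>auto simp: X_def\<close>)
        also have "\<dots> \<le> C * (\<integral>x. (f x - F n x)\<^sup>2 \<partial>?N)" by (rule C(2)[OF F(2)])
        also have "\<dots> \<le> C * (1 / real (Suc n))" using F(3)[of n] by (intro mult_left_mono C(1)) auto
        finally show "(\<integral>\<omega>. norm ((I m f \<omega> - X n \<omega>)\<^sup>2) \<partial>P) \<le> C * (1 / real (Suc n))" .
      qed
      show "(\<lambda>n. C * (1 / real (Suc n))) \<longlonglongrightarrow> 0" by real_asymp
    qed auto
    \<comment> \<open>The squared differences converge to 0 in L1, hence almost surely along a
      subsequence.\<close>
    from tendsto_L1_AE_subseq[OF _ this]
    obtain r :: "nat \<Rightarrow> nat" where r: "strict_mono r" and ae: "AE \<omega> in P. (\<lambda>n. (I m f \<omega> - X (r n) \<omega>)\<^sup>2) \<longlonglongrightarrow> 0"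
      using L2_integrable[OF L2_diff[OF fL XL]] by blast
    have ae4: "AE \<omega> in P. liminf (\<lambda>n. ennreal ((X (r n) \<omega>) ^ 4)) = ennreal ((I m f \<omega>) ^ 4)"
      using ae
    proof eventually_elim
      case (elim \<omega>)
      have "(\<lambda>n. sqrt ((I m f \<omega> - X (r n) \<omega>)\<^sup>2)) \<longlonglongrightarrow> sqrt 0" by (intro tendsto_real_sqrt elim)
      then have "(\<lambda>n. I m f \<omega> - X (r n) \<omega>) \<longlonglongrightarrow> 0" by (simp add: tendsto_rabs_zero_iff)
      from tendsto_diff[OF tendsto_const[of "I m f \<omega>"] this] have "(\<lambda>n. X (r n) \<omega>) \<longlonglongrightarrow> I m f \<omega>" by simp
      then have "(\<lambda>n. ennreal ((X (r n) \<omega>) ^ 4)) \<longlonglongrightarrow> ennreal ((I m f \<omega>) ^ 4)"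
        by (intro tendsto_ennrealI tendsto_power)
      then show ?case by (intro lim_imp_Liminf) auto
    qed
    have blim: "b \<longlonglongrightarrow> D * (\<integral>x. (f x)\<^sup>2 \<partial>?N)\<^sup>2"
    proof -
      have "(\<lambda>n. 1 / real (Suc n)) \<longlonglongrightarrow> 0" by real_asymp
      then have "b \<longlonglongrightarrow> 9 ^ m * (C * (2 * (\<integral>x. (f x)\<^sup>2 \<partial>?N) + 2 * 0))\<^sup>2"
        unfolding b_def by (intro tendsto_intros)
      then show ?thesis by (simp add: D_def power_mult_distrib mult_ac)
    qed
    \<comment> \<open>Fatou's lemma; working with nonnegative integrals yields finiteness of the
      fourth moment together with the bound.\<close>
    have "(\<integral>\<^sup>+\<omega>. ennreal ((I m f \<omega>) ^ 4) \<partial>P) = (\<integral>\<^sup>+\<omega>. liminf (\<lambda>n. ennreal ((X (r n) \<omega>) ^ 4)) \<partial>P)"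
      using ae4 by (intro nn_integral_cong_AE) (auto simp: eq_commute)
    also have "\<dots> \<le> liminf (\<lambda>n. \<integral>\<^sup>+\<omega>. ennreal ((X (r n) \<omega>) ^ 4) \<partial>P)"
      by (intro nn_integral_liminf) measurable
    also have "\<dots> \<le> liminf (\<lambda>n. ennreal (b (r n)))"
    proof (intro Liminf_mono always_eventually allI)
      fix n
      have "(\<integral>\<^sup>+\<omega>. ennreal ((X (r n) \<omega>) ^ 4) \<partial>P) = ennreal (\<integral>\<omega>. (X (r n) \<omega>) ^ 4 \<partial>P)"
        by (intro nn_integral_eq_integral X4) auto
      then show "(\<integral>\<^sup>+\<omega>. ennreal ((X (r n) \<omega>) ^ 4) \<partial>P) \<le> ennreal (b (r n))"
        using X4(2) by (simp add: ennreal_leI)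
    qed
    also have "\<dots> = ennreal (D * (\<integral>x. (f x)\<^sup>2 \<partial>?N)\<^sup>2)"
      using LIMSEQ_subseq_LIMSEQ[OF blim r] by (intro lim_imp_Liminf tendsto_ennrealI) (auto simp: o_def)
    finally have fin: "(\<integral>\<^sup>+\<omega>. ennreal ((I m f \<omega>) ^ 4) \<partial>P) \<le> ennreal (D * (\<integral>x. (f x)\<^sup>2 \<partial>?N)\<^sup>2)" .
    have int: "integrable P (\<lambda>\<omega>. (I m f \<omega>) ^ 4)"
      using le_less_trans[OF fin] by (intro integrableI_nonneg) auto
    moreover have "ennreal (\<integral>\<omega>. (I m f \<omega>) ^ 4 \<partial>P) \<le> ennreal (D * (\<integral>x. (f x)\<^sup>2 \<partial>?N)\<^sup>2)"
      using fin int by (simp add: nn_integral_eq_integral)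
    moreover have "0 \<le> D * (\<integral>x. (f x)\<^sup>2 \<partial>?N)\<^sup>2" by (simp add: D_def)
    ultimately show ?thesis by (simp add: ennreal_le_iff)
  qed
  show thesis by (rule that[of D]) (use main in \<open>auto simp: D_def\<close>)
qed

end

subsection \<open>Total variation distance\<close>

lemma Lipschitz_abs_continuous:
  fixes h :: "real \<Rightarrow> real"
  assumes h: "\<And>x y. \<bar>h x - h y\<bar> \<le> L * \<bar>x - y\<bar>"
  shows "continuous_on UNIV h"
proof (rule lipschitz_on_continuous_on)
  have "0 \<le> L" using h[of 0 1] by (simp add: order_trans[OF abs_ge_zero])
  then show "L-lipschitz_on UNIV h" using h by (intro lipschitz_onI) (auto simp: dist_real_def)
qed

text \<open>The bound \<open>d\<close> does not depend on the Lipschitz constant. So it passes to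
  indicators of closed sets, which are limits of steeper and steeper Lipschitz functions, and from
  there to Borel sets by inner regularity.\<close>

lemma tv_dist_le_Lipschitz:
  fixes \<mu> \<nu> :: "real measure"
  assumes "real_distribution \<mu>" "real_distribution \<nu>"
    and le: "\<And>h L. (\<And>x y. \<bar>h x - h y\<bar> \<le> L * \<bar>x - y\<bar>) \<Longrightarrow> (\<And>x. 0 \<le> h x) \<Longrightarrow> (\<And>x. h x \<le> (1::real)) \<Longrightarrow>
      \<bar>(\<integral>x. h x \<partial>\<mu>) - (\<integral>x. h x \<partial>\<nu>)\<bar> \<le> d"
  shows "tv_dist \<mu> \<nu> \<le> d"
proof -
  interpret m: real_distribution \<mu> by fact
  interpret n: real_distribution \<nu> by fact
  have closed: "\<bar>measure \<mu> K - measure \<nu> K\<bar> \<le> d" if K: "closed K" for K :: "real set"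
  proof (cases "K = {}")
    case True
    \<comment> \<open>The empty set is separate because \<open>infdist\<close> to it is 0 by
      convention, so that the functions below would be constantly 1.\<close>
    then show ?thesis using le[of "\<lambda>_. 0" 0] by simp
  next
    case False
    \<comment> \<open>The function falls from 1 on K to 0 at distance 1/k; closedness of K makes
      these functions converge to its indicator.\<close>
    define h where "h k x = max 0 (1 - real k * infdist x K)" for k x
    have lip: "\<bar>h k x - h k y\<bar> \<le> real k * \<bar>x - y\<bar>" for k x y
    proof -
      have "\<bar>h k x - h k y\<bar> \<le> \<bar>real k * infdist x K - real k * infdist y K\<bar>"
        unfolding h_def by (auto simp: max_def)
      also have "\<dots> = real k * \<bar>infdist x K - infdist y K\<bar>"
        by (simp add: right_diff_distrib[symmetric] abs_mult)
      also have "\<dots> \<le> real k * \<bar>x - y\<bar>"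
        using infdist_triangle_abs[of x K y] by (intro mult_left_mono) (auto simp: dist_real_def)
      finally show ?thesis .
    qed
    have h0: "0 \<le> h k x" and h1: "h k x \<le> 1" for k x
      by (auto simp: h_def infdist_nonneg)
    have hm[measurable]: "h k \<in> borel_measurable borel" for k
      unfolding h_def[abs_def] by (intro borel_measurable_continuous_onI continuous_intros)
    have lim: "(\<lambda>k. h k x) \<longlonglongrightarrow> indicator K x" for x
    proof (cases "x \<in> K")
      case True
      then show ?thesis by (simp add: h_def)
    next
      case out: False
      then have i: "infdist x K > 0"
        using in_closed_iff_infdist_zero[OF K False, of x] infdist_nonneg[of x K] by simp
      obtain k0 :: nat where k0: "1 / infdist x K < real k0" using reals_Archimedean2 by blast
      have "\<forall>\<^sub>F k in sequentially. h k x = indicator K x"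
      proof (rule eventually_mono[OF eventually_ge_at_top[of k0]])
        fix k assume "k0 \<le> k"
        then have "1 / infdist x K < real k" using k0 by linarith
        then have "1 < real k * infdist x K" using i by (simp add: field_simps)
        then show "h k x = indicator K x" using out by (simp add: h_def)
      qed
      then show ?thesis by (rule tendsto_eventually)
    qed
    have conv: "(\<lambda>k. \<integral>x. h k x \<partial>\<rho>) \<longlonglongrightarrow> measure \<rho> K" if "real_distribution \<rho>" for \<rho>
    proof -
      interpret r: real_distribution \<rho> by fact
      have "(\<lambda>k. \<integral>x. h k x \<partial>\<rho>) \<longlonglongrightarrow> (\<integral>x. indicator K x \<partial>\<rho>)"
        by (rule integral_dominated_convergence[where w = "\<lambda>_. 1"]) (use K lim h0 h1 in auto)
      then show ?thesis using K by simp
    qed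
    have "(\<lambda>k. \<bar>(\<integral>x. h k x \<partial>\<mu>) - (\<integral>x. h k x \<partial>\<nu>)\<bar>) \<longlonglongrightarrow> \<bar>measure \<mu> K - measure \<nu> K\<bar>"
      by (intro tendsto_rabs tendsto_diff conv assms)
    then show ?thesis
      by (rule LIMSEQ_le_const2) (use le[OF lip h0 h1] in auto)
  qed
  have inner: "\<exists>K. compact K \<and> K \<subseteq> B \<and> measure \<rho> B < measure \<rho> K + e"
    if \<rho>: "real_distribution \<rho>" and B: "B \<in> sets borel" and e: "0 < e" for \<rho> B and e :: real
  proof -
    interpret r: real_distribution \<rho> by fact
    have sup: "emeasure \<rho> B = (SUP K\<in>{K. K \<subseteq> B \<and> compact K}. emeasure \<rho> K)"
      using B by (intro inner_regular) (auto simp: r.emeasure_eq_measure)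
    show ?thesis
    proof (cases "measure \<rho> B - e < 0")
      case True
      then show ?thesis by (intro exI[of _ "{}"]) auto
    next
      case False
      then have "ennreal (measure \<rho> B - e) < emeasure \<rho> B"
        using e by (simp add: r.emeasure_eq_measure ennreal_less_iff)
      then obtain K where K: "K \<subseteq> B" "compact K" "ennreal (measure \<rho> B - e) < emeasure \<rho> K"
        unfolding sup less_SUP_iff by auto
      then have "measure \<rho> B - e < measure \<rho> K"
        using False by (simp add: r.emeasure_eq_measure ennreal_less_iff)
      then show ?thesis using K by (intro exI[of _ K]) auto
    qed
  qed
  \<comment> \<open>One-sided: B is approximated from inside only for \<rho>, while monotonicity
    suffices for \<sigma>. Exchanging the two measures gives the other sign.\<close>
  have half: "measure \<rho> B - measure \<sigma> B \<le> d"
    if \<rho>: "real_distribution \<rho>" and \<sigma>: "real_distribution \<sigma>" and B: "B \<in> sets borel"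
      and c: "\<And>K. closed K \<Longrightarrow> measure \<rho> K - measure \<sigma> K \<le> d" for \<rho> \<sigma> B
  proof (rule field_le_epsilon)
    fix e :: real assume e: "0 < e"
    interpret r: real_distribution \<rho> by fact
    interpret s: real_distribution \<sigma> by fact
    obtain K1 where K1: "compact K1" "K1 \<subseteq> B" "measure \<rho> B < measure \<rho> K1 + e" using inner[OF \<rho> B e] by blast
    have "measure \<sigma> K1 \<le> measure \<sigma> B" using K1 B by (intro s.finite_measure_mono) auto
    with K1(3) c[OF compact_imp_closed[OF K1(1)]] show "measure \<rho> B - measure \<sigma> B \<le> d + e" by linarith
  qed
  show ?thesis
    unfolding tv_dist_def
  proof (rule cSUP_least)
    fix B :: "real set" assume B: "B \<in> sets borel"
    have "measure \<mu> B - measure \<nu> B \<le> d"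
      by (rule half[OF assms(1,2) B]) (use closed in \<open>auto simp: abs_le_iff\<close>)
    moreover have "measure \<nu> B - measure \<mu> B \<le> d"
      by (rule half[OF assms(2,1) B]) (use closed in \<open>auto simp: abs_le_iff\<close>)
    ultimately show "\<bar>measure \<mu> B - measure \<nu> B\<bar> \<le> d" by linarith
  qed auto
qed

lemma tv_dist_nonneg:
  assumes "real_distribution \<mu>" "real_distribution \<nu>"
  shows "0 \<le> tv_dist \<mu> \<nu>"
proof -
  interpret m: real_distribution \<mu> by fact
  interpret n: real_distribution \<nu> by fact
  have "\<bar>measure \<mu> B - measure \<nu> B\<bar> \<le> 1" for B
    using m.prob_le_1[of B] n.prob_le_1[of B] measure_nonneg[of \<mu> B] measure_nonneg[of \<nu> B] by linarith
  then have "bdd_above ((\<lambda>B. \<bar>measure \<mu> B - measure \<nu> B\<bar>) ` sets borel)" by (intro bdd_aboveI2)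
  from cSUP_upper[OF _ this, of "{}"] show ?thesis by (simp add: tv_dist_def)
qed

section \<open>From combinations of tensor powers to general kernels\<close>

lemma power2_add_le:
  fixes a b s :: real
  assumes s: "0 < s"
  shows "(a + b)\<^sup>2 \<le> (1 + s) * a\<^sup>2 + (1 + 1 / s) * b\<^sup>2"
proof -
  have "0 \<le> (s * a - b)\<^sup>2 / s" using s by simp
  also have "(s * a - b)\<^sup>2 / s = s * a\<^sup>2 - 2 * a * b + b\<^sup>2 / s"
    using s by (simp add: power2_eq_square field_simps)
  finally show ?thesis by (simp add: power2_eq_square algebra_simps)
qed

text \<open>The weighted square inequality used twice. For small s the coefficient of a^4 is close
  to 1, at the price of a large coefficient for the error b^4, which vanishes in the limit taken
  before s tends to 0.\<close>

lemma power4_add_le: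
  fixes a b s :: real
  assumes s: "0 < s"
  shows "(a + b) ^ 4 \<le> (1 + s) ^ 3 * a ^ 4 + (1 + 1 / s) ^ 3 * b ^ 4"
proof -
  have "(a + b) ^ 4 = ((a + b)\<^sup>2)\<^sup>2" by simp
  also have "\<dots> \<le> ((1 + s) * a\<^sup>2 + (1 + 1 / s) * b\<^sup>2)\<^sup>2"
    by (intro power_mono power2_add_le s) simp
  also have "\<dots> \<le> (1 + s) * ((1 + s) * a\<^sup>2)\<^sup>2 + (1 + 1 / s) * ((1 + 1 / s) * b\<^sup>2)\<^sup>2"
    by (rule power2_add_le[OF s])
  also have "\<dots> = (1 + s) ^ 3 * a ^ 4 + (1 + 1 / s) ^ 3 * b ^ 4"
    by (simp add: power_mult_distrib power3_eq_cube power2_eq_square power4_eq_xxxx mult_ac)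
  finally show ?thesis .
qed

context wiener_chaos
begin

lemma integrable_sq_of_power4:
  assumes [measurable]: "X \<in> borel_measurable P" and X: "integrable P (\<lambda>\<omega>. (X \<omega>) ^ 4)"
  shows "X \<in> L2 P"
proof -
  have "integrable P (\<lambda>\<omega>. (X \<omega>)\<^sup>2)"
  proof (rule Bochner_Integration.integrable_bound)
    show "integrable P (\<lambda>\<omega>. 1 + (X \<omega>) ^ 4)" using X by simp
    have "(X \<omega>)\<^sup>2 \<le> 1 + (X \<omega>) ^ 4" for \<omega>
    proof -
      have "2 * (X \<omega>)\<^sup>2 \<le> 1 + (X \<omega>) ^ 4" using sum_squares_bound[of 1 "(X \<omega>)\<^sup>2"] by simp
      moreover have "0 \<le> (X \<omega>)\<^sup>2" by simp
      ultimately show ?thesis by linarith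
    qed
    then show "AE \<omega> in P. norm ((X \<omega>)\<^sup>2) \<le> norm (1 + (X \<omega>) ^ 4)" by simp
  qed simp
  then show ?thesis by (simp add: L2_def)
qed

text \<open>The error \<open>R n\<close> is the exact pointwise difference; almost surely it equals
  minus the sum of the integrals of the two kernel errors. Boundedness controls its second moment
  and hypercontractivity its fourth.\<close>

lemma wiener_sum_approximation:
  assumes p: "p \<ge> 1" and q: "q \<ge> 1" and f: "f \<in> L2_sym p M" and g: "g \<in> L2_sym q M"
  defines "Z \<equiv> \<lambda>\<omega>. I p f \<omega> + I q g \<omega>"
  shows "Z \<in> borel_measurable P" "integrable P (\<lambda>\<omega>. (Z \<omega>) ^ 4)"
    and "\<exists>F G R. (\<forall>n::nat. tensor_span p M (F n) \<and> tensor_span q M (G n)) \<and>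
      (\<forall>n \<omega>. I p (F n) \<omega> + I q (G n) \<omega> = Z \<omega> + R n \<omega>) \<and>
      (\<forall>n. R n \<in> borel_measurable P \<and> integrable P (\<lambda>\<omega>. (R n \<omega>) ^ 4)) \<and>
      (\<lambda>n. \<integral>\<omega>. (R n \<omega>)\<^sup>2 \<partial>P) \<longlonglongrightarrow> 0 \<and> (\<lambda>n. \<integral>\<omega>. (R n \<omega>) ^ 4 \<partial>P) \<longlonglongrightarrow> 0"
proof -
  have add4: "integrable P (\<lambda>\<omega>. (A \<omega> + B \<omega>) ^ 4)" "(\<integral>\<omega>. (A \<omega> + B \<omega>) ^ 4 \<partial>P) \<le> 8 * (\<integral>\<omega>. (A \<omega>) ^ 4 \<partial>P) + 8 * (\<integral>\<omega>. (B \<omega>) ^ 4 \<partial>P)"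
    if A: "A \<in> borel_measurable P" "integrable P (\<lambda>\<omega>. (A \<omega>) ^ 4)" and B: "B \<in> borel_measurable P" "integrable P (\<lambda>\<omega>. (B \<omega>) ^ 4)"
    for A B :: "'w \<Rightarrow> real"
  proof -
    note [measurable] = A(1) B(1)
    have le: "(A \<omega> + B \<omega>) ^ 4 \<le> 8 * (A \<omega>) ^ 4 + 8 * (B \<omega>) ^ 4" for \<omega>
      using power4_add_le[of 1 "A \<omega>" "B \<omega>"] by simp
    have int: "integrable P (\<lambda>\<omega>. 8 * (A \<omega>) ^ 4 + 8 * (B \<omega>) ^ 4)" using A B by simp
    show i: "integrable P (\<lambda>\<omega>. (A \<omega> + B \<omega>) ^ 4)"
      by (rule Bochner_Integration.integrable_bound[OF int]) (use le in \<open>auto intro: order_trans[OF _ abs_ge_self]\<close>)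
    have "(\<integral>\<omega>. (A \<omega> + B \<omega>) ^ 4 \<partial>P) \<le> (\<integral>\<omega>. 8 * (A \<omega>) ^ 4 + 8 * (B \<omega>) ^ 4 \<partial>P)"
      by (intro integral_mono i int le)
    then show "(\<integral>\<omega>. (A \<omega> + B \<omega>) ^ 4 \<partial>P) \<le> 8 * (\<integral>\<omega>. (A \<omega>) ^ 4 \<partial>P) + 8 * (\<integral>\<omega>. (B \<omega>) ^ 4 \<partial>P)"
      using A B by simp
  qed
  obtain C1 where C1: "0 \<le> C1" "\<And>f. f \<in> L2_sym p M \<Longrightarrow> (\<integral>\<omega>. (I p f \<omega>)\<^sup>2 \<partial>P) \<le> C1 * (\<integral>x. (f x)\<^sup>2 \<partial>power_measure p M)"
    using I_bounded[OF p] by blast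
  obtain C2 where C2: "0 \<le> C2" "\<And>f. f \<in> L2_sym q M \<Longrightarrow> (\<integral>\<omega>. (I q f \<omega>)\<^sup>2 \<partial>P) \<le> C2 * (\<integral>x. (f x)\<^sup>2 \<partial>power_measure q M)"
    using I_bounded[OF q] by blast
  obtain D1 where D1: "0 \<le> D1" "\<And>f. f \<in> L2_sym p M \<Longrightarrow> integrable P (\<lambda>\<omega>. (I p f \<omega>) ^ 4)"
    "\<And>f. f \<in> L2_sym p M \<Longrightarrow> (\<integral>\<omega>. (I p f \<omega>) ^ 4 \<partial>P) \<le> D1 * (\<integral>x. (f x)\<^sup>2 \<partial>power_measure p M)\<^sup>2"
    using I_hypercontractive[OF p] by blast
  obtain D2 where D2: "0 \<le> D2" "\<And>f. f \<in> L2_sym q M \<Longrightarrow> integrable P (\<lambda>\<omega>. (I q f \<omega>) ^ 4)"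
    "\<And>f. f \<in> L2_sym q M \<Longrightarrow> (\<integral>\<omega>. (I q f \<omega>) ^ 4 \<partial>P) \<le> D2 * (\<integral>x. (f x)\<^sup>2 \<partial>power_measure q M)\<^sup>2"
    using I_hypercontractive[OF q] by blast
  obtain F where F: "\<And>n::nat. tensor_span p M (F n)" "\<And>n. (\<lambda>x. f x - F n x) \<in> L2_sym p M"
    "\<And>n. (\<integral>x. (f x - F n x)\<^sup>2 \<partial>power_measure p M) < 1 / real (Suc n)"
    "\<And>n. AE \<omega> in P. I p f \<omega> - I p (F n) \<omega> = I p (\<lambda>x. f x - F n x) \<omega>"
    using approximating_sequence[OF p f] by blast
  obtain G where G: "\<And>n::nat. tensor_span q M (G n)" "\<And>n. (\<lambda>x. g x - G n x) \<in> L2_sym q M"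
    "\<And>n. (\<integral>x. (g x - G n x)\<^sup>2 \<partial>power_measure q M) < 1 / real (Suc n)"
    "\<And>n. AE \<omega> in P. I q g \<omega> - I q (G n) \<omega> = I q (\<lambda>x. g x - G n x) \<omega>"
    using approximating_sequence[OF q g] by blast
  note Xm[measurable] = L2_measurable[OF I_L2[OF p f]] and Ym[measurable] = L2_measurable[OF I_L2[OF q g]]
  show "Z \<in> borel_measurable P" unfolding Z_def by measurable
  show "integrable P (\<lambda>\<omega>. (Z \<omega>) ^ 4)" unfolding Z_def by (intro add4(1) Xm Ym D1(2) D2(2) f g)
  define R where "R n \<omega> = (I p (F n) \<omega> + I q (G n) \<omega>) - Z \<omega>" for n \<omega>
  define A where "A n = I p (\<lambda>x. f x - F n x)" for n
  define B where "B n = I q (\<lambda>x. g x - G n x)" for n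
  have AL: "A n \<in> L2 P" and BL: "B n \<in> L2 P" for n
    unfolding A_def B_def by (intro I_L2 p q F G)+
  note Am[measurable] = L2_measurable[OF AL] and Bm[measurable] = L2_measurable[OF BL]
  have FXm[measurable]: "I p (F n) \<in> borel_measurable P" "I q (G n) \<in> borel_measurable P" for n
    by (intro L2_measurable[OF I_L2] p q tensor_span_L2_sym[OF sf] F G)+
  have Rm[measurable]: "R n \<in> borel_measurable P" for n unfolding R_def[abs_def] Z_def by measurable
  have ae: "AE \<omega> in P. R n \<omega> = - (A n \<omega> + B n \<omega>)" for n
    using F(4)[of n] G(4)[of n] by eventually_elim (simp add: R_def Z_def A_def B_def)
  have R2: "(\<integral>\<omega>. (R n \<omega>)\<^sup>2 \<partial>P) = (\<integral>\<omega>. (A n \<omega> + B n \<omega>)\<^sup>2 \<partial>P)" for n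
  proof (rule integral_cong_AE)
    show "AE \<omega> in P. (R n \<omega>)\<^sup>2 = (A n \<omega> + B n \<omega>)\<^sup>2"
      using ae[of n] by eventually_elim (simp only: power2_minus)
  qed measurable
  have ae4: "AE \<omega> in P. (R n \<omega>) ^ 4 = (A n \<omega> + B n \<omega>) ^ 4" for n
    using ae[of n] by eventually_elim (simp only: power_minus_even even_numeral)
  have R4: "(\<integral>\<omega>. (R n \<omega>) ^ 4 \<partial>P) = (\<integral>\<omega>. (A n \<omega> + B n \<omega>) ^ 4 \<partial>P)" for n
    by (intro integral_cong_AE ae4) measurable
  have A4: "integrable P (\<lambda>\<omega>. (A n \<omega>) ^ 4)" and B4: "integrable P (\<lambda>\<omega>. (B n \<omega>) ^ 4)" for n
    unfolding A_def B_def by (intro D1 D2 F G)+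
  have R4i: "integrable P (\<lambda>\<omega>. (R n \<omega>) ^ 4)" for n
    using integrable_cong_AE[OF _ _ ae4[of n]] add4(1)[OF Am A4 Bm B4] by simp
  have lim2: "(\<lambda>n. \<integral>\<omega>. (R n \<omega>)\<^sup>2 \<partial>P) \<longlonglongrightarrow> 0"
  proof (rule tendsto_sandwich[OF _ _ tendsto_const])
    show "\<forall>\<^sub>F n in sequentially. (\<integral>\<omega>. (R n \<omega>)\<^sup>2 \<partial>P) \<le> (2 * C1 + 2 * C2) * (1 / real (Suc n))"
    proof (intro always_eventually allI)
      fix n
      have "(\<integral>\<omega>. (A n \<omega>)\<^sup>2 \<partial>P) \<le> C1 * (1 / real (Suc n))"
        unfolding A_def using order_trans[OF C1(2)[OF F(2)] mult_left_mono[OF less_imp_le[OF F(3)] C1(1)]] .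
      moreover have "(\<integral>\<omega>. (B n \<omega>)\<^sup>2 \<partial>P) \<le> C2 * (1 / real (Suc n))"
        unfolding B_def using order_trans[OF C2(2)[OF G(2)] mult_left_mono[OF less_imp_le[OF G(3)] C2(1)]] .
      ultimately show "(\<integral>\<omega>. (R n \<omega>)\<^sup>2 \<partial>P) \<le> (2 * C1 + 2 * C2) * (1 / real (Suc n))"
        unfolding R2 distrib_right using L2_triangle_sq[OF AL[of n] BL[of n]] by linarith
    qed
    show "(\<lambda>n. (2 * C1 + 2 * C2) * (1 / real (Suc n))) \<longlonglongrightarrow> 0" by real_asymp
  qed auto
  have lim4: "(\<lambda>n. \<integral>\<omega>. (R n \<omega>) ^ 4 \<partial>P) \<longlonglongrightarrow> 0"
  proof (rule tendsto_sandwich[OF _ _ tendsto_const])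
    show "\<forall>\<^sub>F n in sequentially. (\<integral>\<omega>. (R n \<omega>) ^ 4 \<partial>P) \<le> (8 * D1 + 8 * D2) * (1 / real (Suc n))\<^sup>2"
    proof (intro always_eventually allI)
      fix n
      have "(\<integral>\<omega>. (A n \<omega>) ^ 4 \<partial>P) \<le> D1 * (1 / real (Suc n))\<^sup>2"
        unfolding A_def
        by (rule order_trans[OF D1(3)[OF F(2)] mult_left_mono[OF power_mono[OF less_imp_le[OF F(3)]] D1(1)]]) simp
      moreover have "(\<integral>\<omega>. (B n \<omega>) ^ 4 \<partial>P) \<le> D2 * (1 / real (Suc n))\<^sup>2"
        unfolding B_def
        by (rule order_trans[OF D2(3)[OF G(2)] mult_left_mono[OF power_mono[OF less_imp_le[OF G(3)]] D2(1)]]) simp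
      ultimately show "(\<integral>\<omega>. (R n \<omega>) ^ 4 \<partial>P) \<le> (8 * D1 + 8 * D2) * (1 / real (Suc n))\<^sup>2"
        unfolding R4 distrib_right using add4(2)[OF Am A4 Bm B4, of n n] by linarith
    qed
    show "(\<lambda>n. (8 * D1 + 8 * D2) * (1 / real (Suc n))\<^sup>2) \<longlonglongrightarrow> 0" by real_asymp
  qed auto
  show "\<exists>F G R. (\<forall>n::nat. tensor_span p M (F n) \<and> tensor_span q M (G n)) \<and>
      (\<forall>n \<omega>. I p (F n) \<omega> + I q (G n) \<omega> = Z \<omega> + R n \<omega>) \<and>
      (\<forall>n. R n \<in> borel_measurable P \<and> integrable P (\<lambda>\<omega>. (R n \<omega>) ^ 4)) \<and>
      (\<lambda>n. \<integral>\<omega>. (R n \<omega>)\<^sup>2 \<partial>P) \<longlonglongrightarrow> 0 \<and> (\<lambda>n. \<integral>\<omega>. (R n \<omega>) ^ 4 \<partial>P) \<longlonglongrightarrow> 0"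
    using F(1) G(1) Rm R4i lim2 lim4
    by (intro exI[of _ F] exI[of _ G] exI[of _ R]) (simp add: R_def)
qed

text \<open>The bound for approximants Y_n = Z + R_n is passed to the limit: v_n tends to 1, the
  Lipschitz property gives the convergence of E h(Y_n), and for the fourth moments an upper estimate
  suffices. L enters only the speed of convergence, so the final bound is free of it.\<close>

lemma wiener_sum_Lipschitz_bound:
  fixes h :: "real \<Rightarrow> real"
  assumes p: "p \<ge> 1" and q: "q \<ge> 1" and par: "odd (p + q)" and f: "f \<in> L2_sym p M" and g: "g \<in> L2_sym q M"
    and h: "\<And>x y. \<bar>h x - h y\<bar> \<le> L * \<bar>x - y\<bar>" and h01: "\<And>x. 0 \<le> h x" "\<And>x. h x \<le> 1"
  defines "Z \<equiv> \<lambda>\<omega>. I p f \<omega> + I q g \<omega>"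
  assumes Z1: "(\<integral>\<omega>. (Z \<omega>)\<^sup>2 \<partial>P) = 1"
  shows "\<bar>(\<integral>\<omega>. h (Z \<omega>) \<partial>P) - (\<integral>y. h y \<partial>gauss1)\<bar> \<le> 2 * sqrt (2/3 * ((\<integral>\<omega>. (Z \<omega>) ^ 4 \<partial>P) - 3))"
proof -
  note app = wiener_sum_approximation[OF p q f g, folded Z_def]
  have Zm[measurable]: "Z \<in> borel_measurable P" and Z4: "integrable P (\<lambda>\<omega>. (Z \<omega>) ^ 4)"
    using app(1,2) by (auto simp: Z_def)
  from app(3) obtain F G R where FG: "\<forall>n::nat. tensor_span p M (F n) \<and> tensor_span q M (G n)"
    and YR: "\<forall>n \<omega>. I p (F n) \<omega> + I q (G n) \<omega> = Z \<omega> + R n \<omega>"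
    and RR: "\<forall>n. R n \<in> borel_measurable P \<and> integrable P (\<lambda>\<omega>. (R n \<omega>) ^ 4)"
    and lim2: "(\<lambda>n. \<integral>\<omega>. (R n \<omega>)\<^sup>2 \<partial>P) \<longlonglongrightarrow> 0" and lim4: "(\<lambda>n. \<integral>\<omega>. (R n \<omega>) ^ 4 \<partial>P) \<longlonglongrightarrow> 0"
    unfolding Z_def by (elim exE conjE)
  note FG = conjunct1[OF FG[rule_format]] conjunct2[OF FG[rule_format]]
  define Y where "Y n \<omega> = I p (F n) \<omega> + I q (G n) \<omega>" for n \<omega>
  have Rm[measurable]: "R n \<in> borel_measurable P" and R4: "integrable P (\<lambda>\<omega>. (R n \<omega>) ^ 4)" for n
    using RR by auto
  have Y: "Y n = (\<lambda>\<omega>. Z \<omega> + R n \<omega>)" for n unfolding Y_def using YR by blast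
  have ZL: "Z \<in> L2 P" and RL: "R n \<in> L2 P" for n
    by (intro integrable_sq_of_power4 Zm Rm Z4 R4)+
  have iZR: "integrable P (\<lambda>\<omega>. Z \<omega> * R n \<omega>)" for n
    by (intro integrable_mult_L2 L2_integrable ZL RL) measurable
  define v where "v n = (\<integral>\<omega>. (Y n \<omega>)\<^sup>2 \<partial>P)" for n
  have v_eq: "v n = 1 + 2 * (\<integral>\<omega>. Z \<omega> * R n \<omega> \<partial>P) + (\<integral>\<omega>. (R n \<omega>)\<^sup>2 \<partial>P)" for n
  proof -
    have "v n = (\<integral>\<omega>. (Z \<omega>)\<^sup>2 + 2 * (Z \<omega> * R n \<omega>) + (R n \<omega>)\<^sup>2 \<partial>P)"
      unfolding v_def Y by (simp add: power2_eq_square algebra_simps)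
    then show ?thesis using L2_integrable[OF ZL] L2_integrable[OF RL[of n]] iZR[of n] by (simp add: Z1)
  qed
  have sq: "(\<lambda>n. sqrt (\<integral>\<omega>. (R n \<omega>)\<^sup>2 \<partial>P)) \<longlonglongrightarrow> 0"
    using tendsto_real_sqrt[OF lim2] by simp
  have ZR0: "(\<lambda>n. \<integral>\<omega>. Z \<omega> * R n \<omega> \<partial>P) \<longlonglongrightarrow> 0"
  proof (rule Lim_null_comparison[OF _ sq])
    show "\<forall>\<^sub>F n in sequentially. norm (\<integral>\<omega>. Z \<omega> * R n \<omega> \<partial>P) \<le> sqrt (\<integral>\<omega>. (R n \<omega>)\<^sup>2 \<partial>P)"
    proof (intro always_eventually allI)
      fix n
      have "(\<integral>\<omega>. Z \<omega> * R n \<omega> \<partial>P)\<^sup>2 \<le> (\<integral>\<omega>. (Z \<omega>)\<^sup>2 \<partial>P) * (\<integral>\<omega>. (R n \<omega>)\<^sup>2 \<partial>P)"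
        by (intro Cauchy_Schwarz_integral L2_integrable ZL RL) measurable
      then show "norm (\<integral>\<omega>. Z \<omega> * R n \<omega> \<partial>P) \<le> sqrt (\<integral>\<omega>. (R n \<omega>)\<^sup>2 \<partial>P)"
        using real_sqrt_le_mono by (fastforce simp: Z1)
    qed
  qed
  have vlim: "v \<longlonglongrightarrow> 1"
  proof -
    have "(\<lambda>n. 1 + 2 * (\<integral>\<omega>. Z \<omega> * R n \<omega> \<partial>P) + (\<integral>\<omega>. (R n \<omega>)\<^sup>2 \<partial>P)) \<longlonglongrightarrow> 1 + 2 * 0 + 0"
      by (intro tendsto_intros ZR0 lim2)
    then show ?thesis by (simp add: v_eq[abs_def])
  qed
  have L0: "0 \<le> L" using h[of 0 1] by (simp add: order_trans[OF abs_ge_zero])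
  have hc: "continuous_on UNIV h" by (rule Lipschitz_abs_continuous[OF h])
  have [measurable]: "h \<in> borel_measurable borel" by (rule borel_measurable_continuous_onI[OF hc])
  have hlim: "(\<lambda>n. \<integral>\<omega>. h (Y n \<omega>) \<partial>P) \<longlonglongrightarrow> (\<integral>\<omega>. h (Z \<omega>) \<partial>P)"
  proof (rule LIM_zero_cancel, rule Lim_null_comparison)
    show "(\<lambda>n. L * sqrt (\<integral>\<omega>. (R n \<omega>)\<^sup>2 \<partial>P)) \<longlonglongrightarrow> 0"
      using tendsto_mult[OF tendsto_const sq, of L] by simp
    show "\<forall>\<^sub>F n in sequentially. norm ((\<integral>\<omega>. h (Y n \<omega>) \<partial>P) - (\<integral>\<omega>. h (Z \<omega>) \<partial>P)) \<le> L * sqrt (\<integral>\<omega>. (R n \<omega>)\<^sup>2 \<partial>P)"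
    proof (intro always_eventually allI)
      fix n
      have ih: "integrable P (\<lambda>\<omega>. h (V \<omega>))" if "V \<in> borel_measurable P" for V
        using that h01 by (intro integrable_const_bound[of _ 1]) auto
      have Ym: "Y n \<in> borel_measurable P" unfolding Y by measurable
      have iR: "integrable P (\<lambda>\<omega>. \<bar>R n \<omega>\<bar>)"
        using integrable_mult_L2[of "R n" P "\<lambda>_. 1"] L2_integrable[OF RL[of n]] by simp
      have "norm ((\<integral>\<omega>. h (Y n \<omega>) \<partial>P) - (\<integral>\<omega>. h (Z \<omega>) \<partial>P)) = \<bar>\<integral>\<omega>. h (Y n \<omega>) - h (Z \<omega>) \<partial>P\<bar>"
        using ih[OF Ym] ih[OF Zm] by simp
      also have "\<dots> \<le> (\<integral>\<omega>. \<bar>h (Y n \<omega>) - h (Z \<omega>)\<bar> \<partial>P)" by (rule integral_abs_bound)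
      also have "\<dots> \<le> (\<integral>\<omega>. L * \<bar>R n \<omega>\<bar> \<partial>P)"
        using ih[OF Ym] ih[OF Zm] iR h[of "Z \<omega> + R n \<omega>" "Z \<omega>" for \<omega>] by (intro integral_mono) (auto simp: Y)
      also have "\<dots> = L * (\<integral>\<omega>. \<bar>R n \<omega>\<bar> * 1 \<partial>P)" by simp
      also have "\<dots> \<le> L * sqrt (\<integral>\<omega>. (R n \<omega>)\<^sup>2 \<partial>P)"
      proof (intro mult_left_mono L0 real_le_rsqrt)
        have "(\<integral>\<omega>. \<bar>R n \<omega>\<bar> * 1 \<partial>P)\<^sup>2 \<le> (\<integral>\<omega>. \<bar>R n \<omega>\<bar>\<^sup>2 \<partial>P) * (\<integral>\<omega>. 1\<^sup>2 \<partial>P)"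
          by (rule Cauchy_Schwarz_integral) (use L2_integrable[OF RL[of n]] in auto)
        then show "(\<integral>\<omega>. \<bar>R n \<omega>\<bar> * 1 \<partial>P)\<^sup>2 \<le> (\<integral>\<omega>. (R n \<omega>)\<^sup>2 \<partial>P)" by (simp add: prob_space)
      qed
      finally show "norm ((\<integral>\<omega>. h (Y n \<omega>) \<partial>P) - (\<integral>\<omega>. h (Z \<omega>) \<partial>P)) \<le> L * sqrt (\<integral>\<omega>. (R n \<omega>)\<^sup>2 \<partial>P)" .
    qed
  qed
  define E4 where "E4 = (\<integral>\<omega>. (Z \<omega>) ^ 4 \<partial>P)"
  \<comment> \<open>An inequality with leading factor (1 + s)^3 takes the place of convergence of E
    Y_n^4 and avoids expanding the mixed moments of Z and R_n.\<close>
  have Y4: "(\<integral>\<omega>. (Y n \<omega>) ^ 4 \<partial>P) \<le> (1 + s) ^ 3 * E4 + (1 + 1 / s) ^ 3 * (\<integral>\<omega>. (R n \<omega>) ^ 4 \<partial>P)"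
    if s: "0 < s" for s n
  proof -
    have le: "(Y n \<omega>) ^ 4 \<le> (1 + s) ^ 3 * (Z \<omega>) ^ 4 + (1 + 1 / s) ^ 3 * (R n \<omega>) ^ 4" for \<omega>
      unfolding Y by (rule power4_add_le[OF s])
    have int: "integrable P (\<lambda>\<omega>. (1 + s) ^ 3 * (Z \<omega>) ^ 4 + (1 + 1 / s) ^ 3 * (R n \<omega>) ^ 4)"
      using Z4 R4[of n] by simp
    have [measurable]: "Y n \<in> borel_measurable P" unfolding Y by measurable
    have "integrable P (\<lambda>\<omega>. (Y n \<omega>) ^ 4)"
      by (rule Bochner_Integration.integrable_bound[OF int]) (use le in \<open>auto intro: order_trans[OF _ abs_ge_self]\<close>)
    then have "(\<integral>\<omega>. (Y n \<omega>) ^ 4 \<partial>P) \<le> (\<integral>\<omega>. (1 + s) ^ 3 * (Z \<omega>) ^ 4 + (1 + 1 / s) ^ 3 * (R n \<omega>) ^ 4 \<partial>P)"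
      by (intro integral_mono int le)
    then show ?thesis using Z4 R4[of n] by (simp add: E4_def)
  qed
  let ?l = "\<bar>(\<integral>\<omega>. h (Z \<omega>) \<partial>P) - (\<integral>y. h y \<partial>gauss1)\<bar>"
  \<comment> \<open>Here n tends to infinity with s fixed; s tends to 0 afterwards.\<close>
  have s_bound: "?l \<le> 2 * sqrt (2/3 * ((1 + s) ^ 3 * E4 - 3))" if s: "0 < s" for s
  proof (rule LIMSEQ_le)
    show "(\<lambda>n. \<bar>(\<integral>\<omega>. h (Y n \<omega>) \<partial>P) - (\<integral>y. h y \<partial>gauss1)\<bar>) \<longlonglongrightarrow> ?l"
      by (intro tendsto_rabs tendsto_diff hlim tendsto_const)
    have "(\<lambda>n. 2 * sqrt ((1 - v n)\<^sup>2 + 2/3 * ((1 + s) ^ 3 * E4 + (1 + 1 / s) ^ 3 * (\<integral>\<omega>. (R n \<omega>) ^ 4 \<partial>P) - 3 * (v n)\<^sup>2)))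
      \<longlonglongrightarrow> 2 * sqrt ((1 - 1)\<^sup>2 + 2/3 * ((1 + s) ^ 3 * E4 + (1 + 1 / s) ^ 3 * 0 - 3 * 1\<^sup>2))"
      by (intro tendsto_intros vlim lim4)
    then show "(\<lambda>n. 2 * sqrt ((1 - v n)\<^sup>2 + 2/3 * ((1 + s) ^ 3 * E4 + (1 + 1 / s) ^ 3 * (\<integral>\<omega>. (R n \<omega>) ^ 4 \<partial>P) - 3 * (v n)\<^sup>2)))
      \<longlonglongrightarrow> 2 * sqrt (2/3 * ((1 + s) ^ 3 * E4 - 3))" by simp
    show "\<exists>N. \<forall>n\<ge>N. \<bar>(\<integral>\<omega>. h (Y n \<omega>) \<partial>P) - (\<integral>y. h y \<partial>gauss1)\<bar> \<le>
        2 * sqrt ((1 - v n)\<^sup>2 + 2/3 * ((1 + s) ^ 3 * E4 + (1 + 1 / s) ^ 3 * (\<integral>\<omega>. (R n \<omega>) ^ 4 \<partial>P) - 3 * (v n)\<^sup>2))"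
    proof (intro exI[of _ 0] allI impI)
      fix n
      have "\<bar>(\<integral>\<omega>. h (Y n \<omega>) \<partial>P) - (\<integral>y. h y \<partial>gauss1)\<bar> \<le> 2 * sqrt ((1 - v n)\<^sup>2 + 2/3 * ((\<integral>\<omega>. (Y n \<omega>) ^ 4 \<partial>P) - 3 * (v n)\<^sup>2))"
        unfolding v_def Y_def by (rule tensor_span_stein_bound[OF p q par FG hc h01])
      also have "\<dots> \<le> 2 * sqrt ((1 - v n)\<^sup>2 + 2/3 * ((1 + s) ^ 3 * E4 + (1 + 1 / s) ^ 3 * (\<integral>\<omega>. (R n \<omega>) ^ 4 \<partial>P) - 3 * (v n)\<^sup>2))"
        using Y4[OF s, of n] by simp
      finally show "\<bar>(\<integral>\<omega>. h (Y n \<omega>) \<partial>P) - (\<integral>y. h y \<partial>gauss1)\<bar> \<le>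
        2 * sqrt ((1 - v n)\<^sup>2 + 2/3 * ((1 + s) ^ 3 * E4 + (1 + 1 / s) ^ 3 * (\<integral>\<omega>. (R n \<omega>) ^ 4 \<partial>P) - 3 * (v n)\<^sup>2))" .
    qed
  qed
  show ?thesis
  proof (rule LIMSEQ_le_const)
    have "(\<lambda>k. 1 / real (Suc k)) \<longlonglongrightarrow> 0" by real_asymp
    then have "(\<lambda>k. 2 * sqrt (2/3 * ((1 + 1 / real (Suc k)) ^ 3 * E4 - 3))) \<longlonglongrightarrow> 2 * sqrt (2/3 * ((1 + 0) ^ 3 * E4 - 3))"
      by (intro tendsto_intros)
    then show "(\<lambda>k. 2 * sqrt (2/3 * ((1 + 1 / real (Suc k)) ^ 3 * E4 - 3))) \<longlonglongrightarrow> 2 * sqrt (2/3 * ((\<integral>\<omega>. (Z \<omega>) ^ 4 \<partial>P) - 3))"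
      by (simp add: E4_def)
    show "\<exists>N. \<forall>k\<ge>N. ?l \<le> 2 * sqrt (2/3 * ((1 + 1 / real (Suc k)) ^ 3 * E4 - 3))"
      by (intro exI[of _ 0] allI impI s_bound) simp
  qed
qed

text \<open>The estimate obtained is 2 sqrt(2/3 kappa) = sqrt(8/3 kappa). Nonnegativity of the
  distance serves twice: it is the lower bound in the limit statement, and it shows kappa \<ge> 0,
  so that 8/3 may be enlarged to 6.\<close>

lemma wiener_sum_tv_bound:
  assumes p: "p \<ge> 1" and q: "q \<ge> 1" and par: "odd (p + q)" and f: "f \<in> L2_sym p M" and g: "g \<in> L2_sym q M"
  defines "Z \<equiv> \<lambda>\<omega>. I p f \<omega> + I q g \<omega>"
  assumes Z1: "(\<integral>\<omega>. (Z \<omega>)\<^sup>2 \<partial>P) = 1"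
  shows "tv_dist_std_normal P Z \<le> sqrt (6 * kappa4 P Z)" and "0 \<le> tv_dist_std_normal P Z"
proof -
  have Zm[measurable]: "Z \<in> borel_measurable P"
    unfolding Z_def by (rule wiener_sum_approximation[OF p q f g])
  have D: "real_distribution (distr P borel Z)" by (rule real_distribution_distr) measurable
  have "tv_dist (distr P borel Z) gauss1 \<le> 2 * sqrt (2/3 * kappa4 P Z)"
  proof (rule tv_dist_le_Lipschitz[OF D real_dist_normal_dist])
    fix h :: "real \<Rightarrow> real" and L
    assume h: "\<And>x y. \<bar>h x - h y\<bar> \<le> L * \<bar>x - y\<bar>" "\<And>x. 0 \<le> h x" "\<And>x. h x \<le> 1"
    have [measurable]: "h \<in> borel_measurable borel"
      by (rule borel_measurable_continuous_onI[OF Lipschitz_abs_continuous[OF h(1)]])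
    have "(\<integral>x. h x \<partial>distr P borel Z) = (\<integral>\<omega>. h (Z \<omega>) \<partial>P)" by (rule integral_distr) measurable
    then show "\<bar>(\<integral>x. h x \<partial>distr P borel Z) - (\<integral>y. h y \<partial>gauss1)\<bar> \<le> 2 * sqrt (2/3 * kappa4 P Z)"
      using wiener_sum_Lipschitz_bound[OF p q par f g h] Z1 by (simp add: kappa4_def Z_def)
  qed
  then have b: "tv_dist_std_normal P Z \<le> 2 * sqrt (2/3 * kappa4 P Z)" by (simp add: tv_dist_std_normal_def)
  show n: "0 \<le> tv_dist_std_normal P Z"
    unfolding tv_dist_std_normal_def by (rule tv_dist_nonneg[OF D real_dist_normal_dist])
  \<comment> \<open>The real \<open>sqrt\<close> is negative at negative arguments, so a nonnegative
    value forces a nonnegative fourth cumulant.\<close>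
  have "0 \<le> sqrt (2/3 * kappa4 P Z)" using b n by linarith
  then have k: "0 \<le> kappa4 P Z" by simp
  have "2 * sqrt (2/3 * kappa4 P Z) = sqrt (4 * (2/3 * kappa4 P Z))"
    by (simp only: real_sqrt_mult real_sqrt_four)
  also have "\<dots> \<le> sqrt (6 * kappa4 P Z)" using k by (intro real_sqrt_le_mono) simp
  finally show "tv_dist_std_normal P Z \<le> sqrt (6 * kappa4 P Z)" using b by linarith
qed

end

theorem theorem2p1:
  fixes M :: "'a measure" and P :: "'w measure"
    and W :: "('a \<Rightarrow> real) \<Rightarrow> 'w \<Rightarrow> real"
    and I :: "nat \<Rightarrow> ((nat \<Rightarrow> 'a) \<Rightarrow> real) \<Rightarrow> 'w \<Rightarrow> real"
    and p q :: nat
  assumes "sigma_finite_measure M"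
    and "isonormal_process P M W"
    and "\<And>m. m \<ge> 1 \<Longrightarrow> multiple_wiener_integral P M W m (I m)"
    and "p > 0" and "q > 0" and "p \<noteq> q" and "odd p" and "even q"
  shows
    "(\<forall>f\<in>L2_sym p M. \<forall>g\<in>L2_sym q M. \<forall>X Y Z.
        X = I p f \<longrightarrow> Y = I q g \<longrightarrow> Z = (\<lambda>\<omega>. X \<omega> + Y \<omega>) \<longrightarrow>
        (\<integral>\<omega>. (Z \<omega>)\<^sup>2 \<partial>P) = 1 \<longrightarrow>
        tv_dist_std_normal P Z \<le> sqrt (6 * kappa4 P Z)) \<and>
     (\<forall>f g Z.
        (\<forall>n\<ge>1. f n \<in> L2_sym p M \<and> g n \<in> L2_sym q M \<and>
                Z n = (\<lambda>\<omega>. I p (f n) \<omega> + I q (g n) \<omega>) \<and>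
                (\<integral>\<omega>. (Z n \<omega>)\<^sup>2 \<partial>P) = 1) \<longrightarrow>
        (\<lambda>n::nat. kappa4 P (Z n)) \<longlonglongrightarrow> 0 \<longrightarrow>
        (\<lambda>n. tv_dist_std_normal P (Z n)) \<longlonglongrightarrow> 0)"
proof -
  interpret wiener_chaos P M W I
    using assms(1-3) by (auto simp: wiener_chaos_def wiener_chaos_axioms_def isonormal_process_def)
  have p: "p \<ge> 1" and q: "q \<ge> 1" and par: "odd (p + q)" using assms by auto
  note bound = wiener_sum_tv_bound[OF p q par]
  show ?thesis
  proof (intro conjI allI ballI impI)
    fix f g X Y Z
    assume "f \<in> L2_sym p M" "g \<in> L2_sym q M" "X = I p f" "Y = I q g" "Z = (\<lambda>\<omega>. X \<omega> + Y \<omega>)"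
      "(\<integral>\<omega>. (Z \<omega>)\<^sup>2 \<partial>P) = 1"
    then show "tv_dist_std_normal P Z \<le> sqrt (6 * kappa4 P Z)" using bound(1) by simp
  next
    fix f g Z
    assume *: "\<forall>n\<ge>1. f n \<in> L2_sym p M \<and> g n \<in> L2_sym q M \<and>
                Z n = (\<lambda>\<omega>. I p (f n) \<omega> + I q (g n) \<omega>) \<and> (\<integral>\<omega>. (Z n \<omega>)\<^sup>2 \<partial>P) = 1"
      and k: "(\<lambda>n::nat. kappa4 P (Z n)) \<longlonglongrightarrow> 0"
    have b: "tv_dist_std_normal P (Z n) \<le> sqrt (6 * kappa4 P (Z n)) \<and> 0 \<le> tv_dist_std_normal P (Z n)" if "n \<ge> 1" for n
    proof -
      have a: "f n \<in> L2_sym p M" "g n \<in> L2_sym q M" "(\<integral>\<omega>. (I p (f n) \<omega> + I q (g n) \<omega>)\<^sup>2 \<partial>P) = 1"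
        and Z: "Z n = (\<lambda>\<omega>. I p (f n) \<omega> + I q (g n) \<omega>)"
        using *[rule_format, OF that] by auto
      show ?thesis unfolding Z using bound[OF a] by blast
    qed
    show "(\<lambda>n. tv_dist_std_normal P (Z n)) \<longlonglongrightarrow> 0"
    \<comment> \<open>The hypotheses start at n = 1 and leave \<open>Z 0\<close> arbitrary, so both
      bounds hold eventually.\<close>
    proof (rule tendsto_sandwich[OF _ _ tendsto_const])
      show "\<forall>\<^sub>F n in sequentially. 0 \<le> tv_dist_std_normal P (Z n)"
        using b by (intro eventually_sequentiallyI[of 1]) auto
      show "\<forall>\<^sub>F n in sequentially. tv_dist_std_normal P (Z n) \<le> sqrt (6 * kappa4 P (Z n))"
        using b by (intro eventually_sequentiallyI[of 1]) auto
      show "(\<lambda>n. sqrt (6 * kappa4 P (Z n))) \<longlonglongrightarrow> 0"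
        using tendsto_real_sqrt[OF tendsto_mult[OF tendsto_const k, of 6]] by simp
    qed
  qed
qed

end
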